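(* Assume that $a\in L^2(x_0,\infty)$, $a(pa')'\in L^1(x_0,\infty)$ and $\lim_{x\to\infty}p(x)a'(x)a(x)=0$. For $\omega\in\mathbb{T}=\{\omega\in\mathbb{C}:|\omega|=1\}$ let $H_\omega$ be the restriction of $H_{\max}$ to the domain $$\mathcal{D}(H_\omega)=\{u\in\mathcal{D}(H_{\max}):\ s_+(u)=\omega\,s_-(u)\}.$$ Then for all $\omega\in\mathbb{T}$ the operators $H_\omega$ are self-adjoint. Conversely, every operator $H$ such that $H_{\min}\subset H=H^*\subset H_{\max}$ equals $H_\omega$ for some $\omega\in\mathbb{T}$.
   Context: $\mathbb{R}_+=(0,\infty)$. Standing assumptions: $p\in C^1(\mathbb{R}_+)$ and $q\in C(\mathbb{R}_+)$ are real-valued with finite limits as $x\to0$, and $p(x)>0$ for all $x\ge0$. Fix $x_0>0$ with $q(x)>0$ for $x\ge x_0$; for $x\ge x_0$ put $a(x)=(p(x)q(x))^{-1/4}$, $\xi(x)=\sqrt{q(x)/p(x)}$, $\Xi(x)=\int_{x_0}^x\xi(y)\,dy$, where $a\in C^1([x_0,\infty))$ with $a'$ locally absolutely continuous. Differential expression: $(\mathsf{H}u)(x)=-(p(x)u'(x))'-q(x)u(x)$. Boundary condition with fixed $\alpha\in\mathbb{R}\cup\{\infty\}$: $u'(0)=\alpha u(0)$, understood as $u(0)=0$ if $\alpha=\infty$ (here $u(0),u'(0)$ are limits as $x\to+0$). The operator $H_{00}$ in $L^2(\mathbb{R}_+)$ acts as $H_{00}u=\mathsf{H}u$ on the functions $u\in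 C^2(\mathbb{R}_+)$ with $\mathsf{H}u\in L^2(\mathbb{R}_+)$ that vanish for sufficiently large $x$, have limits $u(+0),u'(+0)$ and satisfy the boundary condition. $H_{\min}$ is the closure of $H_{00}$, and $H_{\max}=H_{\min}^*$. The operator $H_{\max}$ acts as $H_{\max}u=\mathsf{H}u$ on the set $\mathcal{D}(H_{\max})$ of all $u$ in the local Sobolev space $\mathbb{H}^2_{\rm loc}(\mathbb{R}_+)$ such that $u\in L^2(\mathbb{R}_+)$, $\mathsf{H}u\in L^2(\mathbb{R}_+)$ and $u$ satisfies the boundary condition. Under the assumptions of the claim every $u\in\mathcal{D}(H_{\max})$ has asymptotics $u(x)=a(x)\big(s_+e^{i\Xi(x)}+s_-e^{-i\Xi(x)}+o(1)\big)$ as $x\to\infty$ with uniquely determined coefficients $s_\pm=s_\pm(u)\in\mathbb{C}$; this defines $s_\pm(u)$. *)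

theory Defs
  imports "HOL-Analysis.Analysis"
begin

section \<open>The Hilbert space \<open>L\<^sup>2(0,\<infinity>)\<close>\<close>

abbreviation halfline :: "real measure" where
  "halfline \<equiv> lebesgue_on {0<..}"

definition square_integrable :: "(real \<Rightarrow> complex) \<Rightarrow> bool" where
  "square_integrable f \<longleftrightarrow>
     f \<in> borel_measurable halfline \<and> integrable halfline (\<lambda>x. (cmod (f x))\<^sup>2)"

lemma borel_measurable_cnj [measurable]: "cnj \<in> borel_measurable borel"
  by (intro borel_measurable_continuous_onI continuous_intros)

lemma square_integrable_prod:
  assumes "square_integrable f" "square_integrable g"
  shows "integrable halfline (\<lambda>x. f x * cnj (g x))"
proof (rule Bochner_Integration.integrable_bound)
  show "integrable halfline (\<lambda>x. (cmod (f x))\<^sup>2 + (cmod (g x))\<^sup>2)"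
    using assms by (auto simp: square_integrable_def)
  have [measurable]: "f \<in> borel_measurable halfline" "g \<in> borel_measurable halfline"
    using assms by (auto simp: square_integrable_def)
  show "(\<lambda>x. f x * cnj (g x)) \<in> borel_measurable halfline"
    by measurable
  have "cmod (f x) * cmod (g x) \<le> (cmod (f x))\<^sup>2 + (cmod (g x))\<^sup>2" for x
  proof -
    have "0 \<le> cmod (f x) * cmod (g x)" by simp
    then show ?thesis
      using sum_squares_bound[of "cmod (f x)" "cmod (g x)"] by linarith
  qed
  then show "AE x in halfline. norm (f x * cnj (g x)) \<le> norm ((cmod (f x))\<^sup>2 + (cmod (g x))\<^sup>2)"
    by (simp add: norm_mult)
qed

lemma square_integrable_zero: "square_integrable (\<lambda>x. 0)"
  by (simp add: square_integrable_def)

lemma square_integrable_cmult: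
  assumes "square_integrable f"
  shows "square_integrable (\<lambda>x. c * f x)"
  using assms by (auto simp: square_integrable_def norm_mult power_mult_distrib)

lemma square_integrable_add:
  assumes "square_integrable f" "square_integrable g"
  shows "square_integrable (\<lambda>x. f x + g x)"
proof -
  have [measurable]: "f \<in> borel_measurable halfline" "g \<in> borel_measurable halfline"
    using assms by (auto simp: square_integrable_def)
  have "integrable halfline (\<lambda>x. (cmod (f x + g x))\<^sup>2)"
  proof (rule Bochner_Integration.integrable_bound)
    show "integrable halfline (\<lambda>x. 2 * ((cmod (f x))\<^sup>2 + (cmod (g x))\<^sup>2))"
      using assms by (auto simp: square_integrable_def)
    have "(cmod (f x + g x))\<^sup>2 \<le> 2 * ((cmod (f x))\<^sup>2 + (cmod (g x))\<^sup>2)" for x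
    proof -
      have "(cmod (f x + g x))\<^sup>2 \<le> (cmod (f x) + cmod (g x))\<^sup>2"
        by (simp add: norm_triangle_ineq power_mono)
      also have "\<dots> \<le> 2 * ((cmod (f x))\<^sup>2 + (cmod (g x))\<^sup>2)"
        using sum_squares_bound[of "cmod (f x)" "cmod (g x)"] by (simp add: power2_sum)
      finally show ?thesis .
    qed
    then show "AE x in halfline. norm ((cmod (f x + g x))\<^sup>2)
        \<le> norm (2 * ((cmod (f x))\<^sup>2 + (cmod (g x))\<^sup>2))"
      by simp
  qed measurable
  then show ?thesis by (simp add: square_integrable_def)
qed

definition L2_eq :: "(real \<Rightarrow> complex) \<Rightarrow> (real \<Rightarrow> complex) \<Rightarrow> bool" where
  "L2_eq f g \<longleftrightarrow> square_integrable f \<and> square_integrable g \<and> (AE x in halfline. f x = g x)"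

lemma L2_eq_part_equivp: "part_equivp L2_eq"
proof (rule part_equivpI)
  show "\<exists>f. L2_eq f f"
    using square_integrable_zero by (auto simp: L2_eq_def)
  show "symp L2_eq"
    by (auto simp: symp_def L2_eq_def elim: eventually_mono)
  show "transp L2_eq"
    unfolding transp_def L2_eq_def by (auto elim: eventually_elim2)
qed

quotient_type L2 = "real \<Rightarrow> complex" / partial: L2_eq
  by (rule L2_eq_part_equivp)

text \<open>\<open>L2_of f\<close> is the class of \<open>f\<close>; it is meaningful only for square integrable \<open>f\<close>.\<close>

abbreviation L2_of :: "(real \<Rightarrow> complex) \<Rightarrow> L2" where
  "L2_of \<equiv> abs_L2"

lift_definition cscale :: "complex \<Rightarrow> L2 \<Rightarrow> L2" is "\<lambda>c f x. c * f x"
  by (auto simp: L2_eq_def square_integrable_cmult elim: eventually_mono)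

lift_definition cinner :: "L2 \<Rightarrow> L2 \<Rightarrow> complex"
  is "\<lambda>f g. integral\<^sup>L halfline (\<lambda>x. f x * cnj (g x))"
proof -
  fix f f' g g' assume "L2_eq f f'" "L2_eq g g'"
  then have [measurable]: "f \<in> borel_measurable halfline" "g \<in> borel_measurable halfline"
      "f' \<in> borel_measurable halfline" "g' \<in> borel_measurable halfline"
    and ae: "AE x in halfline. f x = f' x" "AE x in halfline. g x = g' x"
    by (auto simp: L2_eq_def square_integrable_def)
  show "integral\<^sup>L halfline (\<lambda>x. f x * cnj (g x)) = integral\<^sup>L halfline (\<lambda>x. f' x * cnj (g' x))"
    by (rule integral_cong_AE) (use ae in \<open>auto elim: eventually_elim2\<close>)
qed

instantiation L2 :: real_vector
begin

lift_definition zero_L2 :: L2 is "\<lambda>x. 0"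
  by (simp add: L2_eq_def square_integrable_zero)

lift_definition plus_L2 :: "L2 \<Rightarrow> L2 \<Rightarrow> L2" is "\<lambda>f g x. f x + g x"
  by (auto simp: L2_eq_def square_integrable_add elim: eventually_elim2)

definition scaleR_L2 :: "real \<Rightarrow> L2 \<Rightarrow> L2" where
  "scaleR_L2 r u = cscale (complex_of_real r) u"

definition uminus_L2 :: "L2 \<Rightarrow> L2" where
  "uminus_L2 u = cscale (-1) u"

definition minus_L2 :: "L2 \<Rightarrow> L2 \<Rightarrow> L2" where
  "minus_L2 u v = u + cscale (-1) v"

instance
proof
  fix u v w :: L2 and r s :: real
  show "u + v + w = u + (v + w)"
    by transfer (auto simp: L2_eq_def square_integrable_add algebra_simps)
  show "u + v = v + u"
    by transfer (auto simp: L2_eq_def square_integrable_add algebra_simps)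
  show "0 + u = u"
    by transfer (auto simp: L2_eq_def)
  show "- u + u = 0"
    unfolding uminus_L2_def by transfer (auto simp: L2_eq_def square_integrable_zero)
  show "u - v = u + - v"
    by (simp add: minus_L2_def uminus_L2_def)
  show "r *\<^sub>R (u + v) = r *\<^sub>R u + r *\<^sub>R v"
    unfolding scaleR_L2_def
    by transfer (auto simp: L2_eq_def square_integrable_add square_integrable_cmult distrib_left)
  show "(r + s) *\<^sub>R u = r *\<^sub>R u + s *\<^sub>R u"
    unfolding scaleR_L2_def
    by transfer
      (auto simp: L2_eq_def square_integrable_add square_integrable_cmult distrib_right)
  show "r *\<^sub>R s *\<^sub>R u = (r * s) *\<^sub>R u"
    unfolding scaleR_L2_def
    by transfer (auto simp: L2_eq_def square_integrable_cmult mult.assoc)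
  show "1 *\<^sub>R u = u"
    unfolding scaleR_L2_def by transfer (auto simp: L2_eq_def)
qed

end

lemma cinner_add_left: "cinner (u + v) w = cinner u w + cinner v w"
  by transfer (auto simp: L2_eq_def distrib_right square_integrable_prod)

lemma cinner_cscale_left: "cinner (cscale c u) v = c * cinner u v"
  by transfer (auto simp: L2_eq_def mult.assoc)

lemma cinner_commute: "cinner u v = cnj (cinner v u)"
proof transfer
  fix f g :: "real \<Rightarrow> complex"
  have "integral\<^sup>L halfline (\<lambda>x. f x * cnj (g x)) = integral\<^sup>L halfline (\<lambda>x. cnj (g x * cnj (f x)))"
    by (rule Bochner_Integration.integral_cong) auto
  also have "\<dots> = cnj (integral\<^sup>L halfline (\<lambda>x. g x * cnj (f x)))"
    by (rule Bochner_Integration.integral_cnj)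
  finally show "integral\<^sup>L halfline (\<lambda>x. f x * cnj (g x)) =
      cnj (integral\<^sup>L halfline (\<lambda>x. g x * cnj (f x)))" .
qed

lemma Re_integral_mult_cnj:
  "Re (integral\<^sup>L halfline (\<lambda>x. f x * cnj (f x))) = integral\<^sup>L halfline (\<lambda>x. (cmod (f x))\<^sup>2)"
proof -
  have "(\<lambda>x. f x * cnj (f x)) = (\<lambda>x. complex_of_real ((cmod (f x))\<^sup>2))"
    by (simp only: complex_norm_square)
  then show ?thesis
    by (simp only: integral_complex_of_real Re_complex_of_real)
qed

lemma cinner_self_nonneg: "0 \<le> Re (cinner u u)"
  by transfer (simp only: Re_integral_mult_cnj, simp)

lemma cinner_self_eq_0: "Re (cinner u u) = 0 \<longleftrightarrow> u = 0"
proof transfer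
  fix f assume "L2_eq f f"
  then have f: "square_integrable f" by (simp add: L2_eq_def)
  have "integral\<^sup>L halfline (\<lambda>x. (cmod (f x))\<^sup>2) = 0 \<longleftrightarrow> (AE x in halfline. (cmod (f x))\<^sup>2 = 0)"
    by (rule integral_nonneg_eq_0_iff_AE) (use f in \<open>auto simp: square_integrable_def\<close>)
  also have "\<dots> \<longleftrightarrow> L2_eq f (\<lambda>x. 0)"
    using f by (simp add: L2_eq_def square_integrable_zero)
  finally show "(Re (integral\<^sup>L halfline (\<lambda>x. f x * cnj (f x))) = 0) = L2_eq f (\<lambda>x. 0)"
    by (simp only: Re_integral_mult_cnj)
qed

instantiation L2 :: real_inner
begin

definition inner_L2 :: "L2 \<Rightarrow> L2 \<Rightarrow> real" where
  "inner_L2 u v = Re (cinner u v)"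

definition norm_L2 :: "L2 \<Rightarrow> real" where
  "norm_L2 u = sqrt (inner u u)"

definition sgn_L2 :: "L2 \<Rightarrow> L2" where
  "sgn_L2 u = u /\<^sub>R norm u"

definition dist_L2 :: "L2 \<Rightarrow> L2 \<Rightarrow> real" where
  "dist_L2 u v = norm (u - v)"

definition uniformity_L2 :: "(L2 \<times> L2) filter" where
  "uniformity_L2 = (INF e\<in>{0<..}. principal {(x, y). dist x y < e})"

definition open_L2 :: "L2 set \<Rightarrow> bool" where
  "open_L2 U = (\<forall>x\<in>U. eventually (\<lambda>(x', y). x' = x \<longrightarrow> y \<in> U) uniformity)"

instance
proof
  fix u v w :: L2 and r :: real and U :: "L2 set"
  show "dist u v = norm (u - v)" by (rule dist_L2_def)
  show "sgn u = u /\<^sub>R norm u" by (rule sgn_L2_def)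
  show "uniformity = (INF e\<in>{0<..}. principal {(x, y :: L2). dist x y < e})"
    by (rule uniformity_L2_def)
  show "open U = (\<forall>x\<in>U. eventually (\<lambda>(x', y). x' = x \<longrightarrow> y \<in> U) uniformity)"
    by (rule open_L2_def)
  show "inner u v = inner v u"
    using cinner_commute[of u v] by (simp add: inner_L2_def)
  show "inner (u + v) w = inner u w + inner v w"
    by (simp add: inner_L2_def cinner_add_left)
  show "inner (r *\<^sub>R u) v = r * inner u v"
    by (simp add: inner_L2_def scaleR_L2_def cinner_cscale_left)
  show "0 \<le> inner u u" by (simp add: inner_L2_def cinner_self_nonneg)
  show "inner u u = 0 \<longleftrightarrow> u = 0" by (simp add: inner_L2_def cinner_self_eq_0)
  show "norm u = sqrt (inner u u)" by (rule norm_L2_def)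
qed

end

section \<open>Unbounded operators in \<open>L\<^sup>2(0,\<infinity>)\<close>, represented by their graphs\<close>

definition linear_operator :: "(L2 \<times> L2) set \<Rightarrow> bool" where
  "linear_operator T \<longleftrightarrow>
     (0, 0) \<in> T \<and>
     (\<forall>(u, f)\<in>T. \<forall>(v, g)\<in>T. (u + v, f + g) \<in> T) \<and>
     (\<forall>c. \<forall>(u, f)\<in>T. (cscale c u, cscale c f) \<in> T) \<and>
     single_valued T"

text \<open>For a densely defined operator this is the graph of the adjoint operator.\<close>

definition adjoint_op :: "(L2 \<times> L2) set \<Rightarrow> (L2 \<times> L2) set" where
  "adjoint_op T = {(v, g). \<forall>(u, f)\<in>T. cinner f v = cinner u g}"

definition self_adjoint_op :: "(L2 \<times> L2) set \<Rightarrow> bool" where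
  "self_adjoint_op T \<longleftrightarrow>
     linear_operator T \<and> closure (Domain T) = UNIV \<and> adjoint_op T = T"

section \<open>The Sturm--Liouville operators\<close>

abbreviation vderiv :: "(real \<Rightarrow> 'a::real_normed_vector) \<Rightarrow> real \<Rightarrow> 'a" where
  "vderiv f x \<equiv> vector_derivative f (at x)"

definition SL_expr :: "(real \<Rightarrow> real) \<Rightarrow> (real \<Rightarrow> real) \<Rightarrow> (real \<Rightarrow> complex) \<Rightarrow> real \<Rightarrow> complex" where
  "SL_expr p q u x = - vderiv (\<lambda>y. complex_of_real (p y) * vderiv u y) x - complex_of_real (q x) * u x"

text \<open>The boundary parameter ranges over \<open>\<real> \<union> {\<infinity>}\<close>, with \<open>None\<close> for \<open>\<infinity>\<close>;
  \<open>u0\<close> and \<open>u1\<close> stand for \<open>u(+0)\<close> and \<open>u'(+0)\<close>.\<close>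

definition boundary_cond :: "real option \<Rightarrow> complex \<Rightarrow> complex \<Rightarrow> bool" where
  "boundary_cond \<alpha> u0 u1 \<longleftrightarrow>
     (case \<alpha> of None \<Rightarrow> u0 = 0 | Some r \<Rightarrow> u1 = complex_of_real r * u0)"

definition H00 :: "(real \<Rightarrow> real) \<Rightarrow> (real \<Rightarrow> real) \<Rightarrow> real option \<Rightarrow> (L2 \<times> L2) set" where
  "H00 p q \<alpha> = {(L2_of u, L2_of (SL_expr p q u)) | u.
     u C1_differentiable_on {0<..} \<and> vderiv u C1_differentiable_on {0<..} \<and>
     square_integrable u \<and> square_integrable (SL_expr p q u) \<and>
     (\<exists>R. \<forall>x>0. x \<ge> R \<longrightarrow> u x = 0) \<and>
     (\<exists>u0 u1. (u \<longlongrightarrow> u0) (at_right 0) \<and> (vderiv u \<longlongrightarrow> u1) (at_right 0) \<and>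
        boundary_cond \<alpha> u0 u1)}"

definition H_min :: "(real \<Rightarrow> real) \<Rightarrow> (real \<Rightarrow> real) \<Rightarrow> real option \<Rightarrow> (L2 \<times> L2) set" where
  "H_min p q \<alpha> = closure (H00 p q \<alpha>)"

definition H_max :: "(real \<Rightarrow> real) \<Rightarrow> (real \<Rightarrow> real) \<Rightarrow> real option \<Rightarrow> (L2 \<times> L2) set" where
  "H_max p q \<alpha> = adjoint_op (H_min p q \<alpha>)"

section \<open>Asymptotic coefficients\<close>

definition amp :: "(real \<Rightarrow> real) \<Rightarrow> (real \<Rightarrow> real) \<Rightarrow> real \<Rightarrow> real" where
  "amp p q x = (p x * q x) powr (- 1 / 4)"

definition phase :: "(real \<Rightarrow> real) \<Rightarrow> (real \<Rightarrow> real) \<Rightarrow> real \<Rightarrow> real \<Rightarrow> real" where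
  "phase p q x0 x = integral {x0..x} (\<lambda>y. sqrt (q y / p y))"

text \<open>An element of \<open>L\<^sup>2\<close> is a class of functions, whereas the asymptotic formula concerns
  pointwise values: it refers to the continuous representative, which is unique if it exists.\<close>

definition has_asymptotics ::
  "(real \<Rightarrow> real) \<Rightarrow> (real \<Rightarrow> real) \<Rightarrow> real \<Rightarrow> L2 \<Rightarrow> complex \<Rightarrow> complex \<Rightarrow> bool" where
  "has_asymptotics p q x0 u s\<^sub>p s\<^sub>m \<longleftrightarrow>
     (\<exists>f r. square_integrable f \<and> L2_of f = u \<and> continuous_on {0<..} f \<and>
        (r \<longlongrightarrow> 0) at_top \<and>
        (\<forall>x\<ge>x0. f x = complex_of_real (amp p q x) *
           (s\<^sub>p * exp (\<i> * complex_of_real (phase p q x0 x)) +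
            s\<^sub>m * exp (- \<i> * complex_of_real (phase p q x0 x)) + r x)))"

definition s_plus :: "(real \<Rightarrow> real) \<Rightarrow> (real \<Rightarrow> real) \<Rightarrow> real \<Rightarrow> L2 \<Rightarrow> complex" where
  "s_plus p q x0 u = fst (THE (s\<^sub>p, s\<^sub>m). has_asymptotics p q x0 u s\<^sub>p s\<^sub>m)"

definition s_minus :: "(real \<Rightarrow> real) \<Rightarrow> (real \<Rightarrow> real) \<Rightarrow> real \<Rightarrow> L2 \<Rightarrow> complex" where
  "s_minus p q x0 u = snd (THE (s\<^sub>p, s\<^sub>m). has_asymptotics p q x0 u s\<^sub>p s\<^sub>m)"

definition H_omega ::
  "(real \<Rightarrow> real) \<Rightarrow> (real \<Rightarrow> real) \<Rightarrow> real option \<Rightarrow> real \<Rightarrow> complex \<Rightarrow> (L2 \<times> L2) set" where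
  "H_omega p q \<alpha> x0 \<omega> =
     {(u, f) \<in> H_max p q \<alpha>. s_plus p q x0 u = \<omega> * s_minus p q x0 u}"

section \<open>Local absolute continuity\<close>

definition abs_continuous_on_interval :: "real \<Rightarrow> real \<Rightarrow> (real \<Rightarrow> real) \<Rightarrow> bool" where
  "abs_continuous_on_interval c d f \<longleftrightarrow>
     (\<forall>\<epsilon>>0. \<exists>\<delta>>0. \<forall>I::(real \<times> real) set.
        finite I \<and> (\<forall>(s, t)\<in>I. c \<le> s \<and> s \<le> t \<and> t \<le> d) \<and>
        disjoint_family_on (\<lambda>(s, t). {s<..<t}) I \<and> (\<Sum>(s, t)\<in>I. t - s) < \<delta>
        \<longrightarrow> (\<Sum>(s, t)\<in>I. \<bar>f t - f s\<bar>) < \<epsilon>)"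

definition locally_abs_continuous_on :: "real set \<Rightarrow> (real \<Rightarrow> real) \<Rightarrow> bool" where
  "locally_abs_continuous_on S f \<longleftrightarrow>
     (\<forall>c d. c \<le> d \<and> {c..d} \<subseteq> S \<longrightarrow> abs_continuous_on_interval c d f)"

end

theory Submission
  imports Defs
begin

text \<open>
  Write \<open>\<tau> u = - (p u')' - q u\<close>.  The assumptions put \<open>\<tau>\<close> into the limit circle case at infinity:
  every solution of \<open>\<tau> u = 0\<close> behaves like \<open>a (s e\<^sup>i\<^sup>\<Xi> + s' e\<^sup>-\<^sup>i\<^sup>\<Xi>)\<close> and is therefore square integrable
  together with \<open>a\<close>.  Three facts follow from this and give the theorem.

  \<^emph>\<open>Asymptotics.\<close>  For a real solution \<open>u\<close> put \<open>y = u / a\<close> and \<open>z = p a\<^sup>2 y' = a p u' - p a' u\<close>.  Then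
  \<open>y' = \<xi> z\<close> and \<open>z' = - (\<xi> + r) y\<close> with \<open>r = a (p a')'\<close> integrable, so in coordinates that rotate
  with the phase \<open>\<Xi>\<close> the pair \<open>(y, z)\<close> has an integrable derivative and converges
  (\<open>rotated_convergent\<close>, \<open>solution_asymptotics\<close>).  The derivative of \<open>p a'\<close> exists only almost
  everywhere, hence this integration rests on the fundamental theorem of calculus for absolutely
  continuous functions.  The amplitudes are unique because \<open>\<Xi>\<close> tends to infinity.

  \<^emph>\<open>The maximal operator.\<close>  Let \<open>\<phi>\<close> and \<open>\<theta>\<close> be real solutions of \<open>\<tau> u = 0\<close> with Wronskian \<open>-1\<close>, where
  \<open>\<phi>\<close> satisfies the boundary condition at \<open>0\<close>.  Since both are square integrable, variation of
  constants yields an everywhere defined symmetric operator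
  \<open>(G g)(x) = \<theta>(x) \<integral>\<^sub>0\<^sup>x \<phi> g + \<phi>(x) \<integral>\<^sub>x\<^sup>\<infinity> \<theta> g\<close>.  It inverts \<open>H\<^sub>0\<^sub>0\<close>, and \<open>G f\<close> belongs to the domain of \<open>H\<^sub>0\<^sub>0\<close>
  for every continuous \<open>f\<close> of compact support with \<open>f \<bottom> \<phi>\<close>.  As such \<open>f\<close> are dense in the orthogonal
  complement of \<open>\<phi>\<close>, taking adjoints gives \<open>H\<^sub>m\<^sub>a\<^sub>x = {(G g + c \<phi>, g)}\<close> (\<open>H_max_eq\<close>).  The
  asymptotic coefficients of \<open>u = G g + c \<phi>\<close> are \<open>s\<^sub>\<plusminus>(u) = \<langle>g, \<phi>\<rangle> s\<^sub>\<plusminus>(\<theta>) + c s\<^sub>\<plusminus>(\<phi>)\<close>, and symmetry of \<open>G\<close> turns into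
  \<open>\<langle>H\<^sub>m\<^sub>a\<^sub>x u, v\<rangle> - \<langle>u, H\<^sub>m\<^sub>a\<^sub>x v\<rangle> = \<kappa> (s\<^sub>+(u) cnj s\<^sub>+(v) - s\<^sub>-(u) cnj s\<^sub>-(v))\<close> with \<open>\<kappa> \<noteq> 0\<close>.

  \<^emph>\<open>Boundary values.\<close>  The map \<open>u \<mapsto> (s\<^sub>+(u), s\<^sub>-(u))\<close> is onto \<open>\<complex>\<^sup>2\<close> because the coefficients of \<open>\<phi>\<close>
  and \<open>\<theta>\<close> inherit independence from the Wronskian.  Self-adjoint restrictions of \<open>H\<^sub>m\<^sub>a\<^sub>x\<close> therefore
  correspond to subspaces of \<open>\<complex>\<^sup>2\<close> that coincide with their orthogonal complement for the Hermitian
  form \<open>s\<^sub>+ cnj t\<^sub>+ - s\<^sub>- cnj t\<^sub>-\<close>, and these are exactly the lines \<open>s\<^sub>+ = \<omega> s\<^sub>-\<close> with \<open>|\<omega>| = 1\<close>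
  (locale \<open>boundary_pair\<close>).
\<close>

section \<open>Indefinite integrals on half-lines\<close>

lemma integrable_on_Icc:
  fixes f :: "real \<Rightarrow> 'a::euclidean_space"
  assumes "integrable (lebesgue_on {c<..}) f"
  shows "f absolutely_integrable_on {c..d}"
proof -
  have "f absolutely_integrable_on {c<..}"
    using assms by (simp add: set_integrable_def integrable_restrict_space)
  then have "f absolutely_integrable_on {c<..} \<inter> {c..d}"
    by (rule set_integrable_subset) auto
  moreover have "{c<..} \<inter> {c..d} = {c..d} - {c}" by auto
  ultimately show ?thesis
    using absolutely_integrable_spike_set_eq[of "{c..d} - {c}" "{c..d}" f]
    by (auto intro: negligible_subset[of "{c}"])
qed

lemma integral_Icc_eq_indicator:
  fixes f :: "real \<Rightarrow> 'a::euclidean_space"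
  assumes f: "integrable (lebesgue_on {c<..}) f"
  shows "integral {c..d} f = integral\<^sup>L (lebesgue_on {c<..}) (\<lambda>x. indicat_real {c<..d} x *\<^sub>R f x)"
proof -
  have i: "integrable (lebesgue_on {c<..}) (\<lambda>x. indicat_real {c<..d} x *\<^sub>R f x)"
    using f by (intro Bochner_Integration.integrable_mult_indicator) (auto simp: sets_restrict_space_iff)
  have "integral\<^sup>L (lebesgue_on {c<..}) (\<lambda>x. indicat_real {c<..d} x *\<^sub>R f x)
      = integral {c<..} (\<lambda>x. indicat_real {c<..d} x *\<^sub>R f x)"
    by (rule lebesgue_integral_eq_integral[OF i]) auto
  also have "\<dots> = integral {c<..} (\<lambda>x. if x \<in> {c<..d} then f x else 0)"
    by (rule Henstock_Kurzweil_Integration.integral_cong) (auto simp: indicator_def)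
  also have "\<dots> = integral ({c<..d} \<inter> {c<..}) f" by (rule Henstock_Kurzweil_Integration.integral_restrict_Int)
  also have "\<dots> = integral {c..d} f"
    by (rule integral_spike_set) (auto intro: negligible_subset[of "{c}"])
  finally show ?thesis by simp
qed

lemma integral_Icc_tendsto:
  fixes f :: "real \<Rightarrow> 'a::euclidean_space"
  assumes f: "integrable (lebesgue_on {c<..}) f"
  shows "((\<lambda>d. integral {c..d} f) \<longlongrightarrow> integral\<^sup>L (lebesgue_on {c<..}) f) at_top"
proof -
  have fm: "f \<in> borel_measurable (lebesgue_on {c<..})" using f by simp
  have "((\<lambda>d. integral\<^sup>L (lebesgue_on {c<..}) (\<lambda>x. indicat_real {c<..d} x *\<^sub>R f x)) \<longlongrightarrow> integral\<^sup>L (lebesgue_on {c<..}) f) at_top"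
  proof (rule integral_dominated_convergence_at_top[where w = "\<lambda>x. norm (f x)"])
    show "(\<lambda>x. indicat_real {c<..d} x *\<^sub>R f x) \<in> borel_measurable (lebesgue_on {c<..})" for d
      using fm by (intro borel_measurable_scaleR borel_measurable_indicator) (auto simp: sets_restrict_space_iff)
    show "AE x in lebesgue_on {c<..}. ((\<lambda>d. indicat_real {c<..d} x *\<^sub>R f x) \<longlongrightarrow> f x) at_top"
    proof (rule AE_I2)
      fix x assume "x \<in> space (lebesgue_on {c<..})"
      then show "((\<lambda>d. indicat_real {c<..d} x *\<^sub>R f x) \<longlongrightarrow> f x) at_top"
        by (intro tendsto_eventually eventually_mono[OF eventually_ge_at_top[of x]]) auto
    qed
    show "\<forall>\<^sub>F d in at_top. AE x in lebesgue_on {c<..}. norm (indicat_real {c<..d} x *\<^sub>R f x) \<le> norm (f x)"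
      by (auto intro!: always_eventually AE_I2 simp: indicator_def)
  qed (use f in auto)
  then show ?thesis using integral_Icc_eq_indicator[OF f] by simp
qed

lemma integrable_lebesgue_on_subset:
  fixes f :: "real \<Rightarrow> 'a::euclidean_space"
  assumes f: "integrable (lebesgue_on S) f" and "T \<subseteq> S" "S \<in> sets lebesgue" "T \<in> sets lebesgue"
  shows "integrable (lebesgue_on T) f"
proof -
  have "set_integrable lebesgue S f" using assms by (simp add: set_integrable_def integrable_restrict_space)
  then have "set_integrable lebesgue T f" using assms by (auto intro: set_integrable_subset)
  then show ?thesis using assms by (simp add: set_integrable_def integrable_restrict_space)
qed

lemma C1_imp_lipschitz_Icc:
  fixes G :: "real \<Rightarrow> real"
  assumes d: "\<And>x. x \<in> {c..d} \<Longrightarrow> (G has_real_derivative G' x) (at x)"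
    and c: "continuous_on {c..d} G'"
  obtains L where "L \<ge> 0" "\<And>s t. \<lbrakk>c \<le> s; s \<le> t; t \<le> d\<rbrakk> \<Longrightarrow> \<bar>G t - G s\<bar> \<le> L * (t - s)"
proof -
  have "bounded (G' ` {c..d})" by (intro compact_imp_bounded compact_continuous_image c) simp
  then obtain L where L: "L > 0" "\<And>x. x \<in> {c..d} \<Longrightarrow> \<bar>G' x\<bar> \<le> L" by (auto simp: bounded_pos)
  show ?thesis
  proof (rule that[of L])
    fix s t assume st: "c \<le> s" "s \<le> t" "t \<le> d"
    have "norm (G t - G s) \<le> L * norm (t - s)"
    proof (rule field_differentiable_bound[of "{s..t}" G G' L])
      show "(G has_field_derivative G' x) (at x within {s..t})" if "x \<in> {s..t}" for x
        using d[of x] that st by (auto intro: has_field_derivative_at_within)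
    qed (use st L in auto)
    then show "\<bar>G t - G s\<bar> \<le> L * (t - s)" using st by simp
  qed (use L in auto)
qed

lemma continuous_on_integral_Icc:
  fixes f :: "real \<Rightarrow> complex"
  assumes f: "integrable halfline f"
  shows "continuous_on {0..} (\<lambda>x. integral {0..x} f)"
  unfolding continuous_on_eq_continuous_within
proof
  fix x :: real assume x: "x \<in> {0..}"
  have "f absolutely_integrable_on {0..x+1}" by (rule integrable_on_Icc[OF f])
  then have "continuous_on {0..x+1} (\<lambda>x. integral {0..x} f)"
    by (intro indefinite_integral_continuous_1) (simp add: set_lebesgue_integral_eq_integral(1))
  then have "continuous (at x within {0..x+1}) (\<lambda>x. integral {0..x} f)"
    using x by (auto simp: continuous_on_eq_continuous_within)
  also have "at x within {0..x+1} = at x within {0..}"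
    by (rule at_within_nhd[of x "{..<x+1}"]) auto
  finally show "continuous (at x within {0..}) (\<lambda>x. integral {0..x} f)" .
qed

lemma norm_integral_Icc_le:
  fixes f :: "real \<Rightarrow> complex"
  assumes f: "integrable halfline f"
  shows "cmod (integral {0..x} f) \<le> integral\<^sup>L halfline (\<lambda>x. cmod (f x))"
proof -
  have i: "integrable halfline (\<lambda>y. indicat_real {0<..x} y *\<^sub>R f y)"
    using f by (intro integrable_mult_indicator) (auto simp: sets_restrict_space_iff)
  have "cmod (integral\<^sup>L halfline (\<lambda>y. indicat_real {0<..x} y *\<^sub>R f y))
      \<le> integral\<^sup>L halfline (\<lambda>y. cmod (indicat_real {0<..x} y *\<^sub>R f y))" by (rule integral_norm_bound)
  also have "\<dots> \<le> integral\<^sup>L halfline (\<lambda>y. cmod (f y))"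
    by (rule integral_mono[OF Bochner_Integration.integrable_norm[OF i] Bochner_Integration.integrable_norm[OF f]])
       (simp add: indicator_def)
  finally show ?thesis unfolding integral_Icc_eq_indicator[OF f] .
qed

lemma integral_halfline_eq_Icc:
  fixes f :: "real \<Rightarrow> complex"
  assumes f: "integrable halfline f" and z: "\<And>y. y > x \<Longrightarrow> f y = 0"
  shows "integral\<^sup>L halfline f = integral {0..x} f"
  unfolding integral_Icc_eq_indicator[OF f]
  by (rule Bochner_Integration.integral_cong) (use z in \<open>auto simp: space_restrict_space indicator_def not_le\<close>)

lemma continuous_on_extend_at_0:
  fixes f :: "real \<Rightarrow> 'a::t2_space"
  assumes f: "continuous_on {0<..} f" and l: "(f \<longlongrightarrow> l) (at_right 0)"
  shows "continuous_on {0..} (\<lambda>x. if x = 0 then l else f x)"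
  unfolding continuous_on_eq_continuous_within
proof
  fix x :: real assume "x \<in> {0..}"
  show "continuous (at x within {0..}) (\<lambda>x. if x = 0 then l else f x)"
  proof (cases "x = 0")
    case True
    have "((\<lambda>x. if x = 0 then l else f x) \<longlongrightarrow> l) (at_right 0)"
      using l by (rule Lim_transform_eventually) (auto simp: eventually_at_filter)
    then show ?thesis using True by (simp add: continuous_within at_within_Ici_at_right)
  next
    case False
    with \<open>x \<in> {0..}\<close> have x: "x > 0" by simp
    have "isCont f x" using f x by (simp add: continuous_on_eq_continuous_at)
    moreover have "\<forall>\<^sub>F t in nhds x. f t = (if t = 0 then l else f t)"
      by (rule eventually_mono[OF eventually_nhds_in_open[of "{0<..}"]]) (use x in auto)
    ultimately have "isCont (\<lambda>x. if x = 0 then l else f x) x"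
      using isCont_cong[of f "\<lambda>x. if x = 0 then l else f x" x] by blast
    then show ?thesis by (rule continuous_at_imp_continuous_at_within)
  qed
qed

lemma continuous_on_imp_tendsto_at_right:
  fixes f :: "real \<Rightarrow> real"
  assumes "continuous_on {0..} f"
  shows "(f \<longlongrightarrow> f 0) (at_right 0)"
proof -
  have "(f \<longlongrightarrow> f 0) (at 0 within {0..})" using assms by (simp add: continuous_on_def)
  then show ?thesis by (simp only: at_within_Ici_at_right)
qed

lemma has_vector_derivative_of_real_mult:
  assumes "(f has_real_derivative f') (at x)" "(u has_vector_derivative u') (at x)"
  shows "((\<lambda>x. complex_of_real (f x) * u x) has_vector_derivative of_real (f x) * u' + of_real f' * u x) (at x)"
  using has_vector_derivative_scaleR[OF assms] by (simp add: scaleR_conv_of_real)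

section \<open>The fundamental theorem of calculus for absolutely continuous functions\<close>

text \<open>Over the intervals of a fine tagged division whose tags lie in a null set, an absolutely
  continuous function varies arbitrarily little: the null set has an open neighbourhood \<open>U\<close> of small
  measure, and a gauge can force all these intervals into \<open>U\<close>.  Degenerate intervals have to be
  discarded first, since only nondegenerate ones are determined by their end points.\<close>

lemma abs_continuous_sum_less:
  fixes A :: "real \<Rightarrow> real"
  assumes A: "abs_continuous_on_interval c d A" and N: "negligible N" and e: "e > 0"
  obtains U where "open U" "N \<subseteq> U"
    and "\<And>P. \<lbrakk>P tagged_partial_division_of {c..d}; \<And>x K. (x, K) \<in> P \<Longrightarrow> K \<subseteq> U\<rbrakk>
          \<Longrightarrow> (\<Sum>(x, K)\<in>P. \<bar>A (Sup K) - A (Inf K)\<bar> + (Sup K - Inf K)) < e"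
proof -
  obtain \<delta>0 where "\<delta>0 > 0" and \<delta>0: "\<And>I. \<lbrakk>finite I; \<forall>(s, t)\<in>I. c \<le> s \<and> s \<le> t \<and> t \<le> d;
      disjoint_family_on (\<lambda>(s, t). {s<..<t}) I; (\<Sum>(s, t)\<in>I. t - s) < \<delta>0\<rbrakk>
      \<Longrightarrow> (\<Sum>(s, t)\<in>I. \<bar>A t - A s\<bar>) < e / 2"
    using A e unfolding abs_continuous_on_interval_def
    by (metis (no_types, lifting) half_gt_zero)
  \<comment> \<open>The bound \<open>e / 2\<close> serves the total length, which occurs next to the variation of \<open>A\<close>.\<close>
  define \<delta> where "\<delta> = min \<delta>0 (e / 2)"
  have "\<delta> > 0" using \<open>\<delta>0 > 0\<close> e by (simp add: \<delta>_def)
  have Nl: "N \<in> sets lebesgue" "emeasure lebesgue N = 0"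
    using N by (auto simp: negligible_iff_null_sets null_sets_def)
  obtain U where U: "open U" "N \<subseteq> U" "U - N \<in> lmeasurable" "emeasure lebesgue (U - N) < ennreal \<delta>"
    using sets_lebesgue_outer_open[OF Nl(1) \<open>\<delta> > 0\<close>] by metis
  have "emeasure lebesgue U = emeasure lebesgue (U - N)"
    using N U(1) by (intro emeasure_Diff_null_set[symmetric]) (auto simp: negligible_iff_null_sets borel_open)
  with U(4) have emU: "emeasure lebesgue U < ennreal \<delta>" by simp
  have Um: "U \<in> lmeasurable"
  proof (rule fmeasurableI)
    show "emeasure lebesgue U < \<infinity>" using emU ennreal_less_top order.strict_trans by (metis infinity_ennreal_def)
  qed (use U(1) in \<open>simp add: borel_open\<close>)
  have mU: "measure lebesgue U < \<delta>"
    using emU \<open>\<delta> > 0\<close> Um by (simp add: emeasure_eq_measure2 ennreal_less_iff)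
  show ?thesis
  proof (rule that[OF U(1,2)])
    fix P assume P: "P tagged_partial_division_of {c..d}"
      and PU: "\<And>x K. (x, K) \<in> P \<Longrightarrow> K \<subseteq> U"
    note PD = tagged_partial_division_ofD[OF P]
    have iv: "\<exists>u v. c \<le> u \<and> u \<le> v \<and> v \<le> d \<and> K = {u..v}" if h: "(x, K) \<in> P" for x K
    proof -
      obtain u v where "K = cbox u v" using PD(4)[OF h] by blast
      moreover have "x \<in> K" "K \<subseteq> {c..d}" using PD(2,3)[OF h] by auto
      ultimately show ?thesis by (intro exI[of _ u] exI[of _ v]) auto
    qed
    define P' where "P' = {(x, K)\<in>P. Inf K < Sup K}"
    let ?h = "\<lambda>(x::real, K::real set). (Inf K, Sup K)"
    let ?I = "?h ` P'"
    have iv': "\<exists>u v. c \<le> u \<and> u < v \<and> v \<le> d \<and> K = {u..v}" if "(x, K) \<in> P'" for x K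
      using iv[of x K] that by (auto simp: P'_def)
    have finP': "finite P'" using PD(1) unfolding P'_def by (rule finite_subset[rotated]) auto
    have disj: "(x1,K1) = (x2,K2)" if "(x1,K1) \<in> P'" "(x2,K2) \<in> P'" "y \<in> interior K1" "y \<in> interior K2"
      for x1 K1 x2 K2 y
      using PD(5)[of x1 K1 x2 K2] that by (auto simp: P'_def)
    have inj: "inj_on ?h P'"
    proof (rule inj_onI, clarify)
      fix x1 K1 x2 K2 assume a: "(x1,K1) \<in> P'" "(x2,K2) \<in> P'" "Inf K1 = Inf K2" "Sup K1 = Sup K2"
      obtain u v where uv: "u < v" "K1 = {u..v}" using iv'[OF a(1)] by blast
      obtain u' v' where uv': "u' < v'" "K2 = {u'..v'}" using iv'[OF a(2)] by blast
      have "K1 = K2" using uv uv' a by simp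
      moreover have "(u+v)/2 \<in> interior K1" using uv by (simp add: interior_atLeastAtMost_real)
      ultimately show "x1 = x2 \<and> K1 = K2" using disj[OF a(1,2)] by blast
    qed
    have dI: "disjoint_family_on (\<lambda>(s, t). {s<..<t}) ?I"
      unfolding disjoint_family_on_def
    proof (intro ballI impI)
      fix i j assume "i \<in> ?I" "j \<in> ?I" and ij: "i \<noteq> j"
      then obtain x1 K1 x2 K2 where
        i: "(x1, K1) \<in> P'" "i = (Inf K1, Sup K1)" and j: "(x2, K2) \<in> P'" "j = (Inf K2, Sup K2)"
        by auto
      obtain u v where uv: "u < v" "K1 = {u..v}" using iv'[OF i(1)] by blast
      obtain u' v' where uv': "u' < v'" "K2 = {u'..v'}" using iv'[OF j(1)] by blast
      have False if "y \<in> {u<..<v}" "y \<in> {u'<..<v'}" for y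
      proof -
        have "(x1,K1) = (x2,K2)" using uv uv' that
          by (intro disj[OF i(1) j(1), of y]) (auto simp: interior_atLeastAtMost_real)
        then show False using i j ij by auto
      qed
      then have "{u<..<v} \<inter> {u'<..<v'} = {}" by blast
      then show "(case i of (s, t) \<Rightarrow> {s<..<t}) \<inter> (case j of (s, t) \<Rightarrow> {s<..<t}) = {}"
        using i j uv uv' by simp
    qed
    have bI: "\<forall>(s, t)\<in>?I. c \<le> s \<and> s \<le> t \<and> t \<le> d"
      using iv' by fastforce
    have "(\<Sum>(s, t)\<in>?I. t - s) = (\<Sum>i\<in>?I. measure lebesgue (case i of (s, t) \<Rightarrow> {s<..<t}))"
      using bI by (intro sum.cong) auto
    also have "\<dots> = measure lebesgue (\<Union>i\<in>?I. case i of (s, t) \<Rightarrow> {s<..<t})"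
    proof (intro measure_finite_Union[symmetric] dI)
      show "emeasure lebesgue (case i of (s, t) \<Rightarrow> {s<..<t}) \<noteq> \<infinity>" if "i \<in> ?I" for i
        using bI that by (cases i) (auto simp: emeasure_lborel_Ioo)
    qed (use finP' in \<open>auto split: prod.splits\<close>)
    also have "\<dots> \<le> measure lebesgue U"
    proof (rule measure_mono_fmeasurable[OF _ _ Um])
      show "(\<Union>i\<in>?I. case i of (s, t) \<Rightarrow> {s<..<t}) \<subseteq> U"
      proof clarsimp
        fix x K y assume a: "(x, K) \<in> P'" "Inf K < y" "y < Sup K"
        obtain u v where "u < v" "K = {u..v}" using iv'[OF a(1)] by blast
        then have "y \<in> K" using a by auto
        then show "y \<in> U" using PU[of x K] a(1) by (auto simp: P'_def)
      qed
      show "(\<Union>i\<in>?I. case i of (s, t) \<Rightarrow> {s<..<t}) \<in> sets lebesgue"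
        using finP' by (intro sets.finite_UN) (auto split: prod.splits)
    qed
    finally have len: "(\<Sum>(s, t)\<in>?I. t - s) < \<delta>" using mU by simp
    have "(\<Sum>(s, t)\<in>?I. \<bar>A t - A s\<bar>) < e / 2"
      using len finP' dI bI by (intro \<delta>0) (auto simp: \<delta>_def)
    with len have *: "(\<Sum>(s, t)\<in>?I. \<bar>A t - A s\<bar> + (t - s)) < e"
      by (simp add: sum.distrib case_prod_unfold \<delta>_def)
    have "(\<Sum>(x, K)\<in>P. \<bar>A (Sup K) - A (Inf K)\<bar> + (Sup K - Inf K))
        = (\<Sum>(x, K)\<in>P'. \<bar>A (Sup K) - A (Inf K)\<bar> + (Sup K - Inf K))"
    proof (rule sum.mono_neutral_right[OF PD(1)])
      show "\<forall>i\<in>P - P'. (case i of (x, K) \<Rightarrow> \<bar>A (Sup K) - A (Inf K)\<bar> + (Sup K - Inf K)) = 0"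
        using iv by (fastforce simp: P'_def)
    qed (auto simp: P'_def)
    also have "\<dots> = (\<Sum>(s, t)\<in>?I. \<bar>A t - A s\<bar> + (t - s))"
      using inj by (subst sum.reindex) (auto simp: case_prod_unfold)
    finally show "(\<Sum>(x, K)\<in>P. \<bar>A (Sup K) - A (Inf K)\<bar> + (Sup K - Inf K)) < e"
      using * by simp
  qed
qed

text \<open>Away from the null set \<open>N\<close> the usual Henstock--Kurzweil estimate applies; intervals tagged in
  \<open>N\<close> are handled by the preceding lemma.  Absolute continuity is required of a dominating function
  \<open>A\<close> rather than of \<open>F\<close>, so that sums and products of \<open>A\<close> with smooth
  functions are covered as well.\<close>

lemma fundamental_theorem_of_calculus_abs_continuous:
  fixes F F' :: "real \<Rightarrow> 'a::banach" and A :: "real \<Rightarrow> real"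
  assumes cd: "c \<le> d" and A: "abs_continuous_on_interval c d A"
    and dom: "\<And>s t. \<lbrakk>c \<le> s; s \<le> t; t \<le> d\<rbrakk> \<Longrightarrow> norm (F t - F s) \<le> M * (\<bar>A t - A s\<bar> + (t - s))"
    and N: "negligible N"
    and D: "\<And>x. x \<in> {c..d} - N \<Longrightarrow> (F has_vector_derivative F' x) (at x within {c..d})"
  shows "(F' has_integral F d - F c) {c..d}"
proof -
  define f where "f x = (if x \<in> N then 0 else F' x)" for x
  define M' where "M' = max M 1"
  have M': "M' > 0" by (simp add: M'_def)
  have dom': "norm (F t - F s) \<le> M' * (\<bar>A t - A s\<bar> + (t - s))" if "c \<le> s" "s \<le> t" "t \<le> d" for s t
  proof -
    have "M * (\<bar>A t - A s\<bar> + (t - s)) \<le> M' * (\<bar>A t - A s\<bar> + (t - s))"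
      using that by (intro mult_right_mono) (auto simp: M'_def)
    then show ?thesis using dom[OF that] by linarith
  qed
  have "(f has_integral F d - F c) {c..d}"
    unfolding has_integral_real
  proof (intro allI impI)
    fix e :: real assume e: "e > 0"
    \<comment> \<open>The summand \<open>1\<close> covers \<open>c = d\<close>; half of \<open>e\<close> goes to each kind of tag.\<close>
    define e1 where "e1 = e / (2 * (d - c + 1))"
    have e1: "e1 > 0" using e cd by (simp add: e1_def)
    have "\<forall>x. \<exists>r>0. x \<in> {c..d} - N \<longrightarrow>
         (\<forall>y\<in>{c..d}. norm (y-x) < r \<longrightarrow> norm (F y - F x - (y-x) *\<^sub>R F' x) \<le> e1 * norm (y-x))"
      using D e1 unfolding has_vector_derivative_def has_derivative_within_alt
      by (metis zero_less_one)
    then obtain r where r: "\<And>x. 0 < r x"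
      "\<And>x y. \<lbrakk>x \<in> {c..d} - N; y \<in> {c..d}; norm (y-x) < r x\<rbrakk>
                        \<Longrightarrow> norm (F y - F x - (y-x) *\<^sub>R F' x) \<le> e1 * norm (y-x)"
      by metis
    obtain U where U: "open U" "N \<subseteq> U"
      and Usum: "\<And>P. \<lbrakk>P tagged_partial_division_of {c..d}; \<And>x K. (x, K) \<in> P \<Longrightarrow> K \<subseteq> U\<rbrakk>
          \<Longrightarrow> (\<Sum>(x, K)\<in>P. \<bar>A (Sup K) - A (Inf K)\<bar> + (Sup K - Inf K)) < e / (2 * M')"
      using abs_continuous_sum_less[OF A N, of "e / (2 * M')"] e M' by auto
    define \<gamma> where "\<gamma> x = (if x \<in> N then U else ball x (r x))" for x
    have "gauge \<gamma>" using U r(1) by (auto simp: gauge_def \<gamma>_def)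
    moreover have "norm ((\<Sum>(x, K)\<in>p. measure lborel K *\<^sub>R f x) - (F d - F c)) < e"
      if p: "p tagged_division_of {c..d}" and fine: "\<gamma> fine p" for p
    proof -
      note pD = tagged_division_ofD[OF p]
      have iv: "\<exists>u v. c \<le> u \<and> u \<le> v \<and> v \<le> d \<and> K = {u..v} \<and> x \<in> {u..v}" if h: "(x, K) \<in> p" for x K
      proof -
        obtain u v where "K = cbox u v" using pD(4)[OF h] by blast
        moreover have "x \<in> K" "K \<subseteq> {c..d}" using pD(2,3)[OF h] by auto
        ultimately show ?thesis by (intro exI[of _ u] exI[of _ v]) auto
      qed
      define pN where "pN = {(x, K)\<in>p. x \<in> N}"
      let ?g = "\<lambda>(x, K). measure lborel K *\<^sub>R f x - (F (Sup K) - F (Inf K))"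
      have fin: "finite p" "finite pN" "pN \<subseteq> p" using pD(1) by (auto simp: pN_def intro: finite_subset)
      have "(\<Sum>(x, K)\<in>p. measure lborel K *\<^sub>R f x) - (F d - F c) = sum ?g p"
        using additive_tagged_division_1[OF cd p, of F] by (simp add: sum_subtractf case_prod_unfold)
      also have "\<dots> = sum ?g (p - pN) + sum ?g pN"
        using fin by (intro sum.subset_diff) auto
      also have "norm \<dots> \<le> norm (sum ?g (p - pN)) + norm (sum ?g pN)" by (rule norm_triangle_ineq)
      also have "norm (sum ?g (p - pN)) \<le> (\<Sum>(x, K)\<in>p - pN. e1 * (Sup K - Inf K))"
      proof (rule sum_norm_le, clarify)
        fix x K assume a: "(x, K) \<in> p" "(x, K) \<notin> pN"
        have xN: "x \<notin> N" using a by (auto simp: pN_def)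
        obtain u v where uv: "c \<le> u" "u \<le> v" "v \<le> d" "K = {u..v}" "x \<in> {u..v}" using iv[OF a(1)] by blast
        have "K \<subseteq> ball x (r x)" using fineD[OF fine a(1)] xN by (simp add: \<gamma>_def)
        then have "u \<in> ball x (r x)" "v \<in> ball x (r x)"
          using uv(2,4) by (meson atLeastAtMost_iff order_refl subsetD)+
        then have *: "norm (u - x) < r x" "norm (v - x) < r x"
          by (auto simp: dist_real_def)
        have "norm ((v - u) *\<^sub>R F' x - (F v - F u)) = norm (F u - F x - (u - x) *\<^sub>R F' x - (F v - F x - (v - x) *\<^sub>R F' x))"
          by (auto simp: algebra_simps)
        also have "\<dots> \<le> norm (F u - F x - (u - x) *\<^sub>R F' x) + norm (F v - F x - (v - x) *\<^sub>R F' x)"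
          by (rule norm_triangle_ineq4)
        also have "\<dots> \<le> e1 * norm (u - x) + e1 * norm (v - x)"
          using uv xN * by (intro add_mono r(2)) auto
        also have "\<dots> = e1 * (v - u)" using uv by (simp add: algebra_simps)
        finally show "norm (measure lborel K *\<^sub>R f x - (F (Sup K) - F (Inf K))) \<le> e1 * (Sup K - Inf K)"
          using uv xN by (simp add: f_def)
      qed
      also have "\<dots> \<le> (\<Sum>(x, K)\<in>p. e1 * (Sup K - Inf K))"
        using iv e1 fin by (intro sum_mono2) (auto, fastforce)
      also have "\<dots> = e1 * (d - c)"
        using additive_tagged_division_1[OF cd p, of "\<lambda>x. x"] 
        by (simp add: sum_distrib_left[symmetric] case_prod_unfold)
      also have "\<dots> \<le> e / 2" using cd e by (simp add: e1_def divide_simps)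
      also have "norm (sum ?g pN) \<le> (\<Sum>(x, K)\<in>pN. M' * (\<bar>A (Sup K) - A (Inf K)\<bar> + (Sup K - Inf K)))"
      proof (rule sum_norm_le, clarify)
        fix x K assume a: "(x, K) \<in> pN"
        then have a': "(x, K) \<in> p" "x \<in> N" by (auto simp: pN_def)
        obtain u v where uv: "c \<le> u" "u \<le> v" "v \<le> d" "K = {u..v}" "x \<in> {u..v}" using iv[OF a'(1)] by blast
        show "norm (measure lborel K *\<^sub>R f x - (F (Sup K) - F (Inf K))) \<le> M' * (\<bar>A (Sup K) - A (Inf K)\<bar> + (Sup K - Inf K))"
          using uv a' dom'[OF uv(1,2,3)] by (simp add: f_def norm_minus_commute)
      qed
      also have "\<dots> = M' * (\<Sum>(x, K)\<in>pN. \<bar>A (Sup K) - A (Inf K)\<bar> + (Sup K - Inf K))"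
        by (simp add: sum_distrib_left case_prod_unfold)
      also have "(\<Sum>(x, K)\<in>pN. \<bar>A (Sup K) - A (Inf K)\<bar> + (Sup K - Inf K)) < e / (2 * M')"
      proof (rule Usum)
        show "pN tagged_partial_division_of {c..d}"
          using p fin(3) unfolding tagged_division_of_def by (blast intro: tagged_partial_division_subset)
        show "K \<subseteq> U" if "(x, K) \<in> pN" for x K
          using fineD[OF fine, of x K] that by (auto simp: pN_def \<gamma>_def)
      qed
      finally show ?thesis using M' by (simp add: field_simps)
    qed
    ultimately show "\<exists>\<gamma>. gauge \<gamma> \<and> (\<forall>\<D>. \<D> tagged_division_of {c..d} \<and> \<gamma> fine \<D> \<longrightarrow>
        norm ((\<Sum>(x, K)\<in>\<D>. measure lborel K *\<^sub>R f x) - (F d - F c)) < e)"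
      by (intro exI[of _ \<gamma>]) simp
  qed
  then show ?thesis
    by (rule has_integral_spike[OF N, rotated]) (auto simp: f_def)
qed

section \<open>Linear systems with continuous coefficients\<close>

text \<open>Existence on the whole half-line in one step: for \<open>k = |b| + |q|\<close> and \<open>K(x) = \<integral>\<^sub>0\<^sup>x k\<close>, the
  integral equation is a contraction with constant \<open>1/2\<close> in the norm \<open>sup e\<^sup>-\<^sup>2\<^sup>K |Y|\<close>.  The operator is
  transported to bounded continuous functions \<open>V = e\<^sup>-\<^sup>2\<^sup>K Y\<close> on the real line by freezing all data
  to the left of \<open>0\<close>.\<close>

lemma linear_system_solution:
  fixes b q :: "real \<Rightarrow> real" and u0 w0 :: real
  assumes b: "continuous_on {0..} b" and q: "continuous_on {0..} q"
  obtains u w where "u 0 = u0" "w 0 = w0" "continuous_on {0..} u" "continuous_on {0..} w"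
    "\<And>x. x > 0 \<Longrightarrow> (u has_real_derivative b x * w x) (at x)"
    "\<And>x. x > 0 \<Longrightarrow> (w has_real_derivative - q x * u x) (at x)"
proof -
  define \<beta> where "\<beta> x = b (max 0 x)" for x
  define \<kappa> where "\<kappa> x = q (max 0 x)" for x
  have cm: "continuous_on UNIV (\<lambda>x::real. max 0 x)" by (intro continuous_intros)
  have c\<beta>: "continuous_on UNIV \<beta>" unfolding \<beta>_def
    by (rule continuous_on_compose2[OF b cm]) auto
  have c\<kappa>: "continuous_on UNIV \<kappa>" unfolding \<kappa>_def
    by (rule continuous_on_compose2[OF q cm]) auto
  define k where "k x = \<bar>\<beta> x\<bar> + \<bar>\<kappa> x\<bar>" for x
  have ck: "continuous_on UNIV k" unfolding k_def by (intro continuous_intros c\<beta> c\<kappa>)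
  have clamp_cont: "continuous_on UNIV (\<lambda>x. integral {0..max 0 x} f)"
    if f: "continuous_on UNIV f" for f :: "real \<Rightarrow> 'a::banach"
  proof -
    have "continuous_on {0..} (\<lambda>x. integral {0..x} f)"
      unfolding continuous_on_eq_continuous_within
    proof
      fix x :: real assume x: "x \<in> {0..}"
      have "continuous_on {0..x+1} (\<lambda>x. integral {0..x} f)"
        by (intro indefinite_integral_continuous_1 integrable_continuous_real continuous_on_subset[OF f]) auto
      then have "continuous (at x within {0..x+1}) (\<lambda>x. integral {0..x} f)"
        using x by (auto simp: continuous_on_eq_continuous_within)
      also have "at x within {0..x+1} = at x within {0..}"
        by (rule at_within_nhd[of x "{..<x+1}"]) auto
      finally show "continuous (at x within {0..}) (\<lambda>x. integral {0..x} f)" .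
    qed
    then show ?thesis by (rule continuous_on_compose2[OF _ cm]) auto
  qed
  have clamp_deriv: "((\<lambda>x. integral {0..max 0 x} f) has_vector_derivative f x) (at x)"
    if f: "continuous_on UNIV f" and x: "x > 0" for f :: "real \<Rightarrow> 'a::banach" and x
  proof -
    have "((\<lambda>x. integral {0..x} f) has_vector_derivative f x) (at x within {0..x+1})"
      using x by (intro integral_has_vector_derivative continuous_on_subset[OF f]) auto
    then have "((\<lambda>x. integral {0..x} f) has_vector_derivative f x) (at x)"
      using x by (subst (asm) at_within_interior) (auto simp: interior_atLeastAtMost_real)
    then show ?thesis
      by (rule has_vector_derivative_transform_within_open[of _ _ _ "{0<..}"]) (use x in auto)
  qed
  define K where "K x = integral {0..max 0 x} k" for x
  have cK: "continuous_on UNIV K" unfolding K_def by (rule clamp_cont[OF ck])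
  have dK: "(K has_real_derivative k x) (at x)" if "x > 0" for x
    using clamp_deriv[OF ck that] unfolding K_def has_real_derivative_iff_has_vector_derivative .
  define L where "L Y t = (\<beta> t * snd (Y t), - \<kappa> t * fst (Y t))" for Y :: "real \<Rightarrow> real \<times> real" and t
  define E where "E V t = exp (2 * K t) *\<^sub>R V t" for V :: "real \<Rightarrow> real \<times> real" and t
  have cL: "continuous_on UNIV (L Y)" if "continuous_on UNIV Y" for Y
    unfolding L_def by (intro continuous_intros c\<beta> c\<kappa> that)
  have cE: "continuous_on UNIV (E V)" if "continuous_on UNIV V" for V
    unfolding E_def by (intro continuous_intros cK that)
  have Ldiff: "L (E V) t - L (E Z) t = L (E (\<lambda>t. V t - Z t)) t" for V Z t
    by (simp add: L_def E_def algebra_simps)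
  have pr: "\<bar>fst z\<bar> \<le> norm z" "\<bar>snd z\<bar> \<le> norm z" for z :: "real \<times> real"
    by (auto simp: norm_prod_def intro!: real_le_rsqrt)
  have LE: "norm (L (E V) t) \<le> k t * exp (2 * K t) * norm (V t)" for V t
  proof -
    have "norm (L (E V) t) \<le> norm (\<beta> t * snd (E V t)) + norm (- \<kappa> t * fst (E V t))"
      unfolding L_def by (rule norm_Pair_le)
    also have "\<dots> \<le> \<bar>\<beta> t\<bar> * norm (E V t) + \<bar>\<kappa> t\<bar> * norm (E V t)"
      using pr[of "E V t"] by (auto simp: abs_mult intro!: add_mono mult_left_mono)
    also have "\<dots> = k t * exp (2 * K t) * norm (V t)"
      by (simp add: E_def k_def algebra_simps)
    finally show ?thesis .
  qed
  define m where "m x = exp (- 2 * K x)" for x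
  have bound: "norm (m x *\<^sub>R integral {0..max 0 x} (L (E V))) \<le> C / 2"
    if V: "continuous_on UNIV V" and C: "\<And>t. norm (V t) \<le> C" for V C x
  proof -
    let ?x = "max 0 x"
    have C0: "C \<ge> 0" using C[of 0] norm_ge_zero order_trans by blast
    have i: "((\<lambda>t. C * (k t * exp (2 * K t))) has_integral C/2 * exp (2 * K ?x) - C/2 * exp (2 * K 0)) {0..?x}"
    proof (rule fundamental_theorem_of_calculus_interior)
      show "continuous_on {0..?x} (\<lambda>t. C/2 * exp (2 * K t))"
        by (intro continuous_intros continuous_on_subset[OF cK]) auto
      show "((\<lambda>t. C/2 * exp (2 * K t)) has_vector_derivative C * (k t * exp (2 * K t))) (at t)"
        if "t \<in> {0<..<?x}" for t
        unfolding has_real_derivative_iff_has_vector_derivative[symmetric]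
        using that by (auto intro!: derivative_eq_intros dK)
    qed auto
    have "norm (integral {0..?x} (L (E V))) \<le> integral {0..?x} (\<lambda>t. C * (k t * exp (2 * K t)))"
    proof (rule integral_norm_bound_integral)
      show "L (E V) integrable_on {0..?x}"
        by (intro integrable_continuous_real continuous_on_subset[OF cL[OF cE[OF V]]]) auto
      show "norm (L (E V) t) \<le> C * (k t * exp (2 * K t))" for t
      proof -
        have "k t * exp (2 * K t) * norm (V t) \<le> k t * exp (2 * K t) * C"
          using C by (intro mult_left_mono) (auto simp: k_def)
        then show ?thesis using LE[of V t] by (simp add: mult_ac)
      qed
    qed (use i in blast)
    also have "\<dots> \<le> C/2 * exp (2 * K ?x)" unfolding integral_unique[OF i] using C0 by simp
    also have "K ?x = K x" by (simp add: K_def)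
    finally have "m x * norm (integral {0..?x} (L (E V))) \<le> m x * (C/2 * exp (2 * K x))"
      by (intro mult_left_mono) (auto simp: m_def)
    also have "\<dots> = C/2" by (simp add: m_def exp_minus)
    finally show ?thesis by (simp add: m_def)
  qed
  have K0: "0 \<le> K x" for x unfolding K_def
    by (intro integral_nonneg integrable_continuous_real continuous_on_subset[OF ck]) (auto simp: k_def)
  define y0 where "y0 = (u0, w0)"
  define S where "S V x = m x *\<^sub>R (y0 + integral {0..max 0 x} (L (E V)))" for V x
  have S_bcont: "S V \<in> bcontfun" if V: "continuous_on UNIV V" and C: "\<And>t. norm (V t) \<le> C" for V C
  proof (rule bcontfun_normI)
    show "continuous_on UNIV (S V)" unfolding S_def m_def
      by (intro continuous_intros cK clamp_cont cL cE V)
    show "norm (S V x) \<le> norm y0 + C / 2" for x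
    proof -
      have "norm (S V x) \<le> norm (m x *\<^sub>R y0) + norm (m x *\<^sub>R integral {0..max 0 x} (L (E V)))"
        unfolding S_def scaleR_add_right by (rule norm_triangle_ineq)
      also have "norm (m x *\<^sub>R y0) \<le> 1 * norm y0"
        unfolding norm_scaleR using K0 by (intro mult_right_mono) (auto simp: m_def)
      finally show ?thesis using bound[OF V C, of x] by simp
    qed
  qed
  define T where "T V = Bcontfun (S (apply_bcontfun V))" for V :: "real \<Rightarrow>\<^sub>C (real \<times> real)"
  have T: "apply_bcontfun (T V) = S (apply_bcontfun V)" for V
    unfolding T_def by (intro Bcontfun_inverse S_bcont[OF _ norm_bounded]) simp
  have "\<exists>!V. T V = V"
  proof (rule banach_fix_type[of "1/2"])
    show "\<forall>V Z. dist (T V) (T Z) \<le> 1/2 * dist V Z"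
    proof (intro allI dist_bound)
      fix V Z x
      have int: "L (E (apply_bcontfun W)) integrable_on {0..max 0 x}" for W
        by (intro integrable_continuous_real continuous_on_subset[OF cL[OF cE]]) auto
      have "dist (T V x) (T Z x) = norm (m x *\<^sub>R integral {0..max 0 x} (L (E (\<lambda>t. V t - Z t))))"
        unfolding dist_norm T S_def
        by (simp add: scaleR_diff_right[symmetric] Henstock_Kurzweil_Integration.integral_diff[symmetric] int Ldiff del: scaleR_scaleR)
      also have "\<dots> \<le> dist V Z / 2"
        by (rule bound) (auto intro!: continuous_intros simp: dist_norm[symmetric] dist_bounded)
      finally show "dist (T V x) (T Z x) \<le> 1/2 * dist V Z" by simp
    qed
  qed auto
  then obtain V where V: "T V = V" by blast
  define Y where "Y = E (apply_bcontfun V)"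
  have cY: "continuous_on UNIV Y" unfolding Y_def by (rule cE) simp
  have Y: "Y x = y0 + integral {0..max 0 x} (L Y)" for x
  proof -
    have "V x = S V x" using T[of V] V by simp
    then have "Y x = exp (2 * K x) *\<^sub>R S V x" by (simp add: Y_def E_def)
    also have "\<dots> = y0 + integral {0..max 0 x} (L Y)"
      by (simp add: S_def Y_def m_def exp_minus)
    finally show ?thesis .
  qed
  have dY: "(Y has_vector_derivative L Y x) (at x)" if "x > 0" for x
    using clamp_deriv[OF cL[OF cY] that]
    by (subst Y[abs_def]) (auto intro!: derivative_eq_intros)
  show ?thesis
  proof (rule that[of "\<lambda>x. fst (Y x)" "\<lambda>x. snd (Y x)"])
    show "fst (Y 0) = u0" "snd (Y 0) = w0" by (simp_all add: Y[of 0] y0_def)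
    show "continuous_on {0..} (\<lambda>x. fst (Y x))" "continuous_on {0..} (\<lambda>x. snd (Y x))"
      by (intro continuous_intros continuous_on_subset[OF cY]; simp)+
    fix x :: real assume x: "x > 0"
    show "((\<lambda>x. fst (Y x)) has_real_derivative b x * snd (Y x)) (at x)"
      using bounded_linear.has_vector_derivative[OF bounded_linear_fst dY[OF x]] x
      unfolding has_real_derivative_iff_has_vector_derivative by (simp add: L_def \<beta>_def max_def)
    show "((\<lambda>x. snd (Y x)) has_real_derivative - q x * fst (Y x)) (at x)"
      using bounded_linear.has_vector_derivative[OF bounded_linear_snd dY[OF x]] x
      unfolding has_real_derivative_iff_has_vector_derivative by (simp add: L_def \<kappa>_def max_def)
  qed
qed

section \<open>Square integrable functions and their classes\<close>

lemma L2_eq_refl: "L2_eq f f \<longleftrightarrow> square_integrable f"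
  by (auto simp: L2_eq_def)

lemma L2_of_eq_iff:
  assumes "square_integrable f" "square_integrable g"
  shows "L2_of f = L2_of g \<longleftrightarrow> (AE x in halfline. f x = g x)"
  using Quotient3_rel[OF Quotient3_L2, of f g] assms by (auto simp: L2_eq_def)

lemma L2_of_surj: obtains f where "square_integrable f" "L2_of f = u"
  using Quotient3_abs_rep[OF Quotient3_L2, of u] Quotient3_rep_reflp[OF Quotient3_L2, of u]
  by (auto simp: L2_eq_refl)

lemma cinner_L2_of:
  "square_integrable f \<Longrightarrow> square_integrable g \<Longrightarrow>
    cinner (L2_of f) (L2_of g) = integral\<^sup>L halfline (\<lambda>x. f x * cnj (g x))"
  by (rule cinner.abs_eq) (auto simp: L2_eq_refl)

lemma L2_of_add: "square_integrable f \<Longrightarrow> square_integrable g \<Longrightarrow> L2_of f + L2_of g = L2_of (\<lambda>x. f x + g x)"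
  by (rule plus_L2.abs_eq) (auto simp: L2_eq_refl)

lemma cscale_L2_of: "square_integrable f \<Longrightarrow> cscale c (L2_of f) = L2_of (\<lambda>x. c * f x)"
  by (rule cscale.abs_eq) (auto simp: L2_eq_refl)

lemma L2_of_diff:
  assumes "square_integrable f" "square_integrable g"
  shows "L2_of f - L2_of g = L2_of (\<lambda>x. f x - g x)"
  using L2_of_add[OF assms(1) square_integrable_cmult[OF assms(2), of "-1"]]
  unfolding minus_L2_def cscale_L2_of[OF assms(2)] by simp

lemma square_integrable_diff:
  assumes "square_integrable f" "square_integrable g"
  shows "square_integrable (\<lambda>x. f x - g x)"
  using square_integrable_add[OF assms(1) square_integrable_cmult[OF assms(2), of "-1"]] by simp

lemma norm_L2_of:
  assumes "square_integrable f"
  shows "(norm (L2_of f))\<^sup>2 = integral\<^sup>L halfline (\<lambda>x. (cmod (f x))\<^sup>2)"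
  using cinner_self_nonneg[of "L2_of f"]
  by (simp add: norm_L2_def inner_L2_def cinner_L2_of[OF assms assms] Re_integral_mult_cnj)

lemma cinner_add_right: "cinner u (v + w) = cinner u v + cinner u w"
  by (metis cinner_add_left cinner_commute complex_cnj_add)

lemma cinner_cscale_right: "cinner u (cscale c v) = cnj c * cinner u v"
  by (metis cinner_cscale_left cinner_commute complex_cnj_mult)

lemma cinner_zero [simp]: "cinner v 0 = 0"
  by (metis add_cancel_right_right cinner_add_right add.right_neutral)

lemma cinner_diff_right: "cinner w (u - v) = cinner w u - cinner w v"
  by (simp add: minus_L2_def cinner_add_right cinner_cscale_right)

lemma cscale_zero [simp]: "cscale c 0 = 0" "cscale 0 u = 0"
  by (transfer; simp add: L2_eq_def square_integrable_zero)+

lemma cinner_inner: "cinner u v = Complex (inner u v) (inner u (cscale \<i> v))"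
  by (simp add: complex_eq_iff inner_L2_def cinner_cscale_right)

lemma continuous_on_cinner_left [continuous_intros]:
  "continuous_on S f \<Longrightarrow> continuous_on S (\<lambda>x. cinner (f x) v)"
  unfolding cinner_inner Complex_eq by (intro continuous_intros)

text \<open>The inner product is continuous, so the adjoint only sees the closure of a graph.\<close>

lemma adjoint_closure: "adjoint_op (closure T) = adjoint_op T"
proof
  show "adjoint_op (closure T) \<subseteq> adjoint_op T"
    using closure_subset[of T] unfolding adjoint_op_def by auto
  show "adjoint_op T \<subseteq> adjoint_op (closure T)"
  proof (clarsimp simp: adjoint_op_def)
    fix v g u f assume h: "\<forall>(u, f)\<in>T. cinner f v = cinner u g" and uf: "(u, f) \<in> closure T"
    have "closed {z::L2 \<times> L2. cinner (snd z) v = cinner (fst z) g}"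
      by (intro closed_Collect_eq continuous_intros)
    then have "closure T \<subseteq> {z. cinner (snd z) v = cinner (fst z) g}"
      using h by (intro closure_minimal) auto
    then show "cinner f v = cinner u g" using uf by auto
  qed
qed

text \<open>By continuity of the inner product \<open>w\<close> is orthogonal to itself.\<close>

lemma orthogonal_dense_eq_0:
  assumes "closure S = UNIV" "\<And>u. u \<in> S \<Longrightarrow> cinner u w = 0"
  shows "w = 0"
proof -
  have "closed {u. cinner u w = 0}" by (intro closed_Collect_eq continuous_intros)
  then have "closure S \<subseteq> {u. cinner u w = 0}" using assms(2) by (intro closure_minimal) auto
  then have "cinner w w = 0" using assms(1) by auto
  then show ?thesis using cinner_self_eq_0[of w] by simp
qed

definition Cc :: "(real \<Rightarrow> complex) \<Rightarrow> bool" where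
  "Cc f \<longleftrightarrow> continuous_on UNIV f \<and> (\<exists>s t. 0 < s \<and> s < t \<and> (\<forall>x. x \<notin> {s..t} \<longrightarrow> f x = 0))"

lemma square_integrable_bounded_support:
  assumes m: "f \<in> borel_measurable halfline" and b: "\<And>x. x > 0 \<Longrightarrow> cmod (f x) \<le> B" and s: "\<And>x. x \<notin> {s..t} \<Longrightarrow> f x = 0"
  shows "square_integrable f"
  unfolding square_integrable_def
proof
  show "integrable halfline (\<lambda>x. (cmod (f x))\<^sup>2)"
  proof (rule Bochner_Integration.integrable_bound)
    have "integrable lebesgue (\<lambda>x. indicat_real {s..t} x *\<^sub>R B\<^sup>2)"
      by (intro integrable_scaleR_left integrable_real_indicator) (auto simp: emeasure_lborel_Icc_eq)
    then have "integrable (lebesgue_on UNIV) (\<lambda>x. indicat_real {s..t} x *\<^sub>R B\<^sup>2)"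
      by (simp add: lebesgue_on_UNIV_eq)
    then show "integrable halfline (\<lambda>x. indicat_real {s..t} x *\<^sub>R B\<^sup>2)"
      by (rule integrable_lebesgue_on_subset) auto
    have "(cmod (f x))\<^sup>2 \<le> indicat_real {s..t} x * B\<^sup>2" if "x > 0" for x
      using b[OF that] s[of x] by (auto simp: indicator_def intro!: power_mono)
    then show "AE x in halfline. norm ((cmod (f x))\<^sup>2) \<le> norm (indicat_real {s..t} x *\<^sub>R B\<^sup>2)"
      by (intro AE_I2) (simp add: space_restrict_space)
  qed (use m in measurable)
qed (rule m)

lemma Cc_square_integrable: assumes "Cc f" shows "square_integrable f"
proof -
  obtain s t where st: "0 < s" "s < t" "\<And>x. x \<notin> {s..t} \<Longrightarrow> f x = 0" and c: "continuous_on UNIV f"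
    using assms by (auto simp: Cc_def)
  have "bounded (f ` {s..t})"
    by (intro compact_imp_bounded compact_continuous_image continuous_on_subset[OF c]) auto
  then obtain B where B: "B > 0" "\<And>x. x \<in> {s..t} \<Longrightarrow> cmod (f x) \<le> B" by (auto simp: bounded_pos)
  show ?thesis
  proof (rule square_integrable_bounded_support[OF _ _ st(3)])
    show "f \<in> borel_measurable halfline"
      by (rule continuous_imp_measurable_on_sets_lebesgue[OF continuous_on_subset[OF c]]) auto
    show "cmod (f x) \<le> B" for x using B st(3)[of x] by (cases "x \<in> {s..t}") auto
  qed
qed

lemma Cc_add: assumes "Cc f" "Cc g" shows "Cc (\<lambda>x. f x + g x)"
proof -
  obtain s t s' t' where "0 < s" "s < t" "\<And>x. x \<notin> {s..t} \<Longrightarrow> f x = 0" "0 < s'" "s' < t'" "\<And>x. x \<notin> {s'..t'} \<Longrightarrow> g x = 0"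
    and c: "continuous_on UNIV f" "continuous_on UNIV g"
    using assms by (auto simp: Cc_def)
  then have "0 < min s s' \<and> min s s' < max t t' \<and> (\<forall>x. x \<notin> {min s s'..max t t'} \<longrightarrow> f x + g x = 0)"
    by (auto simp: min_def max_def)
  then show ?thesis unfolding Cc_def using c by (blast intro: continuous_on_add)
qed

lemma Cc_mult: assumes "Cc f" "continuous_on UNIV g" shows "Cc (\<lambda>x. g x * f x)"
  using assms unfolding Cc_def by (auto intro!: continuous_intros)

text \<open>Dominated convergence for \<open>|g\<^sub>n - f|\<^sup>2 \<le> 4 |w|\<^sup>2\<close>.\<close>

lemma L2_dominated_convergence:
  assumes f: "square_integrable f" and m: "\<And>n. g n \<in> borel_measurable halfline"
    and w: "square_integrable w"
    and lim: "AE x in halfline. (\<lambda>n. g n x) \<longlonglongrightarrow> f x"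
    and dom: "\<And>n x. x > 0 \<Longrightarrow> cmod (g n x) \<le> cmod (w x)"
  shows "(\<lambda>n. L2_of (g n)) \<longlonglongrightarrow> L2_of f" "\<And>n. square_integrable (g n)"
proof -
  have [measurable]: "f \<in> borel_measurable halfline" "g n \<in> borel_measurable halfline" for n
    using f m by (auto simp: square_integrable_def)
  show g: "square_integrable (g n)" for n
    unfolding square_integrable_def
  proof
    show "integrable halfline (\<lambda>x. (cmod (g n x))\<^sup>2)"
    proof (rule Bochner_Integration.integrable_bound)
      show "integrable halfline (\<lambda>x. (cmod (w x))\<^sup>2)" using w by (simp add: square_integrable_def)
      show "AE x in halfline. norm ((cmod (g n x))\<^sup>2) \<le> norm ((cmod (w x))\<^sup>2)"
        using dom by (intro AE_I2) (simp add: space_restrict_space power_mono)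
    qed measurable
  qed (rule m)
  have AE_dom: "AE x in halfline. cmod (f x) \<le> cmod (w x)"
  proof -
    have "AE x in halfline. x > 0" by (intro AE_I2) (simp add: space_restrict_space)
    with lim show ?thesis
    proof eventually_elim
      case (elim x)
      show ?case by (rule tendsto_upperbound[OF tendsto_norm[OF elim(1)]]) (use dom[OF elim(2)] in auto)
    qed
  qed
  have "(\<lambda>n. integral\<^sup>L halfline (\<lambda>x. (cmod (g n x - f x))\<^sup>2)) \<longlonglongrightarrow> integral\<^sup>L halfline (\<lambda>x. 0)"
  proof (rule integral_dominated_convergence[where w = "\<lambda>x. 4 * (cmod (w x))\<^sup>2"])
    show "integrable halfline (\<lambda>x. 4 * (cmod (w x))\<^sup>2)" using w by (simp add: square_integrable_def)
    show "AE x in halfline. (\<lambda>n. (cmod (g n x - f x))\<^sup>2) \<longlonglongrightarrow> 0"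
      using lim
    proof eventually_elim
      case (elim x)
      have "(\<lambda>n. g n x - f x) \<longlonglongrightarrow> 0" using elim by (simp add: LIM_zero)
      from tendsto_power[OF tendsto_norm[OF this], of 2] show ?case by simp
    qed
    show "AE x in halfline. norm ((cmod (g n x - f x))\<^sup>2) \<le> 4 * (cmod (w x))\<^sup>2" for n
    proof -
      have "AE x in halfline. x > 0" by (intro AE_I2) (simp add: space_restrict_space)
      with AE_dom show ?thesis
      proof eventually_elim
        case (elim x)
        have "cmod (g n x - f x) \<le> 2 * cmod (w x)"
          using dom[OF elim(2), of n] elim(1) norm_triangle_ineq4[of "g n x" "f x"] by linarith
        then have "(cmod (g n x - f x))\<^sup>2 \<le> (2 * cmod (w x))\<^sup>2" by (intro power_mono) auto
        then show ?case by (simp add: power_mult_distrib)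
      qed
    qed
  qed measurable
  then have "(\<lambda>n. (norm (L2_of (g n) - L2_of f))\<^sup>2) \<longlonglongrightarrow> 0"
    using f g by (simp add: L2_of_diff norm_L2_of square_integrable_diff)
  from tendsto_real_sqrt[OF this] have "(\<lambda>n. norm (L2_of (g n) - L2_of f)) \<longlonglongrightarrow> 0" by simp
  then show "(\<lambda>n. L2_of (g n)) \<longlonglongrightarrow> L2_of f"
    by (simp add: tendsto_norm_zero_iff LIM_zero_iff)
qed

text \<open>A square integrable function is first truncated to a bounded function of compact support.  A
  bounded measurable function is almost everywhere a limit of continuous functions; after projecting
  their values onto a disc and multiplying by a cutoff function they are dominated, hence converge
  in \<open>L\<^sup>2\<close>.\<close>

lemma Cc_dense: "closure (L2_of ` {f. Cc f}) = UNIV"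
proof -
  let ?D = "closure (L2_of ` {f. Cc f})"
  have step2: "L2_of f \<in> ?D" if f: "f \<in> borel_measurable halfline" "\<And>x. cmod (f x) \<le> B" "\<And>x. x \<notin> {s..t} \<Longrightarrow> f x = 0"
      and st: "0 < s" "s < t" for f B s t
  proof -
    have B: "B \<ge> 0" using f(2)[of 0] norm_ge_zero order_trans by blast
    have "f measurable_on {0<..}" using f(1) by (simp add: measurable_on_iff_borel_measurable)
    then obtain N g where N: "negligible N" and g: "\<And>n. continuous_on UNIV (g n)"
      and lim: "\<And>x. x \<notin> N \<Longrightarrow> (\<lambda>n. g n x) \<longlonglongrightarrow> (if x \<in> {0<..} then f x else 0)"
      unfolding measurable_on_def by blast
    define cl where "cl = closest_point (cball (0::complex) B)"
    have cl_cont: "continuous_on UNIV cl" unfolding cl_def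
      using B by (intro continuous_on_closest_point) auto
    have cl_bd: "cmod (cl z) \<le> B" for z
      using closest_point_in_set[of "cball (0::complex) B" z] B by (auto simp: cl_def)
    have cl_id: "cl z = z" if "cmod z \<le> B" for z
      using that unfolding cl_def by (intro closest_point_self) auto
    \<comment> \<open>Equal to \<open>1\<close> on \<open>[s, t]\<close> and supported in \<open>[s/2, t + 1]\<close>, away from \<open>0\<close>.\<close>
    define \<eta> :: "real \<Rightarrow> real" where "\<eta> x = max 0 (min 1 (min ((2 * x - s) / s) (t + 1 - x)))" for x
    have \<eta>_cont: "continuous_on UNIV \<eta>" unfolding \<eta>_def using st by (intro continuous_intros) auto
    have \<eta>01: "0 \<le> \<eta> x" "\<eta> x \<le> 1" for x by (auto simp: \<eta>_def)
    have \<eta>1: "\<eta> x = 1" if "x \<in> {s..t}" for x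
    proof -
      have "(2 * x - s) / s \<ge> 1" using that st by (simp add: field_simps)
      then show ?thesis using that by (simp add: \<eta>_def)
    qed
    have \<eta>0: "\<eta> x = 0" if "x \<notin> {s/2..t+1}" for x
    proof (cases "x < s / 2")
      case True
      then have "(2 * x - s) / s \<le> 0" using st by (simp add: field_simps)
      then show ?thesis by (simp add: \<eta>_def)
    next
      case False
      then have "t + 1 - x < 0" using that by auto
      then show ?thesis by (simp add: \<eta>_def)
    qed
    define h where "h n x = of_real (\<eta> x) * cl (g n x)" for n x
    have h: "Cc (h n)" for n
      unfolding Cc_def
    proof (intro conjI exI)
      show "continuous_on UNIV (h n)" unfolding h_def
        by (intro continuous_intros \<eta>_cont continuous_on_compose2[OF cl_cont g]) auto
      show "0 < s/2" "s/2 < t + 1" "\<forall>x. x \<notin> {s/2..t+1} \<longrightarrow> h n x = 0" using st \<eta>0 by (auto simp: h_def)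
    qed
    have sf: "square_integrable f" by (rule square_integrable_bounded_support[OF f(1)]) (use f in auto)
    have "(\<lambda>n. L2_of (h n)) \<longlonglongrightarrow> L2_of f"
    proof (rule L2_dominated_convergence[OF sf])
      show "h n \<in> borel_measurable halfline" for n
        using Cc_square_integrable[OF h] by (simp add: square_integrable_def)
      define w where "w x = (if x \<in> {s/2..t+1} then complex_of_real B else 0)" for x
      show "square_integrable w"
      proof (rule square_integrable_bounded_support[of _ B "s/2" "t+1"])
        show "w \<in> borel_measurable halfline"
          unfolding w_def by (intro measurable_restrict_space1 measurable_If) (auto intro!: borel_closed)
      qed (use B in \<open>auto simp: w_def\<close>)
      show "cmod (h n x) \<le> cmod (w x)" for n x
      proof (cases "x \<in> {s/2..t+1}")
        case True
        have "cmod (h n x) \<le> 1 * B" unfolding h_def norm_mult using \<eta>01[of x] cl_bd by (intro mult_mono) auto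
        then show ?thesis using True B by (simp add: w_def)
      qed (simp add: h_def \<eta>0)
      show "AE x in halfline. (\<lambda>n. h n x) \<longlonglongrightarrow> f x"
      proof (rule AE_restrict_space_iff[THEN iffD2])
        have "AE x in lebesgue. x \<notin> N" using N by (simp add: negligible_iff_null_sets AE_not_in)
        then show "AE x in lebesgue. x \<in> {0<..} \<longrightarrow> (\<lambda>n. h n x) \<longlonglongrightarrow> f x"
        proof eventually_elim
          case (elim x)
          show ?case
          proof
            assume x: "x \<in> {0<..}"
            have "(\<lambda>n. cl (g n x)) \<longlonglongrightarrow> cl (f x)"
              using lim[OF elim] x cl_cont
              by (intro isCont_tendsto_compose[of _ cl]) (auto simp: continuous_on_eq_continuous_at)
            then have "(\<lambda>n. h n x) \<longlonglongrightarrow> of_real (\<eta> x) * f x"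
              unfolding h_def using cl_id[OF f(2)] by (intro tendsto_intros) auto
            moreover have "of_real (\<eta> x) * f x = f x" using \<eta>1[of x] f(3)[of x] by (cases "x \<in> {s..t}") auto
            ultimately show "(\<lambda>n. h n x) \<longlonglongrightarrow> f x" by simp
          qed
        qed
      qed auto
    qed
    then show ?thesis using h unfolding closure_sequential by (intro exI[of _ "\<lambda>n. L2_of (h n)"]) auto
  qed
  have "u \<in> ?D" for u
  proof -
    obtain f where f: "square_integrable f" "L2_of f = u" by (rule L2_of_surj)
    have [measurable]: "f \<in> borel_measurable halfline" using f by (simp add: square_integrable_def)
    define g where "g n x = (if x \<in> {1 / (real n + 2)..real n + 2} \<and> cmod (f x) \<le> real n then f x else 0)" for n x
    have pos: "0 < 1 / (real n + 2)" for n by simp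
    have gm [measurable]: "g n \<in> borel_measurable halfline" for n
    proof -
      have [measurable]: "{1 / (real n + 2)..real n + 2} \<in> sets halfline"
        using less_le_trans[OF pos[of n]] by (auto simp: sets_restrict_space_iff)
      show ?thesis unfolding g_def by measurable
    qed
    have "L2_of (g n) \<in> ?D" for n
    proof (rule step2[of _ "real n" "1 / (real n + 2)" "real n + 2"])
      have "1 / (real n + 2) \<le> 1" by simp
      then show "1 / (real n + 2) < real n + 2" by linarith
    qed (auto simp: g_def intro!: gm)
    moreover have "(\<lambda>n. L2_of (g n)) \<longlonglongrightarrow> L2_of f"
    proof (rule L2_dominated_convergence[OF f(1) gm f(1)])
      show "AE x in halfline. (\<lambda>n. g n x) \<longlonglongrightarrow> f x"
      proof (rule AE_I2)
        fix x assume "x \<in> space halfline"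
        then have x: "x > 0" by (simp add: space_restrict_space)
        obtain n0 where n0: "real n0 \<ge> max x (max (1/x) (cmod (f x)))" using real_arch_simple by blast
        have "g n x = f x" if "n \<ge> n0" for n
        proof -
          have n: "real n \<ge> x" "real n \<ge> 1/x" "real n \<ge> cmod (f x)" using n0 that by (auto intro: order_trans)
          have "1 \<le> real n * x" using n(2) x by (simp add: field_simps)
          then have "1 / (real n + 2) \<le> x" using x by (simp add: field_simps)
          then show ?thesis using n by (simp add: g_def)
        qed
        then show "(\<lambda>n. g n x) \<longlonglongrightarrow> f x"
          by (intro tendsto_eventually) (auto simp: eventually_sequentially)
      qed
    qed (auto simp: g_def)
    ultimately have "L2_of f \<in> closure ?D"
      unfolding closure_sequential[of _ ?D] by (intro exI[of _ "\<lambda>n. L2_of (g n)"]) simp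
    then show ?thesis using f by simp
  qed
  then show ?thesis by (intro UNIV_eq_I[symmetric])
qed

lemma square_integrable_cong:
  assumes "\<And>x. x > 0 \<Longrightarrow> f x = g x"
  shows "square_integrable f \<longleftrightarrow> square_integrable g"
proof -
  have "f \<in> borel_measurable halfline \<longleftrightarrow> g \<in> borel_measurable halfline"
    by (rule measurable_cong) (use assms in \<open>simp add: space_restrict_space\<close>)
  moreover have "integrable halfline (\<lambda>x. (cmod (f x))\<^sup>2) \<longleftrightarrow> integrable halfline (\<lambda>x. (cmod (g x))\<^sup>2)"
    by (rule Bochner_Integration.integrable_cong) (use assms in \<open>auto simp: space_restrict_space\<close>)
  ultimately show ?thesis by (simp add: square_integrable_def)
qed

lemma L2_of_cong:
  assumes "\<And>x. x > 0 \<Longrightarrow> f x = g x" "square_integrable f"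
  shows "L2_of f = L2_of g"
proof -
  have g: "square_integrable g" using assms square_integrable_cong[of f g] by simp
  have "AE x in halfline. f x = g x" by (rule AE_I2) (use assms in \<open>simp add: space_restrict_space\<close>)
  then show ?thesis using L2_of_eq_iff[OF assms(2) g] by simp
qed

text \<open>A nonempty open set is not negligible.  This is what makes pointwise values of the continuous
  representative of a class meaningful.\<close>

lemma AE_halfline_continuous_eq:
  fixes f g :: "real \<Rightarrow> complex"
  assumes ae: "AE x in halfline. f x = g x" and c: "continuous_on {0<..} f" "continuous_on {0<..} g" and x: "x > 0"
  shows "f x = g x"
proof (rule ccontr)
  assume ne: "f x \<noteq> g x"
  have "continuous_on {0<..} (\<lambda>x. f x - g x)" by (intro continuous_intros c)
  define S where "S = {0<..} \<inter> (\<lambda>x. f x - g x) -` (- {0})"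
  have o: "open S" unfolding S_def
    by (rule continuous_open_preimage[OF \<open>continuous_on {0<..} (\<lambda>x. f x - g x)\<close>]) auto
  have "AE x in lebesgue. x \<in> {0<..} \<longrightarrow> f x = g x" using ae by (simp add: AE_restrict_space_iff)
  then obtain N where N: "N \<in> null_sets lebesgue" "\<And>y. y \<notin> N \<Longrightarrow> y > 0 \<Longrightarrow> f y = g y"
    by (rule AE_E3) auto
  have "S \<subseteq> N" using N(2) by (auto simp: S_def)
  then have "negligible S" using N(1) negligible_iff_null_sets negligible_subset by blast
  then have "S = {}" using o open_not_negligible by blast
  then show False using x ne by (auto simp: S_def)
qed

lemma sigma_finite_halfline: "sigma_finite_measure halfline"
proof
  let ?A = "range (\<lambda>n::nat. {0<..<real n})"
  have "\<exists>n::nat. x < real n" for x by (rule reals_Archimedean2)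
  then have "\<Union>?A = space halfline" by (auto simp: space_restrict_space)
  moreover have "?A \<subseteq> sets halfline" by (auto simp: sets_restrict_space_iff)
  moreover have "emeasure halfline {0<..<real n} \<noteq> \<infinity>" for n
    by (subst emeasure_restrict_space) (auto simp: emeasure_lborel_Ioo)
  ultimately show "\<exists>A. countable A \<and> A \<subseteq> sets halfline \<and> \<Union> A = space halfline \<and> (\<forall>a\<in>A. emeasure halfline a \<noteq> \<infinity>)"
    by (intro exI[of _ ?A]) auto
qed

section \<open>Liouville--Green asymptotics of solutions\<close>

locale SL_problem =
  fixes p q a' pa'' :: "real \<Rightarrow> real" and p0 q0 x0 :: real
  assumes p_C1: "p C1_differentiable_on {0<..}"
    and q_cont: "continuous_on {0<..} q"
    and p_lim: "(p \<longlongrightarrow> p0) (at_right 0)"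
    and q_lim: "(q \<longlongrightarrow> q0) (at_right 0)"
    and p0_pos: "p0 > 0" and p_pos: "\<And>x. x > 0 \<Longrightarrow> p x > 0"
    and x0_pos: "x0 > 0"
    and q_pos: "\<And>x. x \<ge> x0 \<Longrightarrow> q x > 0"
    and a_deriv: "\<And>x. x \<ge> x0 \<Longrightarrow> (amp p q has_real_derivative a' x) (at x within {x0..})"
    and a_C1: "continuous_on {x0..} a'"
    and a'_ac: "locally_abs_continuous_on {x0..} a'"
    and pa'_deriv: "AE x in lebesgue_on {x0<..}. ((\<lambda>y. p y * a' y) has_real_derivative pa'' x) (at x)"
    and a_L2: "integrable (lebesgue_on {x0<..}) (\<lambda>x. (amp p q x)\<^sup>2)"
    and apa''_L1: "integrable (lebesgue_on {x0<..}) (\<lambda>x. amp p q x * pa'' x)"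
    and paa'_lim: "((\<lambda>x. p x * a' x * amp p q x) \<longlongrightarrow> 0) at_top"
begin

abbreviation a :: "real \<Rightarrow> real" where "a \<equiv> amp p q"
abbreviation \<Xi> :: "real \<Rightarrow> real" where "\<Xi> \<equiv> phase p q x0"
definition \<xi> :: "real \<Rightarrow> real" where "\<xi> x = sqrt (q x / p x)"

definition p' :: "real \<Rightarrow> real" where "p' = vderiv p"

lemma p_deriv: "x > 0 \<Longrightarrow> (p has_real_derivative p' x) (at x)"
  using p_C1 unfolding C1_differentiable_on_eq p'_def has_real_derivative_iff_has_vector_derivative
  by (simp add: vector_derivative_works)

lemma p'_cont: "continuous_on {0<..} p'"
  using p_C1 unfolding C1_differentiable_on_eq p'_def by simp

lemma p_cont: "continuous_on {0<..} p"
  by (rule C1_differentiable_imp_continuous_on[OF p_C1])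

lemma a_pos: "x \<ge> x0 \<Longrightarrow> a x > 0"
  using q_pos[of x] p_pos[of x] x0_pos by (simp add: amp_def)

lemma a_square: assumes "x \<ge> x0" shows "(a x)\<^sup>2 = 1 / sqrt (p x * q x)"
proof -
  define P where "P = p x * q x"
  have P: "P > 0" using q_pos[of x] p_pos[of x] x0_pos assms by (simp add: P_def)
  have "(a x)\<^sup>2 = P powr (- (1/2))"
    unfolding amp_def P_def[symmetric] power2_eq_square powr_add[symmetric] by simp
  also have "\<dots> = inverse (P powr (1/2))" by (rule powr_minus)
  also have "P powr (1/2) = sqrt P" using P by (intro powr_half_sqrt) simp
  finally show ?thesis by (simp add: P_def inverse_eq_divide)
qed

lemma \<xi>_pos: "x \<ge> x0 \<Longrightarrow> \<xi> x > 0"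
  using q_pos[of x] p_pos[of x] x0_pos by (simp add: \<xi>_def)

lemma p_a_square_\<xi>: assumes "x \<ge> x0" shows "p x * (a x)\<^sup>2 * \<xi> x = 1"
proof -
  have pq: "p x > 0" "q x > 0" using q_pos[of x] p_pos[of x] x0_pos assms by auto
  have "p x * (a x)\<^sup>2 * \<xi> x = p x * sqrt (q x / p x) / sqrt (p x * q x)"
    by (simp add: a_square[OF assms] \<xi>_def)
  also have "\<dots> = 1" using pq by (simp add: real_sqrt_divide real_sqrt_mult field_simps)
  finally show ?thesis .
qed

lemma q_a_square: assumes "x \<ge> x0" shows "q x * (a x)\<^sup>2 = \<xi> x"
proof -
  have pq: "p x > 0" "q x > 0" using q_pos[of x] p_pos[of x] x0_pos assms by auto
  have "q x = p x * (\<xi> x)\<^sup>2" using pq by (simp add: \<xi>_def)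
  then have "q x * (a x)\<^sup>2 = \<xi> x * (p x * (a x)\<^sup>2 * \<xi> x)" by (simp add: power2_eq_square)
  then show ?thesis by (simp add: p_a_square_\<xi>[OF assms])
qed

lemma a_deriv_at: "x > x0 \<Longrightarrow> (a has_real_derivative a' x) (at x)"
  using a_deriv[of x] at_within_interior[of x "{x0..}"] by (simp add: interior_real_atLeast)

lemma a_cont: "continuous_on {x0..} a"
  by (rule DERIV_continuous_on[OF a_deriv]) auto

lemma \<xi>_cont: "continuous_on {x0..} \<xi>"
  unfolding \<xi>_def using p_pos x0_pos
  by (intro continuous_intros continuous_on_subset[OF p_cont] continuous_on_subset[OF q_cont])
     (auto simp: less_imp_neq[symmetric])

lemma \<Xi>_deriv_within: "x \<ge> x0 \<Longrightarrow> (\<Xi> has_real_derivative \<xi> x) (at x within {x0..x+1})"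
  using integral_has_vector_derivative[of x0 "x+1" \<xi> x] continuous_on_subset[OF \<xi>_cont, of "{x0..x+1}"]
  unfolding has_real_derivative_iff_has_vector_derivative phase_def \<xi>_def[symmetric, abs_def] by auto

lemma \<Xi>_deriv: assumes "x > x0" shows "(\<Xi> has_real_derivative \<xi> x) (at x)"
  using \<Xi>_deriv_within[of x] at_within_interior[of x "{x0..x+1}"] assms
  by (simp add: interior_atLeastAtMost_real)

lemma \<Xi>_cont: "continuous_on {x0..} \<Xi>"
  unfolding continuous_on_eq_continuous_within
proof
  fix x assume x: "x \<in> {x0..}"
  have "at x within {x0..} = at x within {x0..x+1}"
    by (rule at_within_nhd[of x "{..<x+1}"]) auto
  then show "continuous (at x within {x0..}) \<Xi>"
    using DERIV_continuous[OF \<Xi>_deriv_within] x by simp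
qed

lemma \<Xi>_mono: assumes "x0 \<le> s" "s \<le> t" shows "\<Xi> s \<le> \<Xi> t"
proof (rule DERIV_nonneg_imp_increasing_open[OF assms(2)])
  show "\<exists>y. (\<Xi> has_real_derivative y) (at x) \<and> 0 \<le> y" if "s < x" "x < t" for x
    using \<Xi>_deriv[of x] \<xi>_pos[of x] that assms by (auto intro!: exI[of _ "\<xi> x"])
qed (use assms in \<open>auto intro: continuous_on_subset[OF \<Xi>_cont]\<close>)

text \<open>The identity \<open>(ln a)' = (p a a') \<xi>\<close> and the boundedness of \<open>p a a'\<close> show that a bounded phase
  would keep \<open>a\<close> away from \<open>0\<close>, contradicting its square integrability.\<close>

lemma \<Xi>_at_top: "filterlim \<Xi> at_top at_top"
proof (rule ccontr)
  assume "\<not> ?thesis"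
  then obtain B where "\<not> eventually (\<lambda>x. \<Xi> x \<ge> B) at_top" by (auto simp: filterlim_at_top)
  then have B: "\<Xi> x \<le> B" if "x \<ge> x0" for x
    using \<Xi>_mono[of x] that unfolding eventually_at_top_linorder 
    by (metis linorder_le_cases order_trans)
  have "\<forall>\<^sub>F x in at_top. \<bar>p x * a' x * a x\<bar> < 1"
    using paa'_lim by (auto simp: tendsto_iff dest: spec[of _ 1])
  then have "\<forall>\<^sub>F x in at_top. \<bar>p x * a' x * a x\<bar> < 1 \<and> x > x0"
    using eventually_gt_at_top by (rule eventually_conj)
  then obtain X where X: "\<And>x. x \<ge> X \<Longrightarrow> \<bar>p x * a' x * a x\<bar> < 1 \<and> x > x0"
    unfolding eventually_at_top_linorder by auto
  \<comment> \<open>A lower bound for \<open>ln a\<close>, since \<open>ln a + \<Xi>\<close> increases from \<open>X\<close> on.\<close>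
  define m where "m = ln (a X) - (B - \<Xi> X)"
  have lower: "ln (a x) \<ge> m" if "x \<ge> X" for x
  proof -
    have "ln (a X) + \<Xi> X \<le> ln (a x) + \<Xi> x"
    proof (rule DERIV_nonneg_imp_nondecreasing[OF that])
      fix t assume t: "X \<le> t" "t \<le> x"
      have t0: "t > x0" "\<bar>p t * a' t * a t\<bar> < 1" using X[of t] t by auto
      have pos: "a t > 0" "\<xi> t > 0" using a_pos[of t] \<xi>_pos[of t] t0 by auto
      have "a' t / a t = (p t * (a t)\<^sup>2 * \<xi> t) * (a' t / a t)" using p_a_square_\<xi>[of t] t0 by simp
      also have "\<dots> = (p t * a' t * a t) * \<xi> t" using pos by (simp add: power2_eq_square)
      also have "\<dots> \<ge> (-1) * \<xi> t" using t0 pos by (intro mult_right_mono) auto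
      finally have "a' t / a t + \<xi> t \<ge> 0" by simp
      moreover have "((\<lambda>x. ln (a x) + \<Xi> x) has_real_derivative a' t / a t + \<xi> t) (at t)"
        using a_deriv_at[OF t0(1)] \<Xi>_deriv[OF t0(1)] pos by (auto intro!: derivative_eq_intros)
      ultimately show "\<exists>y. ((\<lambda>x. ln (a x) + \<Xi> x) has_real_derivative y) (at t) \<and> 0 \<le> y" by blast
    qed
    then show ?thesis using B[of x] X[of x] that by (simp add: m_def)
  qed
  define e where "e = (exp m)\<^sup>2"
  have e: "e > 0" by (simp add: e_def)
  have ae: "(a x)\<^sup>2 \<ge> e" if "x \<ge> X" for x
    unfolding e_def using lower[OF that] a_pos[of x] X[OF that] 
    by (intro power_mono) (auto simp: ln_ge_iff)
  have "x0 < X" using X[of X] by simp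
  have lim: "((\<lambda>d. integral {x0..d} (\<lambda>x. (a x)\<^sup>2)) \<longlongrightarrow> integral\<^sup>L (lebesgue_on {x0<..}) (\<lambda>x. (a x)\<^sup>2)) at_top"
    by (rule integral_Icc_tendsto[OF a_L2])
  have "filterlim (\<lambda>d. integral {x0..d} (\<lambda>x. (a x)\<^sup>2)) at_top at_top"
  proof (rule filterlim_at_top_mono)
    show "filterlim (\<lambda>d. -X * e + d * e) at_top at_top"
      using e by (intro filterlim_tendsto_add_at_top[OF tendsto_const] filterlim_at_top_mult_tendsto_pos[OF tendsto_const] filterlim_ident)
    show "\<forall>\<^sub>F d in at_top. -X * e + d * e \<le> integral {x0..d} (\<lambda>x. (a x)\<^sup>2)"
    proof (rule eventually_mono[OF eventually_ge_at_top[of X]])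
      fix d assume d: "X \<le> d"
      have cont: "continuous_on {s..t} (\<lambda>x. (a x)\<^sup>2)" if "s \<ge> x0" for s t
        using that by (intro continuous_intros continuous_on_subset[OF a_cont]) auto
      have "-X * e + d * e = integral {X..d} (\<lambda>x. e)" using d by (simp add: algebra_simps)
      also have "\<dots> \<le> integral {X..d} (\<lambda>x. (a x)\<^sup>2)"
        using ae \<open>x0 < X\<close> by (intro integral_le integrable_continuous_real cont) auto
      also have "\<dots> \<le> integral {x0..d} (\<lambda>x. (a x)\<^sup>2)"
        using \<open>x0 < X\<close> by (intro integral_subset_le integrable_continuous_real cont) auto
      finally show "-X * e + d * e \<le> integral {x0..d} (\<lambda>x. (a x)\<^sup>2)" .
    qed
  qed
  then show False using lim not_tendsto_and_filterlim_at_infinity[OF _ lim]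
    by (auto dest: filterlim_at_top_imp_at_infinity)
qed

text \<open>Real solutions of \<open>\<tau> u = 0\<close> as a first order system, with \<open>w = p u'\<close>.\<close>

definition solution :: "(real \<Rightarrow> real) \<Rightarrow> (real \<Rightarrow> real) \<Rightarrow> bool" where
  "solution u w \<longleftrightarrow> (\<forall>x>0. (u has_real_derivative w x / p x) (at x) \<and>
     (w has_real_derivative - q x * u x) (at x))"

text \<open>The Liouville--Green variables \<open>y = u / a\<close> and \<open>z = p a\<^sup>2 y'\<close>, followed by a component of
  \<open>(y, z)\<close> in coordinates that rotate with the phase.  The offset \<open>\<tau> = 0\<close> gives the first component
  and \<open>\<tau> = - \<pi>/2\<close> the second one.\<close>

definition scaled where "scaled u x = u x / a x"
definition scaled_deriv where "scaled_deriv u w x = a x * w x - p x * a' x * u x"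
definition rotated where "rotated u w \<tau> x = cos (\<Xi> x + \<tau>) * scaled u x - sin (\<Xi> x + \<tau>) * scaled_deriv u w x"

lemma solution_cont: assumes "solution u w" shows "continuous_on {0<..} u" "continuous_on {0<..} w"
  using assms unfolding solution_def continuous_on_eq_continuous_at[OF open_greaterThan]
  by (auto intro: DERIV_isCont)

text \<open>Rotation removes the leading terms of \<open>y' = \<xi> z\<close>, \<open>z' = - (\<xi> + r) y\<close> and leaves
  \<open>sin (\<Xi> + \<tau>) r y\<close> with \<open>r = a (p a')'\<close>.  The only part of the rotated component that is not
  continuously differentiable is a smooth multiple of \<open>a'\<close>, so \<open>a'\<close> dominates its increments.\<close>

lemma rotated_has_integral:
  assumes sol: "solution u w" and cd: "x0 < c" "c \<le> d"
  shows "((\<lambda>x. sin (\<Xi> x + \<tau>) * (a x * pa'' x) * scaled u x) has_integral rotated u w \<tau> d - rotated u w \<tau> c) {c..d}"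
proof -
  have sub: "{c..d} \<subseteq> {0<..}" "{c..d} \<subseteq> {x0..}" using cd x0_pos by auto
  note conts = continuous_on_subset[OF p_cont sub(1)] continuous_on_subset[OF p'_cont sub(1)] continuous_on_subset[OF q_cont sub(1)]
    continuous_on_subset[OF solution_cont(1)[OF sol] sub(1)] continuous_on_subset[OF solution_cont(2)[OF sol] sub(1)]
    continuous_on_subset[OF a_cont sub(2)] continuous_on_subset[OF a_C1 sub(2)]
    continuous_on_subset[OF \<xi>_cont sub(2)] continuous_on_subset[OF \<Xi>_cont sub(2)]
  have du: "(u has_real_derivative w x / p x) (at x)" and dw: "(w has_real_derivative - q x * u x) (at x)"
    if "x \<ge> c" for x using sol that cd x0_pos by (auto simp: solution_def)
  have pos: "a x > 0" "p x > 0" if "x \<ge> c" for x using a_pos[of x] p_pos[of x] that cd x0_pos by auto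
  have da: "(a has_real_derivative a' x) (at x)" "(\<Xi> has_real_derivative \<xi> x) (at x)" 
    "(p has_real_derivative p' x) (at x)" if "x \<ge> c" for x
    using a_deriv_at \<Xi>_deriv p_deriv that cd x0_pos by auto
  \<comment> \<open>The rotated component splits as \<open>G + Q a'\<close> with \<open>G\<close> and \<open>Q\<close> continuously differentiable.\<close>
  define G where "G x = cos (\<Xi> x + \<tau>) * (u x / a x) - sin (\<Xi> x + \<tau>) * (a x * w x)" for x
  define G' where "G' x = - sin (\<Xi> x + \<tau>) * \<xi> x * (u x / a x) + cos (\<Xi> x + \<tau>) * ((w x / p x * a x - u x * a' x) / (a x * a x))
     - (cos (\<Xi> x + \<tau>) * \<xi> x * (a x * w x) + sin (\<Xi> x + \<tau>) * (a' x * w x - a x * (q x * u x)))" for x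
  define Q where "Q x = sin (\<Xi> x + \<tau>) * (p x * u x)" for x
  define Q' where "Q' x = cos (\<Xi> x + \<tau>) * \<xi> x * (p x * u x) + sin (\<Xi> x + \<tau>) * (p' x * u x + w x)" for x
  have dy0: "((\<lambda>x. u x / a x) has_real_derivative (w x / p x * a x - u x * a' x) / (a x * a x)) (at x)"
    if "x \<ge> c" for x
    using pos[OF that] by (auto intro!: derivative_eq_intros du da that)
  have dG: "(G has_real_derivative G' x) (at x)" if "x \<ge> c" for x
    unfolding G_def G'_def
    by (rule dy0[OF that] derivative_eq_intros refl dw[OF that] da[OF that])+ (simp add: algebra_simps)
  have dQ: "(Q has_real_derivative Q' x) (at x)" if "x \<ge> c" for x
    unfolding Q_def Q'_def using pos[OF that]
    by (auto intro!: derivative_eq_intros du[OF that] dw[OF that] da[OF that] simp: algebra_simps)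
  have nz: "\<forall>x\<in>{c..d}. a x \<noteq> 0" "\<forall>x\<in>{c..d}. p x \<noteq> 0" using pos by force+
  have cG: "continuous_on {c..d} G'" and cQ: "continuous_on {c..d} Q'" and "continuous_on {c..d} Q"
    unfolding G'_def Q'_def Q_def using nz by (auto intro!: continuous_intros conts)
  obtain LG where LG: "LG \<ge> 0" "\<And>s t. \<lbrakk>c \<le> s; s \<le> t; t \<le> d\<rbrakk> \<Longrightarrow> \<bar>G t - G s\<bar> \<le> LG * (t - s)"
    using C1_imp_lipschitz_Icc[of c d G G'] dG cG by auto
  obtain LQ where LQ: "LQ \<ge> 0" "\<And>s t. \<lbrakk>c \<le> s; s \<le> t; t \<le> d\<rbrakk> \<Longrightarrow> \<bar>Q t - Q s\<bar> \<le> LQ * (t - s)"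
    using C1_imp_lipschitz_Icc[of c d Q Q'] dQ cQ by auto
  have bdd: "\<exists>B>0. \<forall>x\<in>{c..d}. \<bar>h x\<bar> \<le> B" if "continuous_on {c..d} h" for h :: "real \<Rightarrow> real"
    using compact_imp_bounded[OF compact_continuous_image[OF that]] by (auto simp: bounded_pos)
  obtain BQ where BQ: "BQ > 0" "\<And>x. x \<in> {c..d} \<Longrightarrow> \<bar>Q x\<bar> \<le> BQ" using bdd[OF \<open>continuous_on {c..d} Q\<close>] by auto
  obtain Ba where Ba: "Ba > 0" "\<And>x. x \<in> {c..d} \<Longrightarrow> \<bar>a' x\<bar> \<le> Ba" using bdd[of a'] conts by auto
  have F_eq: "rotated u w \<tau> x = G x + Q x * a' x" for x
    by (simp add: rotated_def scaled_def scaled_deriv_def G_def Q_def algebra_simps)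
  obtain N where N: "negligible N" "\<And>x. x \<in> {c..d} - N \<Longrightarrow> ((\<lambda>y. p y * a' y) has_real_derivative pa'' x) (at x)"
  proof -
    obtain N where N: "N \<in> null_sets (lebesgue_on {x0<..})" 
      "{x \<in> space (lebesgue_on {x0<..}). \<not> ((\<lambda>y. p y * a' y) has_real_derivative pa'' x) (at x)} \<subseteq> N"
      using pa'_deriv by (rule AE_E3) (auto simp: null_sets_def)
    have "N \<in> null_sets lebesgue" using N(1) by (simp add: null_sets_restrict_space)
    then have "negligible N" by (simp add: negligible_iff_null_sets)
    moreover have "((\<lambda>y. p y * a' y) has_real_derivative pa'' x) (at x)" if "x \<in> {c..d} - N" for x
    proof -
      have "x > x0" using that cd by auto
      then show ?thesis using N(2) that by (auto simp: space_restrict_space)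
    qed
    ultimately show ?thesis by (rule that)
  qed
  show ?thesis
  proof (rule fundamental_theorem_of_calculus_abs_continuous[OF cd(2) _ _ N(1), of a' _ "LG + BQ + Ba * LQ"])
    show "abs_continuous_on_interval c d a'" using a'_ac sub cd by (simp add: locally_abs_continuous_on_def)
    fix s t assume st: "c \<le> s" "s \<le> t" "t \<le> d"
    have "rotated u w \<tau> t - rotated u w \<tau> s = (G t - G s) + (Q t * (a' t - a' s) + a' s * (Q t - Q s))"
      by (simp add: F_eq algebra_simps)
    also have "\<bar>\<dots>\<bar> \<le> \<bar>G t - G s\<bar> + (\<bar>Q t\<bar> * \<bar>a' t - a' s\<bar> + \<bar>a' s\<bar> * \<bar>Q t - Q s\<bar>)"
      using abs_triangle_ineq[of "G t - G s" "Q t * (a' t - a' s) + a' s * (Q t - Q s)"]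
        abs_triangle_ineq[of "Q t * (a' t - a' s)" "a' s * (Q t - Q s)"] by (simp add: abs_mult)
    also have "\<dots> \<le> LG * (t - s) + (BQ * \<bar>a' t - a' s\<bar> + Ba * (LQ * (t - s)))"
      using st BQ Ba LQ LG by (intro add_mono mult_mono) auto
    also have "\<dots> \<le> (LG + BQ + Ba * LQ) * (\<bar>a' t - a' s\<bar> + (t - s))"
    proof -
      have "0 \<le> (LG + Ba * LQ) * \<bar>a' t - a' s\<bar> + BQ * (t - s)"
        using st BQ Ba LQ LG by auto
      then show ?thesis by (simp add: algebra_simps)
    qed
    finally show "norm (rotated u w \<tau> t - rotated u w \<tau> s) \<le> (LG + BQ + Ba * LQ) * (\<bar>a' t - a' s\<bar> + (t - s))" by simp
  next
    fix x assume x: "x \<in> {c..d} - N"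
    then have xc: "x \<ge> c" "x \<ge> x0" using cd by auto
    have id1: "p x * (a x)\<^sup>2 * \<xi> x = 1" and id2: "q x * (a x)\<^sup>2 = \<xi> x" using p_a_square_\<xi> q_a_square xc by auto
    have dz: "((\<lambda>x. a x * w x - (p x * a' x) * u x) has_real_derivative
       a' x * w x - a x * (q x * u x) - (pa'' x * u x + p x * a' x * (w x / p x))) (at x)"
      by (rule N(2)[OF x] derivative_eq_intros refl du dw da xc)+ (simp add: algebra_simps)
    have dz_eq: "a' x * w x - a x * (q x * u x) - (pa'' x * u x + p x * a' x * (w x / p x))
       = - (\<xi> x + a x * pa'' x) * (u x / a x)"
      unfolding id2[symmetric] using pos[OF xc(1)] by (simp add: field_simps power2_eq_square)
    have xi_eq: "\<xi> x = 1 / (p x * (a x)\<^sup>2)" using id1 pos[OF xc(1)] by (simp add: field_simps)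
    have dy_eq: "(w x / p x * a x - u x * a' x) / (a x * a x) = \<xi> x * (a x * w x - p x * a' x * u x)"
      unfolding xi_eq using pos[OF xc(1)] by (simp add: field_simps power2_eq_square)
    have "(rotated u w \<tau> has_real_derivative sin (\<Xi> x + \<tau>) * (a x * pa'' x) * scaled u x) (at x)"
      unfolding rotated_def[abs_def] scaled_def scaled_deriv_def
      by (rule derivative_eq_intros refl dy0[OF xc(1), unfolded dy_eq] dz[unfolded dz_eq] da xc)+
         (simp add: algebra_simps)
    then show "(rotated u w \<tau> has_vector_derivative sin (\<Xi> x + \<tau>) * (a x * pa'' x) * scaled u x) (at x within {c..d})"
      by (simp add: has_real_derivative_iff_has_vector_derivative[symmetric] has_field_derivative_at_within)
  qed
qed

lemma rotation_wronskian:
  fixes c s :: real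
  assumes "s\<^sup>2 + c\<^sup>2 = 1"
  shows "(A * c + B * s) * (D * c - C * s) - (C * c + D * s) * (B * c - A * s) = A * D - C * B"
  using assms by algebra

lemma rotate_back:
  shows "scaled u x = rotated u w 0 x * cos (\<Xi> x) + rotated u w (- pi / 2) x * sin (\<Xi> x)"
    and "scaled_deriv u w x = rotated u w (- pi / 2) x * cos (\<Xi> x) - rotated u w 0 x * sin (\<Xi> x)"
proof -
  have "rotated u w (- pi / 2) x = sin (\<Xi> x) * scaled u x + cos (\<Xi> x) * scaled_deriv u w x"
    by (simp add: rotated_def cos_diff sin_diff)
  moreover have "rotated u w 0 x = cos (\<Xi> x) * scaled u x - sin (\<Xi> x) * scaled_deriv u w x"
    by (simp add: rotated_def)
  moreover have "(sin (\<Xi> x))\<^sup>2 + (cos (\<Xi> x))\<^sup>2 = 1" by simp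
  ultimately show "scaled u x = rotated u w 0 x * cos (\<Xi> x) + rotated u w (- pi / 2) x * sin (\<Xi> x)"
    and "scaled_deriv u w x = rotated u w (- pi / 2) x * cos (\<Xi> x) - rotated u w 0 x * sin (\<Xi> x)"
    by algebra+
qed

lemma scaled_cont: assumes "solution u w" shows "continuous_on {x0..} (scaled u)"
  unfolding scaled_def using a_pos x0_pos
  by (intro continuous_intros continuous_on_subset[OF solution_cont(1)[OF assms]] a_cont) (auto simp: less_imp_neq[symmetric])

lemma rotated_cont: assumes "solution u w" shows "continuous_on {x0..} (rotated u w \<tau>)"
  unfolding rotated_def scaled_deriv_def using x0_pos
  by (intro continuous_intros scaled_cont[OF assms] \<Xi>_cont a_cont a_C1 continuous_on_subset[OF p_cont] 
      continuous_on_subset[OF solution_cont(1)[OF assms]] continuous_on_subset[OF solution_cont(2)[OF assms]]) auto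

lemma r_abs_integrable: "(\<lambda>x. a x * pa'' x) absolutely_integrable_on {x0..d}"
  by (rule integrable_on_Icc[OF apa''_L1])

lemma r_abs_integrable_on: "c \<ge> x0 \<Longrightarrow> (\<lambda>x. \<bar>a x * pa'' x\<bar>) integrable_on {c..d}"
  using absolutely_integrable_on_subinterval[OF r_abs_integrable[of d], of c d]
  by (auto simp: absolutely_integrable_on_def)

lemma rotated_increment:
  assumes sol: "solution u w" and cd: "x0 < c" "c \<le> d" and B: "\<And>x. x \<in> {c..d} \<Longrightarrow> \<bar>scaled u x\<bar> \<le> B"
  shows "\<bar>rotated u w \<tau> d - rotated u w \<tau> c\<bar> \<le> B * integral {c..d} (\<lambda>x. \<bar>a x * pa'' x\<bar>)"
proof -
  note hi = rotated_has_integral[OF sol cd, of \<tau>]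
  have "norm (integral {c..d} (\<lambda>x. sin (\<Xi> x + \<tau>) * (a x * pa'' x) * scaled u x)) \<le> integral {c..d} (\<lambda>x. B * \<bar>a x * pa'' x\<bar>)"
  proof (rule integral_norm_bound_integral)
    show "(\<lambda>x. sin (\<Xi> x + \<tau>) * (a x * pa'' x) * scaled u x) integrable_on {c..d}" using hi by blast
    show "(\<lambda>x. B * \<bar>a x * pa'' x\<bar>) integrable_on {c..d}"
      using cd by (intro integrable_on_mult_right r_abs_integrable_on) auto
    fix x assume x: "x \<in> {c..d}"
    have "\<bar>sin (\<Xi> x + \<tau>)\<bar> * \<bar>a x * pa'' x\<bar> * \<bar>scaled u x\<bar> \<le> 1 * \<bar>a x * pa'' x\<bar> * B"
      using B[OF x] by (intro mult_mono) auto
    then show "norm (sin (\<Xi> x + \<tau>) * (a x * pa'' x) * scaled u x) \<le> B * \<bar>a x * pa'' x\<bar>"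
      by (simp add: abs_mult mult_ac)
  qed
  then show ?thesis by (simp add: integral_unique[OF hi])
qed

text \<open>Once the remaining mass of \<open>r\<close> is small, the maximum of the
  rotated components on an interval is controlled by their values at its left end.\<close>

lemma scaled_bounded:
  assumes sol: "solution u w"
  obtains X K where "X > x0" "\<And>x. x \<ge> X \<Longrightarrow> \<bar>scaled u x\<bar> \<le> K"
proof -
  let ?R = "\<lambda>x. \<bar>a x * pa'' x\<bar>"
  have iR: "integrable (lebesgue_on {x0<..}) ?R" using apa''_L1 by simp
  let ?t = "integral\<^sup>L (lebesgue_on {x0<..}) ?R"
  have "\<forall>\<^sub>F d in at_top. dist (integral {x0..d} ?R) ?t < 1/8"
    using tendstoD[OF integral_Icc_tendsto[OF iR], of "1/8"] by simp
  then have "\<forall>\<^sub>F d in at_top. dist (integral {x0..d} ?R) ?t < 1/8 \<and> d > x0"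
    using eventually_gt_at_top by (rule eventually_conj)
  then obtain X where X: "\<And>d. d \<ge> X \<Longrightarrow> dist (integral {x0..d} ?R) ?t < 1/8 \<and> d > x0"
    unfolding eventually_at_top_linorder by auto
  have small: "integral {X..T} ?R \<le> 1/4" if T: "T \<ge> X" for T
  proof -
    have "integral {x0..X} ?R + integral {X..T} ?R = integral {x0..T} ?R"
      using X[of X] T r_abs_integrable_on by (intro Henstock_Kurzweil_Integration.integral_combine) auto
    then show ?thesis using X[of X] X[OF T] by (simp add: dist_real_def abs_if split: if_splits)
  qed
  let ?m = "\<lambda>x. \<bar>rotated u w 0 x\<bar> + \<bar>rotated u w (- pi / 2) x\<bar>"
  have y_le: "\<bar>scaled u x\<bar> \<le> ?m x" for x
  proof -
    have "\<bar>scaled u x\<bar> \<le> \<bar>rotated u w 0 x * cos (\<Xi> x)\<bar> + \<bar>rotated u w (- pi / 2) x * sin (\<Xi> x)\<bar>"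
      unfolding rotate_back(1)[of u x w] by (rule abs_triangle_ineq)
    also have "\<dots> \<le> ?m x" unfolding abs_mult
      by (intro add_mono mult_left_le) auto
    finally show ?thesis .
  qed
  show ?thesis
  proof (rule that)
    show "X > x0" using X[of X] by simp
    fix T assume T: "T \<ge> X"
    have "continuous_on {X..T} ?m"
      using X[of X] by (intro continuous_intros continuous_on_subset[OF rotated_cont[OF sol]]) auto
    then obtain t where t: "t \<in> {X..T}" and max: "\<And>x. x \<in> {X..T} \<Longrightarrow> ?m x \<le> ?m t"
      using continuous_attains_sup[of "{X..T}" ?m] T by auto
    have inc: "\<bar>rotated u w \<tau> t - rotated u w \<tau> X\<bar> \<le> ?m t * (1/4)" for \<tau>
    proof -
      have "\<bar>rotated u w \<tau> t - rotated u w \<tau> X\<bar> \<le> ?m t * integral {X..t} ?R"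
        using X[of X] t y_le max by (intro rotated_increment[OF sol]) (auto intro: order_trans)
      also have "\<dots> \<le> ?m t * (1/4)" using small[of t] t by (intro mult_left_mono) auto
      finally show ?thesis .
    qed
    have "?m t \<le> 2 * ?m X" using inc[of 0] inc[of "- pi / 2"] by (simp add: abs_if split: if_splits)
    then show "\<bar>scaled u T\<bar> \<le> 2 * ?m X" using y_le[of T] max[of T] T by auto
  qed
qed

lemma rotated_convergent:
  assumes sol: "solution u w"
  shows "\<exists>L. (rotated u w \<tau> \<longlongrightarrow> L) at_top"
proof -
  obtain X K where X: "X > x0" and K: "\<And>x. x \<ge> X \<Longrightarrow> \<bar>scaled u x\<bar> \<le> K" using scaled_bounded[OF sol] by metis
  let ?f = "\<lambda>x. sin (\<Xi> x + \<tau>) * (a x * pa'' x) * scaled u x"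
  have r: "integrable (lebesgue_on {X<..}) (\<lambda>x. a x * pa'' x)"
    by (rule integrable_lebesgue_on_subset[OF apa''_L1]) (use X in auto)
  have "integrable (lebesgue_on {X<..}) ?f"
  proof (rule Bochner_Integration.integrable_bound)
    show "integrable (lebesgue_on {X<..}) (\<lambda>x. K * (a x * pa'' x))" using r by simp
    have "(\<lambda>x. sin (\<Xi> x + \<tau>)) \<in> borel_measurable (lebesgue_on {X<..})" "scaled u \<in> borel_measurable (lebesgue_on {X<..})"
      using X by (auto intro!: continuous_imp_measurable_on_sets_lebesgue continuous_intros
         continuous_on_subset[OF \<Xi>_cont] continuous_on_subset[OF scaled_cont[OF sol]])
    then show "?f \<in> borel_measurable (lebesgue_on {X<..})"
      by (intro borel_measurable_times[OF borel_measurable_times[OF _ borel_measurable_integrable[OF r]]])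
    have "norm (?f x) \<le> norm (K * (a x * pa'' x))" if "x > X" for x
    proof -
      have "\<bar>sin (\<Xi> x + \<tau>)\<bar> * \<bar>a x * pa'' x\<bar> * \<bar>scaled u x\<bar> \<le> 1 * \<bar>a x * pa'' x\<bar> * \<bar>K\<bar>"
        using K[of x] that by (intro mult_mono) auto
      then show ?thesis by (simp add: abs_mult mult_ac)
    qed
    then show "AE x in lebesgue_on {X<..}. norm (?f x) \<le> norm (K * (a x * pa'' x))"
      by (intro AE_I2) (auto simp: space_restrict_space)
  qed
  then have "((\<lambda>d. rotated u w \<tau> X + integral {X..d} ?f) \<longlongrightarrow> rotated u w \<tau> X + integral\<^sup>L (lebesgue_on {X<..}) ?f) at_top"
    by (intro tendsto_intros integral_Icc_tendsto)
  moreover have "\<forall>\<^sub>F d in at_top. rotated u w \<tau> X + integral {X..d} ?f = rotated u w \<tau> d"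
    by (rule eventually_mono[OF eventually_ge_at_top[of X]])
       (simp add: integral_unique[OF rotated_has_integral[OF sol X]])
  ultimately show ?thesis by (blast dest: Lim_transform_eventually)
qed

lemma scaled_wronskian:
  assumes "x \<ge> x0"
  shows "scaled u1 x * scaled_deriv u2 w2 x - scaled u2 x * scaled_deriv u1 w1 x = u1 x * w2 x - u2 x * w1 x"
  using a_pos[OF assms] by (simp add: scaled_def scaled_deriv_def field_simps)

text \<open>The real oscillation with complex amplitude \<open>s\<close>; solutions are real, so their two coefficients
  are conjugate to each other.\<close>

definition wave :: "complex \<Rightarrow> real \<Rightarrow> complex" where
  "wave s x = s * exp (\<i> * of_real (\<Xi> x)) + cnj s * exp (- \<i> * of_real (\<Xi> x))"

text \<open>The Wronskian is invariant under rotation and survives in the limit as \<open>4 Im (s\<^sub>1 cnj s\<^sub>2)\<close>.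
  Thus independent solutions have independent amplitudes.\<close>

lemma solution_asymptotics:
  assumes sol: "solution u1 w1" "solution u2 w2"
    and W: "\<And>x. x > 0 \<Longrightarrow> u1 x * w2 x - u2 x * w1 x = W"
  obtains s1 s2 :: complex where
    "((\<lambda>x. of_real (u1 x / a x) - wave s1 x) \<longlongrightarrow> 0) at_top"
    "((\<lambda>x. of_real (u2 x / a x) - wave s2 x) \<longlongrightarrow> 0) at_top"
    "Im (s1 * cnj s2) = W / 4"
proof -
  have one: "((\<lambda>x. of_real (u x / a x) - wave s x) \<longlongrightarrow> 0) at_top"
    if C: "(rotated u w 0 \<longlongrightarrow> C) at_top" and S: "(rotated u w (- pi / 2) \<longlongrightarrow> S) at_top" and s: "s = Complex (C / 2) (- S / 2)" for u w C S s
  proof -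
    have b: "Bfun (\<lambda>x. cos (\<Xi> x)) at_top" "Bfun (\<lambda>x. sin (\<Xi> x)) at_top"
      by (rule BfunI[where K=1], simp)+
    have z: "((\<lambda>x. rotated u w 0 x - C) \<longlongrightarrow> 0) at_top" "((\<lambda>x. rotated u w (- pi / 2) x - S) \<longlongrightarrow> 0) at_top"
      using C S by (simp_all add: LIM_zero)
    have "((\<lambda>x. (rotated u w 0 x - C) * cos (\<Xi> x)) \<longlongrightarrow> 0) at_top" "((\<lambda>x. (rotated u w (- pi / 2) x - S) * sin (\<Xi> x)) \<longlongrightarrow> 0) at_top"
      using bounded_bilinear.Zfun_prod_Bfun[OF bounded_bilinear_mult] z b by (auto simp: tendsto_Zfun_iff)
    from tendsto_of_real[OF tendsto_add[OF this], where 'a = complex]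
    have "((\<lambda>x. complex_of_real ((rotated u w 0 x - C) * cos (\<Xi> x) + (rotated u w (- pi / 2) x - S) * sin (\<Xi> x))) \<longlongrightarrow> 0) at_top"
      by simp
    also have "(\<lambda>x. complex_of_real ((rotated u w 0 x - C) * cos (\<Xi> x) + (rotated u w (- pi / 2) x - S) * sin (\<Xi> x)))
       = (\<lambda>x. of_real (u x / a x) - wave s x)"
    proof
      fix x
      have "exp (\<i> * of_real (\<Xi> x)) = Complex (cos (\<Xi> x)) (sin (\<Xi> x))"
        and "exp (- \<i> * of_real (\<Xi> x)) = Complex (cos (\<Xi> x)) (- sin (\<Xi> x))"
        by (simp_all add: complex_eq_iff Re_exp Im_exp)
      moreover have "u x / a x = rotated u w 0 x * cos (\<Xi> x) + rotated u w (- pi / 2) x * sin (\<Xi> x)"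
        using rotate_back(1)[of u x w] by (simp add: scaled_def)
      ultimately show "complex_of_real ((rotated u w 0 x - C) * cos (\<Xi> x) + (rotated u w (- pi / 2) x - S) * sin (\<Xi> x))
       = of_real (u x / a x) - wave s x"
        by (simp add: wave_def complex_eq_iff s algebra_simps)
    qed
    finally show ?thesis .
  qed
  obtain C1 S1 C2 S2 where
    L1: "(rotated u1 w1 0 \<longlongrightarrow> C1) at_top" "(rotated u1 w1 (- pi / 2) \<longlongrightarrow> S1) at_top" and
    L2: "(rotated u2 w2 0 \<longlongrightarrow> C2) at_top" "(rotated u2 w2 (- pi / 2) \<longlongrightarrow> S2) at_top"
    using rotated_convergent[OF sol(1)] rotated_convergent[OF sol(2)] by metis
  have "((\<lambda>x. rotated u1 w1 0 x * rotated u2 w2 (- pi / 2) x - rotated u2 w2 0 x * rotated u1 w1 (- pi / 2) x) \<longlongrightarrow> C1 * S2 - C2 * S1) at_top"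
    by (intro tendsto_intros L1 L2)
  moreover have "\<forall>\<^sub>F x in at_top. rotated u1 w1 0 x * rotated u2 w2 (- pi / 2) x - rotated u2 w2 0 x * rotated u1 w1 (- pi / 2) x = W"
  proof (rule eventually_mono[OF eventually_ge_at_top[of x0]])
    fix x assume x: "x \<ge> x0"
    have "scaled u1 x * scaled_deriv u2 w2 x - scaled u2 x * scaled_deriv u1 w1 x = W"
      using scaled_wronskian[OF x] W[of x] x x0_pos by simp
    moreover have "(sin (\<Xi> x))\<^sup>2 + (cos (\<Xi> x))\<^sup>2 = 1" by simp
    ultimately show "rotated u1 w1 0 x * rotated u2 w2 (- pi / 2) x - rotated u2 w2 0 x * rotated u1 w1 (- pi / 2) x = W"
      unfolding rotate_back(1)[of u1 x w1] rotate_back(1)[of u2 x w2] rotate_back(2)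
      using rotation_wronskian by metis
  qed
  ultimately have "((\<lambda>x::real. W) \<longlongrightarrow> C1 * S2 - C2 * S1) at_top" by (rule Lim_transform_eventually)
  then have "C1 * S2 - C2 * S1 = W" by (simp add: tendsto_const_iff)
  then show ?thesis
    by (intro that[OF one[OF L1 refl] one[OF L2 refl]]) (simp add: field_simps)
qed

lemma solution_square_integrable:
  assumes sol: "solution u w" and c: "continuous_on {0..} u"
  shows "square_integrable (\<lambda>x. of_real (u x))"
proof -
  obtain X K where X: "X > x0" and K: "\<And>x. x \<ge> X \<Longrightarrow> \<bar>scaled u x\<bar> \<le> K" using scaled_bounded[OF sol] by metis
  have m: "u \<in> borel_measurable halfline"
    by (rule continuous_imp_measurable_on_sets_lebesgue[OF continuous_on_subset[OF c]]) auto
  have "(\<lambda>x. (u x)\<^sup>2) absolutely_integrable_on {0..X}"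
    by (intro absolutely_integrable_continuous_real continuous_intros continuous_on_subset[OF c]) auto
  moreover have "(\<lambda>x. (u x)\<^sup>2) absolutely_integrable_on {X<..}"
  proof -
    have "integrable (lebesgue_on {X<..}) (\<lambda>x. (u x)\<^sup>2)"
    proof (rule Bochner_Integration.integrable_bound)
      have "integrable (lebesgue_on {X<..}) (\<lambda>x. (a x)\<^sup>2)"
        by (rule integrable_lebesgue_on_subset[OF a_L2]) (use X in auto)
      then show "integrable (lebesgue_on {X<..}) (\<lambda>x. K\<^sup>2 * (a x)\<^sup>2)" by simp
      have "u \<in> borel_measurable (lebesgue_on {X<..})"
        by (rule continuous_imp_measurable_on_sets_lebesgue[OF continuous_on_subset[OF c]]) (use X x0_pos in auto)
      then show "(\<lambda>x. (u x)\<^sup>2) \<in> borel_measurable (lebesgue_on {X<..})" by simp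
      have "norm ((u x)\<^sup>2) \<le> norm (K\<^sup>2 * (a x)\<^sup>2)" if "x > X" for x
      proof -
        have "a x > 0" using a_pos[of x] that X by simp
        then have "u x = scaled u x * a x" by (simp add: scaled_def)
        moreover have "(scaled u x)\<^sup>2 \<le> K\<^sup>2" using K[of x] that by (intro abs_le_square_iff[THEN iffD1]) auto
        ultimately show ?thesis by (simp add: power_mult_distrib mult_right_mono)
      qed
      then show "AE x in lebesgue_on {X<..}. norm ((u x)\<^sup>2) \<le> norm (K\<^sup>2 * (a x)\<^sup>2)"
        by (intro AE_I2) (auto simp: space_restrict_space)
    qed
    then show ?thesis by (simp add: set_integrable_def integrable_restrict_space)
  qed
  ultimately have "(\<lambda>x. (u x)\<^sup>2) absolutely_integrable_on ({0..X} \<union> {X<..})"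
    by (rule set_integrable_Un) auto
  then have "integrable (lebesgue_on ({0..X} \<union> {X<..})) (\<lambda>x. (u x)\<^sup>2)"
    by (rule absolutely_integrable_imp_integrable) auto
  then have "integrable halfline (\<lambda>x. (u x)\<^sup>2)"
    by (rule integrable_lebesgue_on_subset) auto
  then show ?thesis using m by (simp add: square_integrable_def)
qed

lemma wronskian_const:
  assumes sol: "solution u1 w1" "solution u2 w2"
    and c: "continuous_on {0..} u1" "continuous_on {0..} u2" "continuous_on {0..} w1" "continuous_on {0..} w2"
    and x: "x \<ge> 0"
  shows "u1 x * w2 x - u2 x * w1 x = u1 0 * w2 0 - u2 0 * w1 0"
proof (cases "x = 0")
  case False
  have sub: "{0..x} \<subseteq> {0..}" by auto
  show ?thesis
  proof (rule DERIV_isconst2[where a = 0 and b = x and f = "\<lambda>x. u1 x * w2 x - u2 x * w1 x"])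
    show "continuous_on {0..x} (\<lambda>x. u1 x * w2 x - u2 x * w1 x)"
      by (intro continuous_intros continuous_on_subset[OF c(1) sub] continuous_on_subset[OF c(2) sub] 
        continuous_on_subset[OF c(3) sub] continuous_on_subset[OF c(4) sub])
    fix t assume "0 < t" "t < x"
    then show "((\<lambda>x. u1 x * w2 x - u2 x * w1 x) has_real_derivative 0) (at t)"
      using sol p_pos[of t] unfolding solution_def
      by (auto intro!: derivative_eq_intros simp: field_simps)
  qed (use x False in auto)
qed simp

lemma solution_exists:
  obtains u w where "solution u w" "continuous_on {0..} u" "continuous_on {0..} w" "u 0 = u0" "w 0 = w0"
proof -
  define P where "P x = (if x = 0 then p0 else p x)" for x
  define Q where "Q x = (if x = 0 then q0 else q x)" for x
  have P: "continuous_on {0..} P" and Q: "continuous_on {0..} Q"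
    unfolding P_def[abs_def] Q_def[abs_def] by (intro continuous_on_extend_at_0 p_cont q_cont p_lim q_lim)+
  have Pnz: "P x > 0" if "x \<ge> 0" for x using p0_pos p_pos[of x] that by (simp add: P_def)
  have "continuous_on {0..} (\<lambda>x. 1 / P x)" using Pnz by (intro continuous_intros P) (auto simp: less_imp_neq[symmetric])
  then obtain u w where uw: "u 0 = u0" "w 0 = w0" "continuous_on {0..} u" "continuous_on {0..} w"
    "\<And>x. x > 0 \<Longrightarrow> (u has_real_derivative 1 / P x * w x) (at x)"
    "\<And>x. x > 0 \<Longrightarrow> (w has_real_derivative - Q x * u x) (at x)"
    using linear_system_solution[of "\<lambda>x. 1 / P x" Q u0 w0] Q by metis
  have "solution u w" unfolding solution_def using uw(5,6) by (auto simp: P_def Q_def)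
  then show ?thesis using uw that by blast
qed

end

section \<open>Density of the domain of the minimal operator\<close>

lemma max_power_deriv:
  "((\<lambda>y::real. (max 0 y) ^ (n + 2)) has_real_derivative real (n + 2) * (max 0 y) ^ (n + 1)) (at y)"
proof (cases y "0::real" rule: linorder_cases)
  case less
  have "((\<lambda>y::real. 0) has_real_derivative 0) (at y)" by simp
  then have "((\<lambda>y::real. (max 0 y) ^ (n + 2)) has_real_derivative 0) (at y)"
    by (rule has_field_derivative_transform_within_open[of _ _ _ "{..<0}"]) (use less in auto)
  then show ?thesis using less by simp
next
  case greater
  have "((\<lambda>y::real. y ^ (n + 2)) has_real_derivative real (n + 2) * y ^ (n + 1)) (at y)"
    by (rule derivative_eq_intros refl)+ simp
  then have "((\<lambda>y::real. (max 0 y) ^ (n + 2)) has_real_derivative real (n + 2) * y ^ (n + 1)) (at y)"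
    by (rule has_field_derivative_transform_within_open[of _ _ _ "{0<..}"]) (use greater in auto)
  then show ?thesis using greater by simp
next
  case equal
  have "((\<lambda>h::real. (max 0 h) ^ (n + 2) / h) \<longlongrightarrow> 0) (at 0)"
  proof (rule Lim_null_comparison)
    have *: "norm ((max 0 h) ^ (n + 2) / h) \<le> \<bar>h\<bar> ^ (n + 1)" for h :: real
    proof (cases "h > 0")
      case False
      then have "norm ((max 0 h) ^ (n + 2) / h) = 0" by simp
      then show ?thesis by (metis abs_ge_zero zero_le_power)
    qed (auto simp: field_simps)
    show "\<forall>\<^sub>F h::real in at 0. norm ((max 0 h) ^ (n + 2) / h) \<le> \<bar>h\<bar> ^ (n + 1)"
      using * by (intro always_eventually) blast
    have "((\<lambda>h::real. \<bar>h\<bar> ^ (n + 1)) \<longlongrightarrow> \<bar>0\<bar> ^ (n + 1)) (at 0)" by (intro tendsto_intros)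
    then show "((\<lambda>h::real. \<bar>h\<bar> ^ (n + 1)) \<longlongrightarrow> 0) (at 0)" by simp
  qed
  then show ?thesis using equal by (simp add: DERIV_def)
qed

text \<open>The derivatives are part of the predicate so that the supports of \<open>u'\<close> and \<open>u''\<close> are at hand.\<close>

definition C2_supported ::
    "real \<Rightarrow> real \<Rightarrow> (real \<Rightarrow> complex) \<Rightarrow> (real \<Rightarrow> complex) \<Rightarrow> (real \<Rightarrow> complex) \<Rightarrow> bool" where
  "C2_supported s t u u' u'' \<longleftrightarrow>
     (\<forall>x. (u has_vector_derivative u' x) (at x)) \<and> (\<forall>x. (u' has_vector_derivative u'' x) (at x)) \<and>
     continuous_on UNIV u'' \<and> (\<forall>x. x \<notin> {s..t} \<longrightarrow> u x = 0 \<and> u' x = 0 \<and> u'' x = 0)"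

text \<open>With the cutoff \<open>\<psi> = max 0 ((x - s) (t - x)) ^ 3\<close>, which is positive on an interval larger than the
  support of \<open>h\<close>, approximate the continuous function \<open>h / \<psi>\<close> by a polynomial \<open>P\<close> and take \<open>u = \<psi> P\<close>.
  The interval \<open>[s, t]\<close> does not depend on the accuracy \<open>e\<close>.\<close>

lemma C2_approximation:
  assumes h: "Cc h"
  obtains s t where "0 < s" "s < t" "\<And>x. x \<notin> {s..t} \<Longrightarrow> h x = 0"
    "\<And>e. e > 0 \<Longrightarrow> \<exists>u u' u''. C2_supported s t u u' u'' \<and> (\<forall>x. cmod (u x - h x) \<le> e)"
proof -
  obtain s0 t0 where st0: "0 < s0" "s0 < t0" and h0: "\<And>x. x \<notin> {s0..t0} \<Longrightarrow> h x = 0" and hc: "continuous_on UNIV h"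
    using h by (auto simp: Cc_def)
  define s t where "s = s0 / 2" and "t = t0 + 1"
  have st: "0 < s" "s < s0" "t0 < t" "s < t" using st0 by (auto simp: s_def t_def)
  define m where "m x = (x - s) * (t - x)" for x
  define M where "M x = max 0 (m x)" for x
  define \<psi> where "\<psi> x = M x ^ 3" for x
  define \<psi>1 where "\<psi>1 x = 3 * M x ^ 2 * (s + t - 2 * x)" for x
  define \<psi>2 where "\<psi>2 x = 6 * M x * (s + t - 2 * x)\<^sup>2 - 6 * M x ^ 2" for x
  have dm: "(m has_real_derivative s + t - 2 * x) (at x)" for x
    unfolding m_def by (auto intro!: derivative_eq_intros simp: algebra_simps)
  have dM: "((\<lambda>x. M x ^ (n + 2)) has_real_derivative real (n + 2) * M x ^ (n + 1) * (s + t - 2 * x)) (at x)" for n x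
    unfolding M_def using DERIV_chain2[OF max_power_deriv dm, of n x] by (simp add: mult_ac)
  have dM2: "((\<lambda>x. M x ^ 2) has_real_derivative 2 * M x * (s + t - 2 * x)) (at x)" for x
    using dM[of 0 x] by (simp add: numeral_2_eq_2)
  have d1: "(\<psi> has_real_derivative \<psi>1 x) (at x)" for x
    using dM[of 1 x] unfolding \<psi>_def \<psi>1_def by (simp add: numeral_3_eq_3 numeral_2_eq_2)
  have d2: "(\<psi>1 has_real_derivative \<psi>2 x) (at x)" for x
    unfolding \<psi>1_def[abs_def] \<psi>2_def
    by (rule dM2 derivative_eq_intros refl)+ (simp add: algebra_simps power2_eq_square)
  have mc: "continuous_on UNIV M" unfolding M_def m_def by (intro continuous_intros)
  have \<psi>c: "continuous_on UNIV \<psi>" "continuous_on UNIV \<psi>1" "continuous_on UNIV \<psi>2"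
    unfolding \<psi>_def \<psi>1_def \<psi>2_def by (intro continuous_intros mc)+
  have M0: "M x = 0" if "x \<notin> {s..t}" for x
  proof -
    have "(x - s) * (t - x) \<le> 0" using that st by (auto simp: mult_le_0_iff not_le)
    then show ?thesis by (simp add: M_def m_def)
  qed
  then have \<psi>0: "\<psi> x = 0" "\<psi>1 x = 0" "\<psi>2 x = 0" if "x \<notin> {s..t}" for x
    using that by (auto simp: \<psi>_def \<psi>1_def \<psi>2_def)
  have \<psi>pos: "\<psi> x > 0" if "x \<in> {s<..<t}" for x
    using that by (auto simp: \<psi>_def M_def m_def max_def not_le)
  define k where "k x = h x / of_real (\<psi> x)" for x
  have kc: "continuous_on {s..t} k"
  proof -
    have "continuous_on ({s<..<t} \<union> - {s0..t0}) k"
    proof (rule continuous_on_open_Un)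
      have "of_real (\<psi> x) \<noteq> (0::complex)" if "x \<in> {s<..<t}" for x using \<psi>pos[OF that] by simp
      then show "continuous_on {s<..<t} k" unfolding k_def
        by (intro continuous_intros continuous_on_subset[OF hc] continuous_on_subset[OF \<psi>c(1)]) auto
      have "continuous_on (- {s0..t0}) (\<lambda>x. 0::complex)" by simp
      then show "continuous_on (- {s0..t0}) k"
        by (rule continuous_on_eq) (use h0 in \<open>auto simp: k_def\<close>)
    qed auto
    then show ?thesis by (rule continuous_on_subset) (use st in auto)
  qed
  have "bounded (\<psi> ` {s..t})"
    by (intro compact_imp_bounded compact_continuous_image continuous_on_subset[OF \<psi>c(1)]) auto
  then obtain B where B: "B > 0" "\<And>x. x \<in> {s..t} \<Longrightarrow> \<bar>\<psi> x\<bar> \<le> B" by (auto simp: bounded_pos)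
  show ?thesis
  proof (rule that[of s t])
    show "h x = 0" if "x \<notin> {s..t}" for x using h0[of x] that st by auto
    fix e :: real assume e: "e > 0"
    obtain P where P: "polynomial_function P" "\<And>x. x \<in> {s..t} \<Longrightarrow> norm (k x - P x) < e / B"
      using Stone_Weierstrass_polynomial_function[of "{s..t}" k "e / B"] kc e B by auto
    obtain P1 where P1: "polynomial_function P1" "\<And>x. (P has_vector_derivative P1 x) (at x)"
      using has_vector_derivative_polynomial_function[OF P(1)] by blast
    obtain P2 where P2: "polynomial_function P2" "\<And>x. (P1 has_vector_derivative P2 x) (at x)"
      using has_vector_derivative_polynomial_function[OF P1(1)] by blast
    have Pc: "continuous_on UNIV P" "continuous_on UNIV P1" "continuous_on UNIV P2"
      using P P1 P2 by (auto intro: continuous_on_polymonial_function)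
    define u where "u x = \<psi> x *\<^sub>R P x" for x
    define u' where "u' x = \<psi> x *\<^sub>R P1 x + \<psi>1 x *\<^sub>R P x" for x
    define u'' where "u'' x = (\<psi> x *\<^sub>R P2 x + \<psi>1 x *\<^sub>R P1 x) + (\<psi>1 x *\<^sub>R P1 x + \<psi>2 x *\<^sub>R P x)" for x
    have "(u has_vector_derivative u' x) (at x)" for x
      unfolding u_def[abs_def] u'_def by (rule has_vector_derivative_scaleR[OF d1 P1(2)])
    moreover have "(u' has_vector_derivative u'' x) (at x)" for x
      unfolding u'_def[abs_def] u''_def
      by (intro has_vector_derivative_add has_vector_derivative_scaleR d1 d2 P1(2) P2(2))
    moreover have "continuous_on UNIV u''" unfolding u''_def by (intro continuous_intros \<psi>c Pc)
    moreover have "u x = 0 \<and> u' x = 0 \<and> u'' x = 0" if "x \<notin> {s..t}" for x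
      using \<psi>0[OF that] by (simp add: u_def u'_def u''_def)
    moreover have "cmod (u x - h x) \<le> e" for x
    proof (cases "x \<in> {s..t}")
      case True
      have "h x = \<psi> x *\<^sub>R k x"
      proof (cases "x \<in> {s<..<t}")
        case True then show ?thesis using \<psi>pos[OF True] by (simp add: k_def scaleR_conv_of_real)
      next
        case False
        then have "h x = 0" using h0[of x] st by auto
        then show ?thesis by (simp add: k_def)
      qed
      then have "u x - h x = \<psi> x *\<^sub>R (P x - k x)" by (simp add: u_def scaleR_diff_right)
      then have "cmod (u x - h x) = \<bar>\<psi> x\<bar> * norm (k x - P x)" by (simp add: norm_minus_commute)
      also have "\<dots> \<le> B * (e / B)" using B(2)[OF True] P(2)[OF True] by (intro mult_mono) auto
      finally show ?thesis using B by simp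
    next
      case False
      then show ?thesis using \<psi>0[OF False] h0[of x] st e by (auto simp: u_def)
    qed
    ultimately show "\<exists>u u' u''. C2_supported s t u u' u'' \<and> (\<forall>x. cmod (u x - h x) \<le> e)"
      unfolding C2_supported_def by blast
  qed (use st in auto)
qed

context SL_problem begin

lemma SL_expr_eq:
  assumes u: "\<And>x. x > 0 \<Longrightarrow> (u has_vector_derivative u' x) (at x)"
    and w: "\<And>x. x > 0 \<Longrightarrow> ((\<lambda>x. of_real (p x) * u' x) has_vector_derivative w' x) (at x)" and x: "x > 0"
  shows "SL_expr p q u x = - w' x - of_real (q x) * u x"
proof -
  have vd: "vderiv u y = u' y" if "y > 0" for y by (rule vector_derivative_at[OF u[OF that]])
  have "((\<lambda>y. of_real (p y) * vderiv u y) has_vector_derivative w' x) (at x)"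
    by (rule has_vector_derivative_transform_within_open[OF w[OF x], of "{0<..}"])
       (use x vd in auto)
  then show ?thesis unfolding SL_expr_def by (simp add: vector_derivative_at)
qed

lemma vderiv_C1:
  assumes u: "\<And>x. x > 0 \<Longrightarrow> (u has_vector_derivative u' x) (at x)"
    and u': "\<And>x. x > 0 \<Longrightarrow> (u' has_vector_derivative u'' x) (at x)" and c: "continuous_on {0<..} u''"
  shows "u C1_differentiable_on {0<..}" "vderiv u C1_differentiable_on {0<..}"
proof -
  have "continuous_on {0<..} u'"
    using u' by (intro continuous_at_imp_continuous_on) (auto intro: has_vector_derivative_continuous)
  then show "u C1_differentiable_on {0<..}" unfolding C1_differentiable_on_def using u by auto
  have vd: "vderiv u y = u' y" if "y > 0" for y by (rule vector_derivative_at[OF u[OF that]])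
  have "(vderiv u has_vector_derivative u'' x) (at x)" if "x > 0" for x
    by (rule has_vector_derivative_transform_within_open[OF u'[OF that], of "{0<..}"])
       (use that vd in auto)
  then show "vderiv u C1_differentiable_on {0<..}" unfolding C1_differentiable_on_def using c by auto
qed

lemma C2_compact_in_H00:
  assumes C2: "C2_supported s t u u' u''" and st: "0 < s" "s < t"
  shows "(L2_of u, L2_of (SL_expr p q u)) \<in> H00 p q \<alpha>" "Cc u"
proof -
  have u: "\<And>x. (u has_vector_derivative u' x) (at x)" and u': "\<And>x. (u' has_vector_derivative u'' x) (at x)"
    and c: "continuous_on UNIV u''" and supp: "\<And>x. x \<notin> {s..t} \<Longrightarrow> u x = 0 \<and> u' x = 0 \<and> u'' x = 0"
    using C2 unfolding C2_supported_def by auto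
  have uc: "continuous_on UNIV u" "continuous_on UNIV u'"
    by (auto intro!: continuous_at_imp_continuous_on has_vector_derivative_continuous u u')
  show Cu: "Cc u" unfolding Cc_def using uc st supp by blast
  define g where "g x = - (of_real (p x) * u'' x + of_real (p' x) * u' x) - of_real (q x) * u x" for x
  have eq: "SL_expr p q u x = g x" if "x > 0" for x
    unfolding g_def
    by (rule SL_expr_eq[OF u _ that]) (intro has_vector_derivative_of_real_mult p_deriv u')
  have gc: "continuous_on {0<..} g" unfolding g_def
    by (intro continuous_intros p_cont p'_cont q_cont continuous_on_subset[OF c] continuous_on_subset[OF uc(1)] continuous_on_subset[OF uc(2)]) auto
  have g0: "g x = 0" if "x \<notin> {s..t}" for x using supp[OF that] by (simp add: g_def)
  have "bounded (g ` {s..t})"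
    by (intro compact_imp_bounded compact_continuous_image continuous_on_subset[OF gc]) (use st in auto)
  then obtain B where B: "B > 0" "\<And>x. x \<in> {s..t} \<Longrightarrow> cmod (g x) \<le> B" by (auto simp: bounded_pos)
  have "square_integrable g"
  proof (rule square_integrable_bounded_support[OF _ _ g0])
    show "g \<in> borel_measurable halfline" by (rule continuous_imp_measurable_on_sets_lebesgue[OF gc]) auto
    show "cmod (g x) \<le> B" for x using B g0[of x] by (cases "x \<in> {s..t}") auto
  qed
  then have sq: "square_integrable (SL_expr p q u)" using square_integrable_cong[of "SL_expr p q u" g] eq by blast
  have C1: "u C1_differentiable_on {0<..}" "vderiv u C1_differentiable_on {0<..}"
    using u u' c by (auto intro!: vderiv_C1[of u u' u''] intro: continuous_on_subset)
  have ev: "\<forall>\<^sub>F x in at_right 0. x \<in> {0<..<s}" using st eventually_at_right_real by blast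
  have l1: "(u \<longlongrightarrow> 0) (at_right 0)"
    by (rule tendsto_eventually, rule eventually_mono[OF ev]) (use supp in auto)
  have l2: "(vderiv u \<longlongrightarrow> 0) (at_right 0)"
    by (rule tendsto_eventually, rule eventually_mono[OF ev]) (use supp vector_derivative_at[OF u] in auto)
  have "boundary_cond \<alpha> 0 0" by (simp add: boundary_cond_def split: option.split)
  then show "(L2_of u, L2_of (SL_expr p q u)) \<in> H00 p q \<alpha>"
    unfolding H00_def using C1 Cc_square_integrable[OF Cu] sq l1 l2 supp
    by (intro CollectI exI[of _ u] conjI refl exI[of _ "t + 1"] exI[of _ 0]) auto
qed

lemma H00_domain_dense: "closure (Domain (H00 p q \<alpha>)) = UNIV"
proof -
  let ?D = "closure (Domain (H00 p q \<alpha>))"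
  have "L2_of h \<in> ?D" if h: "Cc h" for h
  proof -
    obtain s t where st: "0 < s" "s < t" and h0: "\<And>x. x \<notin> {s..t} \<Longrightarrow> h x = 0" and
    ap: "\<And>e. e > 0 \<Longrightarrow> \<exists>u u' u''. C2_supported s t u u' u'' \<and> (\<forall>x. cmod (u x - h x) \<le> e)"
      by (rule C2_approximation[OF h]) blast
    have "\<forall>n. \<exists>u. L2_of u \<in> Domain (H00 p q \<alpha>) \<and> Cc u \<and> (\<forall>x. x \<notin> {s..t} \<longrightarrow> u x = 0) \<and> (\<forall>x. cmod (u x - h x) \<le> 1 / (real n + 1))"
    proof
      fix n :: nat
      have e: "1 / (real n + 1) > 0" by simp
      obtain u u' u'' where u: "C2_supported s t u u' u''" "\<And>x. cmod (u x - h x) \<le> 1 / (real n + 1)"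
        using ap[OF e] by blast
      show "\<exists>u. L2_of u \<in> Domain (H00 p q \<alpha>) \<and> Cc u \<and> (\<forall>x. x \<notin> {s..t} \<longrightarrow> u x = 0) \<and> (\<forall>x. cmod (u x - h x) \<le> 1 / (real n + 1))"
        using C2_compact_in_H00[OF u(1) st] u unfolding C2_supported_def by blast
    qed
    then obtain U where U: "\<And>n. L2_of (U n) \<in> Domain (H00 p q \<alpha>)" "\<And>n. Cc (U n)"
      "\<And>n x. x \<notin> {s..t} \<Longrightarrow> U n x = 0" "\<And>n x. cmod (U n x - h x) \<le> 1 / (real n + 1)"
      by metis
    have "bounded (h ` {s..t})" using h
      by (intro compact_imp_bounded compact_continuous_image) (auto simp: Cc_def intro: continuous_on_subset)
    then obtain B where B: "B > 0" "\<And>x. x \<in> {s..t} \<Longrightarrow> cmod (h x) \<le> B" by (auto simp: bounded_pos)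
    have "(\<lambda>n. L2_of (U n)) \<longlonglongrightarrow> L2_of h"
    proof (rule L2_dominated_convergence[OF Cc_square_integrable[OF h]])
      show "U n \<in> borel_measurable halfline" for n
        using Cc_square_integrable[OF U(2)] by (simp add: square_integrable_def)
      define w where "w x = (if x \<in> {s..t} then complex_of_real (B + 1) else 0)" for x
      show "square_integrable w"
      proof (rule square_integrable_bounded_support[of _ "B + 1" s t])
        show "w \<in> borel_measurable halfline"
          unfolding w_def by (intro measurable_restrict_space1 measurable_If) (auto intro!: borel_closed)
      qed (use B in \<open>auto simp: w_def\<close>)
      show "cmod (U n x) \<le> cmod (w x)" for n x
      proof (cases "x \<in> {s..t}")
        case True
        have "cmod (U n x) \<le> cmod (h x) + cmod (U n x - h x)" using norm_triangle_ineq[of "h x" "U n x - h x"] by simp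
        also have "\<dots> \<le> B + 1" using B(2)[OF True] U(4)[of n x] by (intro add_mono) (auto intro: order_trans)
        finally show ?thesis using True B by (simp add: w_def)
      qed (simp add: U(3))
      have "(\<lambda>n. U n x) \<longlonglongrightarrow> h x" for x
      proof -
        have "(\<lambda>n. 1 / (real n + 1)) \<longlonglongrightarrow> 0" using LIMSEQ_inverse_real_of_nat by (simp add: inverse_eq_divide add.commute)
        then have "(\<lambda>n. U n x - h x) \<longlonglongrightarrow> 0"
          by (rule Lim_null_comparison[rotated]) (use U(4) in auto)
        then show ?thesis by (simp add: LIM_zero_iff)
      qed
      then show "AE x in halfline. (\<lambda>n. U n x) \<longlonglongrightarrow> h x" by simp
    qed
    then show ?thesis using U(1) unfolding closure_sequential by (intro exI[of _ "\<lambda>n. L2_of (U n)"]) auto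
  qed
  then have "closure (L2_of ` {f. Cc f}) \<subseteq> ?D" by (intro closure_minimal) auto
  then show ?thesis using Cc_dense by auto
qed

end

section \<open>Green operator and maximal operator\<close>

text \<open>A fundamental system with Wronskian \<open>-1\<close>, the sign that makes the operator \<open>green_op\<close> below an
  inverse of \<open>\<tau>\<close> and not of \<open>- \<tau>\<close>.  The solution \<open>\<phi>\<close> satisfies the boundary condition at \<open>0\<close>, stated
  for \<open>w = p u'\<close>.\<close>

locale SL_fundamental = SL_problem +
  fixes \<alpha> :: "real option" and \<phi> w\<phi> \<theta> w\<theta> :: "real \<Rightarrow> real"
  assumes sol_\<phi>: "solution \<phi> w\<phi>" and sol_\<theta>: "solution \<theta> w\<theta>"
    and cont_\<phi>: "continuous_on {0..} \<phi>" "continuous_on {0..} w\<phi>"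
    and cont_\<theta>: "continuous_on {0..} \<theta>" "continuous_on {0..} w\<theta>"
    and W0: "\<phi> 0 * w\<theta> 0 - \<theta> 0 * w\<phi> 0 = -1"
    and bc_\<phi>: "case \<alpha> of None \<Rightarrow> \<phi> 0 = 0 | Some r \<Rightarrow> w\<phi> 0 = p0 * r * \<phi> 0"
begin

lemma W: "x \<ge> 0 \<Longrightarrow> \<phi> x * w\<theta> x - \<theta> x * w\<phi> x = -1"
  using wronskian_const[OF sol_\<phi> sol_\<theta> cont_\<phi>(1) cont_\<theta>(1) cont_\<phi>(2) cont_\<theta>(2)] W0 by simp

definition \<phi>c :: "real \<Rightarrow> complex" where "\<phi>c x = of_real (\<phi> x)"
definition \<theta>c :: "real \<Rightarrow> complex" where "\<theta>c x = of_real (\<theta> x)"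

lemma sq_\<phi>: "square_integrable \<phi>c" and sq_\<theta>: "square_integrable \<theta>c"
  unfolding \<phi>c_def[abs_def] \<theta>c_def[abs_def]
  using solution_square_integrable[OF sol_\<phi> cont_\<phi>(1)] solution_square_integrable[OF sol_\<theta> cont_\<theta>(1)] by auto

lemma cont_c: "continuous_on {0..} \<phi>c" "continuous_on {0..} \<theta>c"
  unfolding \<phi>c_def[abs_def] \<theta>c_def[abs_def] by (intro continuous_intros cont_\<phi> cont_\<theta>)+

definition \<Phi> :: L2 where "\<Phi> = L2_of \<phi>c"

lemma integrable_solution_mult:
  assumes "square_integrable f"
  shows "integrable halfline (\<lambda>x. \<phi>c x * f x)" "integrable halfline (\<lambda>x. \<theta>c x * f x)"
  using square_integrable_prod[OF assms sq_\<phi>] square_integrable_prod[OF assms sq_\<theta>]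
  by (simp_all add: \<phi>c_def \<theta>c_def mult.commute)

lemma cinner_\<Phi>: "square_integrable f \<Longrightarrow> cinner (L2_of f) \<Phi> = integral\<^sup>L halfline (\<lambda>x. \<phi>c x * f x)"
  unfolding \<Phi>_def by (subst cinner_L2_of[OF _ sq_\<phi>]) (simp_all add: \<phi>c_def mult.commute)

text \<open>Variation of constants.  The second integral is the one from \<open>x\<close> to infinity.\<close>

definition green_op :: "(real \<Rightarrow> complex) \<Rightarrow> real \<Rightarrow> complex" where
  "green_op f x = \<theta>c x * integral {0..x} (\<lambda>t. \<phi>c t * f t) +
     \<phi>c x * (integral\<^sup>L halfline (\<lambda>t. \<theta>c t * f t) - integral {0..x} (\<lambda>t. \<theta>c t * f t))"

lemma green_op_cont: "square_integrable f \<Longrightarrow> continuous_on {0..} (green_op f)"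
  unfolding green_op_def by (intro continuous_intros cont_c continuous_on_integral_Icc integrable_solution_mult)

lemma green_op_square_integrable: assumes f: "square_integrable f" shows "square_integrable (green_op f)"
proof -
  define A where "A = integral\<^sup>L halfline (\<lambda>x. cmod (\<phi>c x * f x))"
  define B where "B = 2 * integral\<^sup>L halfline (\<lambda>x. cmod (\<theta>c x * f x))"
  note i = integrable_solution_mult[OF f]
  have AB: "A \<ge> 0" "B \<ge> 0" by (simp_all add: A_def B_def)
  define w where "w x = complex_of_real (A * \<bar>\<theta> x\<bar> + B * \<bar>\<phi> x\<bar>)" for x
  have abs: "square_integrable (\<lambda>x. of_real (c * \<bar>g x\<bar>))" if "square_integrable (\<lambda>x. complex_of_real (g x))" for g :: "real \<Rightarrow> real" and c
  proof -
    have m: "(\<lambda>x. complex_of_real (g x)) \<in> borel_measurable halfline" and i: "integrable halfline (\<lambda>x. (cmod (complex_of_real (g x)))\<^sup>2)"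
      using that by (auto simp: square_integrable_def)
    have "square_integrable (\<lambda>x. complex_of_real (cmod (complex_of_real (g x))))"
      unfolding square_integrable_def
    proof
      show "(\<lambda>x. complex_of_real (cmod (complex_of_real (g x)))) \<in> borel_measurable halfline"
        using m by measurable
    qed (use i in simp)
    from square_integrable_cmult[OF this, of "of_real c"] show ?thesis by simp
  qed
  have w: "square_integrable w"
    using square_integrable_add[OF abs abs, of \<theta> \<phi> A B] sq_\<phi> sq_\<theta>
    unfolding w_def[abs_def] \<phi>c_def[abs_def] \<theta>c_def[abs_def] by simp
  have le: "cmod (green_op f x) \<le> cmod (w x)" for x
  proof -
    have 1: "cmod (integral {0..x} (\<lambda>t. \<phi>c t * f t)) \<le> A" unfolding A_def by (rule norm_integral_Icc_le[OF i(1)])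
    have "cmod (integral\<^sup>L halfline (\<lambda>t. \<theta>c t * f t) - integral {0..x} (\<lambda>t. \<theta>c t * f t))
       \<le> cmod (integral\<^sup>L halfline (\<lambda>t. \<theta>c t * f t)) + cmod (integral {0..x} (\<lambda>t. \<theta>c t * f t))"
      by (rule norm_triangle_ineq4)
    also have "\<dots> \<le> B" unfolding B_def
      using integral_norm_bound[of halfline "\<lambda>t. \<theta>c t * f t"] norm_integral_Icc_le[OF i(2), of x] by linarith
    finally have 2: "cmod (integral\<^sup>L halfline (\<lambda>t. \<theta>c t * f t) - integral {0..x} (\<lambda>t. \<theta>c t * f t)) \<le> B" .
    have "cmod (green_op f x) \<le> \<bar>\<theta> x\<bar> * A + \<bar>\<phi> x\<bar> * B"
      unfolding green_op_def using 1 2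
      by (intro order_trans[OF norm_triangle_ineq add_mono]) (auto simp: norm_mult \<phi>c_def \<theta>c_def intro!: mult_left_mono)
    then show ?thesis using AB unfolding w_def norm_of_real by (simp add: mult_ac abs_of_nonneg)
  qed
  have m: "green_op f \<in> borel_measurable halfline"
    by (rule continuous_imp_measurable_on_sets_lebesgue[OF continuous_on_subset[OF green_op_cont[OF f]]]) auto
  show ?thesis unfolding square_integrable_def
  proof
    show "integrable halfline (\<lambda>x. (cmod (green_op f x))\<^sup>2)"
      by (rule Bochner_Integration.integrable_bound[of _ "\<lambda>x. (cmod (w x))\<^sup>2"])
         (use w m le in \<open>auto simp: square_integrable_def intro!: AE_I2 power_mono\<close>)
  qed (rule m)
qed

definition green_kernel :: "real \<Rightarrow> real \<Rightarrow> complex" where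
  "green_kernel x y = (if y \<le> x then \<theta>c x * \<phi>c y else \<phi>c x * \<theta>c y)"

lemma green_kernel_sym: "green_kernel x y = green_kernel y x" by (simp add: green_kernel_def)
lemma green_kernel_cnj: "cnj (green_kernel x y) = green_kernel x y" by (simp add: green_kernel_def \<phi>c_def \<theta>c_def)

lemma green_op_kernel:
  assumes f: "square_integrable f" and x: "x > 0"
  shows "integrable halfline (\<lambda>y. green_kernel x y * f y)" "green_op f x = integral\<^sup>L halfline (\<lambda>y. green_kernel x y * f y)"
proof -
  note i = integrable_solution_mult[OF f]
  let ?I = "\<lambda>y. indicat_real {0<..x} y"
  have ii: "integrable halfline (\<lambda>y. ?I y *\<^sub>R (\<phi>c y * f y))" "integrable halfline (\<lambda>y. ?I y *\<^sub>R (\<theta>c y * f y))"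
    using i by (auto intro!: integrable_mult_indicator simp: sets_restrict_space_iff)
  have eq: "green_kernel x y * f y = \<theta>c x * (?I y *\<^sub>R (\<phi>c y * f y)) + \<phi>c x * (\<theta>c y * f y - ?I y *\<^sub>R (\<theta>c y * f y))"
    if "y \<in> space halfline" for y
    using that by (auto simp: green_kernel_def indicator_def space_restrict_space)
  have int: "integrable halfline (\<lambda>y. \<theta>c x * (?I y *\<^sub>R (\<phi>c y * f y)) + \<phi>c x * (\<theta>c y * f y - ?I y *\<^sub>R (\<theta>c y * f y)))"
    using i ii by (intro Bochner_Integration.integrable_add integrable_mult_right Bochner_Integration.integrable_diff) auto
  show "integrable halfline (\<lambda>y. green_kernel x y * f y)"
    using int by (subst Bochner_Integration.integrable_cong[OF refl eq]) auto
  have linear: "integral\<^sup>L halfline (\<lambda>y. c * h y + d * (k y - l y)) =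
      c * integral\<^sup>L halfline h + d * (integral\<^sup>L halfline k - integral\<^sup>L halfline l)"
    if "integrable halfline h" "integrable halfline k" "integrable halfline l" for c d :: complex and h k l
    using that by simp
  have "integral\<^sup>L halfline (\<lambda>y. green_kernel x y * f y)
     = integral\<^sup>L halfline (\<lambda>y. \<theta>c x * (?I y *\<^sub>R (\<phi>c y * f y)) + \<phi>c x * (\<theta>c y * f y - ?I y *\<^sub>R (\<theta>c y * f y)))"
    by (rule Bochner_Integration.integral_cong[OF refl eq])
  also have "\<dots> = \<theta>c x * integral\<^sup>L halfline (\<lambda>y. ?I y *\<^sub>R (\<phi>c y * f y)) +
     \<phi>c x * (integral\<^sup>L halfline (\<lambda>y. \<theta>c y * f y) - integral\<^sup>L halfline (\<lambda>y. ?I y *\<^sub>R (\<theta>c y * f y)))"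
    using linear[OF ii(1) i(2) ii(2)] .
  also have "\<dots> = green_op f x" unfolding green_op_def integral_Icc_eq_indicator[OF i(1)] integral_Icc_eq_indicator[OF i(2)] ..
  finally show "green_op f x = integral\<^sup>L halfline (\<lambda>y. green_kernel x y * f y)" ..
qed

text \<open>The kernel is real and symmetric; Fubini applies because it is dominated by
  \<open>|\<theta>(x) \<phi>(y)| + |\<phi>(x) \<theta>(y)|\<close> with square integrable factors.\<close>

lemma green_op_symmetric:
  assumes f: "square_integrable f" and g: "square_integrable g"
  shows "cinner (L2_of (green_op f)) (L2_of g) = cinner (L2_of f) (L2_of (green_op g))"
proof -
  interpret sigma_finite_measure halfline by (rule sigma_finite_halfline)
  interpret P: pair_sigma_finite halfline halfline ..
  have [measurable]: "f \<in> borel_measurable halfline" "g \<in> borel_measurable halfline"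
    "\<phi>c \<in> borel_measurable halfline" "\<theta>c \<in> borel_measurable halfline"
    using f g sq_\<phi> sq_\<theta> by (auto simp: square_integrable_def)
  have id [measurable]: "(\<lambda>x::real. x) \<in> borel_measurable halfline"
    by (rule continuous_imp_measurable_on_sets_lebesgue) auto
  let ?H = "\<lambda>x y. green_kernel x y * f y * cnj (g x)"
  have meas: "case_prod ?H \<in> borel_measurable (halfline \<Otimes>\<^sub>M halfline)"
    unfolding green_kernel_def case_prod_unfold by measurable
  have prod: "integrable (halfline \<Otimes>\<^sub>M halfline) (\<lambda>(x, y). h x * k y)"
    if h: "integrable halfline h" and k: "integrable halfline k" for h k :: "real \<Rightarrow> real"
  proof (rule P.Fubini_integrable)
    have [measurable]: "h \<in> borel_measurable halfline" "k \<in> borel_measurable halfline" using h k by auto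
    show "(\<lambda>(x, y). h x * k y) \<in> borel_measurable (halfline \<Otimes>\<^sub>M halfline)" unfolding case_prod_unfold by measurable
    show "integrable halfline (\<lambda>x. \<integral>y. norm (case (x, y) of (x, y) \<Rightarrow> h x * k y) \<partial>halfline)"
      using h by (simp add: abs_mult)
    show "AE x in halfline. integrable halfline (\<lambda>y. case (x, y) of (x, y) \<Rightarrow> h x * k y)"
      using k by simp
  qed
  have n: "integrable halfline (\<lambda>x. cmod (\<phi>c x * u x))" "integrable halfline (\<lambda>x. cmod (\<theta>c x * u x))" if "square_integrable u" for u
    using integrable_solution_mult[OF that] by auto
  have int: "integrable (halfline \<Otimes>\<^sub>M halfline) (case_prod ?H)"
  proof (rule Bochner_Integration.integrable_bound[OF _ meas])
    show "integrable (halfline \<Otimes>\<^sub>M halfline) (\<lambda>z. (\<lambda>(x, y). cmod (\<theta>c x * g x) * cmod (\<phi>c y * f y)) z + (\<lambda>(x, y). cmod (\<phi>c x * g x) * cmod (\<theta>c y * f y)) z)"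
      by (intro Bochner_Integration.integrable_add prod n f g)
    show "AE z in halfline \<Otimes>\<^sub>M halfline. norm (case_prod ?H z) \<le>
      norm ((\<lambda>(x, y). cmod (\<theta>c x * g x) * cmod (\<phi>c y * f y)) z + (\<lambda>(x, y). cmod (\<phi>c x * g x) * cmod (\<theta>c y * f y)) z)"
      by (intro AE_I2) (auto simp: green_kernel_def norm_mult mult_ac)
  qed
  have sp: "x > 0" if "x \<in> space halfline" for x using that by (simp add: space_restrict_space)
  have "cinner (L2_of (green_op f)) (L2_of g) = (\<integral>x. green_op f x * cnj (g x) \<partial>halfline)"
    by (rule cinner_L2_of[OF green_op_square_integrable[OF f] g])
  also have "\<dots> = (\<integral>x. (\<integral>y. ?H x y \<partial>halfline) \<partial>halfline)"
    by (rule Bochner_Integration.integral_cong[OF refl]) (simp add: green_op_kernel[OF f sp])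
  also have "\<dots> = (\<integral>y. (\<integral>x. ?H x y \<partial>halfline) \<partial>halfline)" by (rule P.Fubini_integral[OF int, symmetric])
  also have "\<dots> = (\<integral>y. f y * cnj (green_op g y) \<partial>halfline)"
  proof (rule Bochner_Integration.integral_cong[OF refl])
    fix y assume y: "y \<in> space halfline"
    have "(\<integral>x. ?H x y \<partial>halfline) = (\<integral>x. f y * cnj (green_kernel y x * g x) \<partial>halfline)"
      by (rule Bochner_Integration.integral_cong[OF refl]) (simp add: green_kernel_cnj green_kernel_sym[of y] mult_ac)
    also have "\<dots> = f y * (\<integral>x. cnj (green_kernel y x * g x) \<partial>halfline)" by simp
    also have "(\<integral>x. cnj (green_kernel y x * g x) \<partial>halfline) = cnj (green_op g y)"
      unfolding green_op_kernel(2)[OF g sp[OF y]] by (rule Bochner_Integration.integral_cnj)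
    finally show "(\<integral>x. ?H x y \<partial>halfline) = f y * cnj (green_op g y)" .
  qed
  also have "\<dots> = cinner (L2_of f) (L2_of (green_op g))"
    by (rule cinner_L2_of[OF f green_op_square_integrable[OF g], symmetric])
  finally show ?thesis .
qed

text \<open>The derivative of \<open>w u - v p u'\<close> is \<open>v \<tau> u\<close>.\<close>

lemma lagrange_identity:
  assumes sol: "solution v w" and cv: "continuous_on {0..} v" "continuous_on {0..} w"
    and C1: "u C1_differentiable_on {0<..}" "vderiv u C1_differentiable_on {0<..}"
    and l: "(u \<longlongrightarrow> u0) (at_right 0)" "(vderiv u \<longlongrightarrow> u1) (at_right 0)" and x: "x > 0"
  shows "((\<lambda>x. of_real (v x) * SL_expr p q u x) has_integral
     (of_real (w x) * u x - of_real (v x) * (of_real (p x) * vderiv u x))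
     - (of_real (w 0) * u0 - of_real (v 0) * (of_real p0 * u1))) {0..x}"
proof -
  define u' u'' where "u' = vderiv u" and "u'' = vderiv u'"
  have d: "(u has_vector_derivative u' x) (at x)" "(u' has_vector_derivative u'' x) (at x)" if "x > 0" for x
    using C1 that unfolding C1_differentiable_on_eq u'_def u''_def by (auto simp: vector_derivative_works)
  have dpu: "((\<lambda>x. of_real (p x) * u' x) has_vector_derivative of_real (p x) * u'' x + of_real (p' x) * u' x) (at x)" if "x > 0" for x
    by (rule has_vector_derivative_of_real_mult[OF p_deriv[OF that] d(2)[OF that]])
  have SL: "SL_expr p q u x = - (of_real (p x) * u'' x + of_real (p' x) * u' x) - of_real (q x) * u x" if "x > 0" for x
    by (rule SL_expr_eq[OF d(1) dpu that])
  have cont: "continuous_on {0<..} u" "continuous_on {0<..} u'"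
    using d by (auto intro!: continuous_at_imp_continuous_on intro: has_vector_derivative_continuous)
  define M where "M x = of_real (w x) * u x - of_real (v x) * (of_real (p x) * u' x)" for x
  \<comment> \<open>The value at \<open>0\<close> is the limit there, where \<open>u\<close> itself is not constrained.\<close>
  define M0 where "M0 = of_real (w 0) * u0 - of_real (v 0) * (of_real p0 * u1)"
  have Mc: "continuous_on {0..} (\<lambda>x. if x = 0 then M0 else M x)"
  proof (rule continuous_on_extend_at_0)
    show "continuous_on {0<..} M" unfolding M_def
      by (intro continuous_intros cont p_cont continuous_on_subset[OF cv(1)] continuous_on_subset[OF cv(2)]) auto
    show "(M \<longlongrightarrow> M0) (at_right 0)" unfolding M_def M0_def
      by (intro tendsto_intros continuous_on_imp_tendsto_at_right cv l[folded u'_def] p_lim)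
  qed
  have "((\<lambda>x. of_real (v x) * SL_expr p q u x) has_integral (if x = 0 then M0 else M x) - (if (0::real) = 0 then M0 else M 0)) {0..x}"
  proof (rule fundamental_theorem_of_calculus_interior)
    show "continuous_on {0..x} (\<lambda>x. if x = 0 then M0 else M x)" by (rule continuous_on_subset[OF Mc]) auto
    fix t assume "t \<in> {0<..<x}"
    then have t: "t > 0" by simp
    have dv: "(v has_real_derivative w t / p t) (at t)" "(w has_real_derivative - q t * v t) (at t)"
      using sol t by (auto simp: solution_def)
    have "(M has_vector_derivative (of_real (w t) * u' t + of_real (- q t * v t) * u t)
        - (of_real (v t) * (of_real (p t) * u'' t + of_real (p' t) * u' t) + of_real (w t / p t) * (of_real (p t) * u' t))) (at t)"
      unfolding M_def[abs_def]
      by (intro has_vector_derivative_diff has_vector_derivative_of_real_mult dv d p_deriv t)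
    also have "(of_real (w t) * u' t + of_real (- q t * v t) * u t)
        - (of_real (v t) * (of_real (p t) * u'' t + of_real (p' t) * u' t) + of_real (w t / p t) * (of_real (p t) * u' t))
       = of_real (v t) * SL_expr p q u t"
      using p_pos[OF t] by (simp add: SL[OF t] algebra_simps)
    finally show "((\<lambda>x. if x = 0 then M0 else M x) has_vector_derivative of_real (v t) * SL_expr p q u t) (at t)"
      by (rule has_vector_derivative_transform_within_open[of _ _ _ "{0<..}"]) (use t in auto)
  qed (use x in auto)
  then show ?thesis using x by (simp add: M_def M0_def u'_def)
qed

text \<open>In Lagrange's identity the boundary term at infinity vanishes for \<open>u\<close> of bounded support, and
  the one at \<open>0\<close> vanishes for \<open>\<phi>\<close> since \<open>u\<close> and \<open>\<phi>\<close> satisfy the same boundary condition.\<close>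

lemma H00_inverse:
  assumes C1: "u C1_differentiable_on {0<..}" "vderiv u C1_differentiable_on {0<..}"
    and l: "(u \<longlongrightarrow> u0) (at_right 0)" "(vderiv u \<longlongrightarrow> u1) (at_right 0)" and bc: "boundary_cond \<alpha> u0 u1"
    and R: "\<And>x. x > 0 \<Longrightarrow> x \<ge> R \<Longrightarrow> u x = 0" and sq: "square_integrable (SL_expr p q u)"
  shows "integral\<^sup>L halfline (\<lambda>x. \<phi>c x * SL_expr p q u x) = 0"
    and "\<And>x. x > 0 \<Longrightarrow> green_op (SL_expr p q u) x = u x"
proof -
  let ?f = "SL_expr p q u"
  note int = integrable_solution_mult[OF sq]
  have vd0: "vderiv u x = 0" if "x > max R 0" for x
  proof -
    have "((\<lambda>x. 0) has_vector_derivative (0::complex)) (at x)" by simp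
    then have "(u has_vector_derivative 0) (at x)"
      by (rule has_vector_derivative_transform_within_open[of _ _ _ "{max R 0<..}"]) (use that R in auto)
    then show ?thesis by (rule vector_derivative_at)
  qed
  have hi: "integral {0..x} (\<lambda>x. of_real (v x) * ?f x) =
     (of_real (w x) * u x - of_real (v x) * (of_real (p x) * vderiv u x))
     - (of_real (w 0) * u0 - of_real (v 0) * (of_real p0 * u1))"
    if "solution v w" "continuous_on {0..} v" "continuous_on {0..} w" "x > 0" for v w x
    by (rule integral_unique[OF lagrange_identity[OF that(1,2,3) C1 l that(4)]])
  have tot: "integral\<^sup>L halfline (\<lambda>x. of_real (v x) * ?f x) = - (of_real (w 0) * u0 - of_real (v 0) * (of_real p0 * u1))"
    if s: "solution v w" "continuous_on {0..} v" "continuous_on {0..} w" and i: "integrable halfline (\<lambda>x. of_real (v x) * ?f x)" for v w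
  proof -
    have "\<forall>\<^sub>F x in at_top. integral {0..x} (\<lambda>x. of_real (v x) * ?f x) = - (of_real (w 0) * u0 - of_real (v 0) * (of_real p0 * u1))"
      by (rule eventually_mono[OF eventually_gt_at_top[of "max R 0"]]) (simp add: hi[OF s] R vd0)
    then have "((\<lambda>x. integral {0..x} (\<lambda>x. of_real (v x) * ?f x)) \<longlongrightarrow> - (of_real (w 0) * u0 - of_real (v 0) * (of_real p0 * u1))) at_top"
      by (rule tendsto_eventually)
    with integral_Icc_tendsto[OF i] show ?thesis by (rule tendsto_unique[OF trivial_limit_at_top_linorder])
  qed
  have b0: "of_real (w\<phi> 0) * u0 - of_real (\<phi> 0) * (of_real p0 * u1) = 0"
    using bc bc_\<phi> by (auto simp: boundary_cond_def split: option.splits)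
  have tot\<phi>: "integral\<^sup>L halfline (\<lambda>x. \<phi>c x * ?f x) = 0"
    using tot[OF sol_\<phi> cont_\<phi>] int b0 by (simp add: \<phi>c_def)
  then show "integral\<^sup>L halfline (\<lambda>x. \<phi>c x * ?f x) = 0" .
  fix x :: real assume x: "x > 0"
  have W': "of_real (\<phi> x * w\<theta> x - \<theta> x * w\<phi> x) = (-1::complex)" using W[of x] x by simp
  have I\<phi>: "integral {0..x} (\<lambda>t. \<phi>c t * ?f t) = of_real (w\<phi> x) * u x - \<phi>c x * (of_real (p x) * vderiv u x)"
    using hi[OF sol_\<phi> cont_\<phi> x] b0 by (simp add: \<phi>c_def)
  have I\<theta>: "integral\<^sup>L halfline (\<lambda>t. \<theta>c t * ?f t) - integral {0..x} (\<lambda>t. \<theta>c t * ?f t)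
     = - (of_real (w\<theta> x) * u x - \<theta>c x * (of_real (p x) * vderiv u x))"
    using hi[OF sol_\<theta> cont_\<theta> x] tot[OF sol_\<theta> cont_\<theta>] int by (simp add: \<theta>c_def)
  have "green_op ?f x = - (of_real (\<phi> x * w\<theta> x - \<theta> x * w\<phi> x)) * u x"
    unfolding green_op_def I\<phi> I\<theta> by (simp add: \<phi>c_def \<theta>c_def algebra_simps)
  also have "\<dots> = u x" unfolding W' by simp
  finally show "green_op ?f x = u x" .
qed

text \<open>Near \<open>0\<close> the function \<open>G f\<close> is a multiple of \<open>\<phi>\<close>, which yields the boundary condition.  To the
  right of the support of \<open>f\<close> it equals \<open>\<langle>f, \<phi>\<rangle> \<theta>\<close>, hence vanishes exactly by orthogonality.\<close>

lemma green_op_of_Cc_in_H00: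
  assumes f: "Cc f" and orth: "integral\<^sup>L halfline (\<lambda>x. \<phi>c x * f x) = 0"
  shows "(L2_of (green_op f), L2_of f) \<in> H00 p q \<alpha>"
proof -
  note sf = Cc_square_integrable[OF f]
  note int = integrable_solution_mult[OF sf]
  obtain s t where st: "0 < s" "s < t" "\<And>x. x \<notin> {s..t} \<Longrightarrow> f x = 0" and fc: "continuous_on UNIV f"
    using f by (auto simp: Cc_def)
  define T where "T = integral\<^sup>L halfline (\<lambda>t. \<theta>c t * f t)"
  define I where "I x = integral {0..x} (\<lambda>t. \<phi>c t * f t)" for x
  define J where "J x = T - integral {0..x} (\<lambda>t. \<theta>c t * f t)" for x
  have G: "green_op f x = of_real (\<theta> x) * I x + of_real (\<phi> x) * J x" for x
    by (simp add: green_op_def I_def J_def T_def \<phi>c_def \<theta>c_def)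
  have dint: "((\<lambda>x. integral {0..x} (\<lambda>t. h t * f t)) has_vector_derivative h x * f x) (at x)"
    if h: "continuous_on {0..} h" and x: "x > 0" for h :: "real \<Rightarrow> complex" and x
  proof -
    have "((\<lambda>x. integral {0..x} (\<lambda>t. h t * f t)) has_vector_derivative h x * f x) (at x within {0..x+1})"
      using x by (intro integral_has_vector_derivative continuous_intros continuous_on_subset[OF h] continuous_on_subset[OF fc]) auto
    then show ?thesis
      using x by (subst (asm) at_within_interior) (auto simp: interior_atLeastAtMost_real)
  qed
  have dI: "(I has_vector_derivative \<phi>c x * f x) (at x)" and dJ: "(J has_vector_derivative - (\<theta>c x * f x)) (at x)" if "x > 0" for x
    unfolding I_def[abs_def] J_def[abs_def] 
    using dint[OF cont_c(1) that] has_vector_derivative_diff[OF has_vector_derivative_const dint[OF cont_c(2) that], of T] by auto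
  have d\<phi>: "(\<phi> has_real_derivative w\<phi> x / p x) (at x)" "(w\<phi> has_real_derivative - q x * \<phi> x) (at x)"
    and d\<theta>: "(\<theta> has_real_derivative w\<theta> x / p x) (at x)" "(w\<theta> has_real_derivative - q x * \<theta> x) (at x)" if "x > 0" for x
    using sol_\<phi> sol_\<theta> that by (auto simp: solution_def)
  define V where "V x = of_real (w\<theta> x) * I x + of_real (w\<phi> x) * J x" for x
  define u' where "u' x = of_real (1 / p x) * V x" for x
  have dG: "(green_op f has_vector_derivative u' x) (at x)" if x: "x > 0" for x
  proof -
    have "(green_op f has_vector_derivative (of_real (\<theta> x) * (\<phi>c x * f x) + of_real (w\<theta> x / p x) * I x)
        + (of_real (\<phi> x) * (- (\<theta>c x * f x)) + of_real (w\<phi> x / p x) * J x)) (at x)"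
      unfolding G[abs_def]
      by (intro has_vector_derivative_add has_vector_derivative_of_real_mult d\<phi> d\<theta> dI dJ x)
    then show ?thesis using p_pos[OF x] by (simp add: u'_def V_def \<phi>c_def \<theta>c_def field_simps)
  qed
  have dV: "(V has_vector_derivative - of_real (q x) * green_op f x - f x) (at x)" if x: "x > 0" for x
  proof -
    have W': "of_real (\<phi> x * w\<theta> x - \<theta> x * w\<phi> x) = (-1::complex)" using W[of x] x by simp
    have "(V has_vector_derivative (of_real (w\<theta> x) * (\<phi>c x * f x) + of_real (- q x * \<theta> x) * I x)
        + (of_real (w\<phi> x) * (- (\<theta>c x * f x)) + of_real (- q x * \<phi> x) * J x)) (at x)"
      unfolding V_def[abs_def]
      by (intro has_vector_derivative_add has_vector_derivative_of_real_mult d\<phi> d\<theta> dI dJ x)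
    also have "(of_real (w\<theta> x) * (\<phi>c x * f x) + of_real (- q x * \<theta> x) * I x)
        + (of_real (w\<phi> x) * (- (\<theta>c x * f x)) + of_real (- q x * \<phi> x) * J x)
       = - of_real (q x) * green_op f x + of_real (\<phi> x * w\<theta> x - \<theta> x * w\<phi> x) * f x"
      by (simp add: G \<phi>c_def \<theta>c_def algebra_simps)
    finally show ?thesis unfolding W' by simp
  qed
  define u'' where "u'' x = of_real (1 / p x) * (- of_real (q x) * green_op f x - f x) + of_real (- p' x / (p x)\<^sup>2) * V x" for x
  have du': "(u' has_vector_derivative u'' x) (at x)" if x: "x > 0" for x
  proof -
    have "((\<lambda>x. 1 / p x) has_real_derivative - p' x / (p x)\<^sup>2) (at x)"
      using p_deriv[OF x] p_pos[OF x] by (auto intro!: derivative_eq_intros simp: power2_eq_square)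
    then show ?thesis unfolding u'_def[abs_def] u''_def by (intro has_vector_derivative_of_real_mult dV x)
  qed
  have Vc: "continuous_on {0<..} V" using dV
    by (auto intro!: continuous_at_imp_continuous_on intro: has_vector_derivative_continuous)
  have nz: "\<forall>x\<in>{0<..}. p x \<noteq> 0" "\<forall>x\<in>{0<..}. (p x)\<^sup>2 \<noteq> 0" using p_pos by force+
  have u''c: "continuous_on {0<..} u''" unfolding u''_def
    by (intro continuous_intros p_cont p'_cont q_cont Vc nz continuous_on_subset[OF green_op_cont[OF sf]] continuous_on_subset[OF fc]) auto
  have C1: "green_op f C1_differentiable_on {0<..}" "vderiv (green_op f) C1_differentiable_on {0<..}"
    by (rule vderiv_C1[OF dG du' u''c]; assumption)+
  have SL: "SL_expr p q (green_op f) x = f x" if x: "x > 0" for x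
  proof -
    have d: "((\<lambda>x. of_real (p x) * u' x) has_vector_derivative - of_real (q x) * green_op f x - f x) (at x)" if x: "x > 0" for x
      by (rule has_vector_derivative_transform_within_open[OF dV[OF x], of "{0<..}"])
         (use x nz in \<open>auto simp: u'_def\<close>)
    show ?thesis by (subst SL_expr_eq[OF dG d x]) auto
  qed
  have zero: "green_op f x = 0" if "x > 0" "x \<ge> t" for x
  proof -
    have "I x = 0" unfolding I_def using integral_halfline_eq_Icc[OF int(1), of x] orth st that by simp
    moreover have "J x = 0" unfolding J_def T_def using integral_halfline_eq_Icc[OF int(2), of x] st that by simp
    ultimately show ?thesis by (simp add: G)
  qed
  have IJ0: "I x = 0 \<and> J x = T" if "0 < x" "x < s" for x
  proof -
    have "integral {0..x} (\<lambda>t. h t * f t) = 0" for h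
      by (rule integral_unique, rule has_integral_is_0) (use that st in auto)
    then show ?thesis by (simp add: I_def J_def)
  qed
  have ev: "\<forall>\<^sub>F x in at_right 0. x \<in> {0<..<s}" using st eventually_at_right_real by blast
  have l0: "(green_op f \<longlongrightarrow> of_real (\<phi> 0) * T) (at_right 0)"
  proof (rule Lim_transform_eventually)
    show "((\<lambda>x. of_real (\<phi> x) * T) \<longlongrightarrow> of_real (\<phi> 0) * T) (at_right 0)"
      by (intro tendsto_intros continuous_on_imp_tendsto_at_right cont_\<phi>)
    show "\<forall>\<^sub>F x in at_right 0. of_real (\<phi> x) * T = green_op f x"
      by (rule eventually_mono[OF ev]) (use IJ0 in \<open>simp add: G\<close>)
  qed
  have l1: "(vderiv (green_op f) \<longlongrightarrow> of_real (1 / p0 * w\<phi> 0) * T) (at_right 0)"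
  proof (rule Lim_transform_eventually)
    show "((\<lambda>x. of_real (1 / p x * w\<phi> x) * T) \<longlongrightarrow> of_real (1 / p0 * w\<phi> 0) * T) (at_right 0)"
      using p0_pos by (intro tendsto_intros continuous_on_imp_tendsto_at_right cont_\<phi> p_lim) auto
    show "\<forall>\<^sub>F x in at_right 0. of_real (1 / p x * w\<phi> x) * T = vderiv (green_op f) x"
      by (rule eventually_mono[OF ev]) (use IJ0 vector_derivative_at[OF dG] in \<open>simp add: u'_def V_def\<close>)
  qed
  have bc: "boundary_cond \<alpha> (of_real (\<phi> 0) * T) (of_real (1 / p0 * w\<phi> 0) * T)"
    using bc_\<phi> p0_pos by (auto simp: boundary_cond_def split: option.splits)
  have sq: "square_integrable (SL_expr p q (green_op f))" using square_integrable_cong[of "SL_expr p q (green_op f)" f] SL sf by blast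
  have "L2_of f = L2_of (SL_expr p q (green_op f))" by (rule L2_of_cong[OF _ sf]) (simp add: SL)
  then show ?thesis unfolding H00_def
    using C1 green_op_square_integrable[OF sf] sq l0 l1 bc zero
    by (intro CollectI exI[of _ "green_op f"] conjI exI[of _ t] exI[of _ "of_real (\<phi> 0) * T"] exI[of _ "of_real (1 / p0 * w\<phi> 0) * T"]) auto
qed

lemma H00_elim:
  assumes "(U, F) \<in> H00 p q \<alpha>"
  obtains f where "square_integrable f" "F = L2_of f" "U = L2_of (green_op f)" "cinner F \<Phi> = 0"
proof -
  obtain u u0 u1 R where u: "U = L2_of u" "F = L2_of (SL_expr p q u)"
    "u C1_differentiable_on {0<..}" "vderiv u C1_differentiable_on {0<..}"
    "square_integrable u" "square_integrable (SL_expr p q u)" and R: "\<forall>x>0. x \<ge> R \<longrightarrow> u x = 0"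
    and l: "(u \<longlongrightarrow> u0) (at_right 0)" "(vderiv u \<longlongrightarrow> u1) (at_right 0)" "boundary_cond \<alpha> u0 u1"
    using assms unfolding H00_def by auto
  note inv = H00_inverse[OF u(3,4) l(1,2,3) _ u(6), of R]
  show ?thesis
  proof (rule that[of "SL_expr p q u"])
    show "U = L2_of (green_op (SL_expr p q u))" unfolding u(1)
      by (rule L2_of_cong[OF _ u(5)]) (use inv(2) R in auto)
    show "cinner F \<Phi> = 0" unfolding u(2) using cinner_\<Phi>[OF u(6)] inv(1) R by simp
  qed (use u in auto)
qed

lemma \<Phi>_nonzero: "\<Phi> \<noteq> 0"
proof
  assume "\<Phi> = 0"
  then have "L2_of \<phi>c = L2_of (\<lambda>x. 0)" by (simp add: \<Phi>_def zero_L2_def)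
  then have "AE x in halfline. \<phi>c x = 0" using L2_of_eq_iff[OF sq_\<phi> square_integrable_zero] by simp
  moreover have "continuous_on {0<..} \<phi>c" by (rule continuous_on_subset[OF cont_c(1)]) auto
  ultimately have "\<phi>c x = 0" if "x > 0" for x
    using AE_halfline_continuous_eq[of \<phi>c "\<lambda>x. 0" x] that by auto
  then have z: "\<phi> x = 0" if "x > 0" for x
    using that by (simp add: \<phi>c_def)
  have "(\<phi> has_real_derivative 0) (at 1)"
    by (rule has_field_derivative_transform_within_open[of "\<lambda>x. 0" _ _ "{0<..}"]) (use z in auto)
  moreover have "(\<phi> has_real_derivative w\<phi> 1 / p 1) (at 1)" using sol_\<phi> by (simp add: solution_def)
  ultimately have "w\<phi> 1 = 0" using DERIV_unique p_pos[of 1] by fastforce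
  then show False using W[of 1] z[of 1] by simp
qed

text \<open>By \<open>H_max_eq\<close> below, these classes exhaust the domain of the maximal operator.\<close>

definition max_element :: "(real \<Rightarrow> complex) \<Rightarrow> complex \<Rightarrow> L2" where
  "max_element g c = L2_of (\<lambda>x. green_op g x + c * \<phi>c x)"

lemma max_element_square_integrable: "square_integrable g \<Longrightarrow> square_integrable (\<lambda>x. green_op g x + c * \<phi>c x)"
  by (intro square_integrable_add square_integrable_cmult green_op_square_integrable sq_\<phi>)

lemma max_element_eq: "square_integrable g \<Longrightarrow> max_element g c = L2_of (green_op g) + cscale c \<Phi>"
  unfolding max_element_def \<Phi>_def
  by (simp add: L2_of_add cscale_L2_of square_integrable_cmult green_op_square_integrable sq_\<phi>)

text \<open>Every \<open>f\<close> of compact support can be corrected by a multiple of a fixed \<open>f\<^sub>0\<close> to become orthogonal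
  to \<open>\<Phi>\<close>.  Hence \<open>\<langle>f, w\<rangle>\<close> is a fixed multiple of \<open>\<langle>f, \<Phi>\<rangle>\<close> for all \<open>f\<close> in a dense set.\<close>

lemma orthogonal_H00_range:
  assumes w: "\<And>f. Cc f \<Longrightarrow> cinner (L2_of f) \<Phi> = 0 \<Longrightarrow> cinner (L2_of f) w = 0"
  obtains c where "w = cscale c \<Phi>"
proof -
  have "\<exists>f0. Cc f0 \<and> cinner (L2_of f0) \<Phi> \<noteq> 0"
    using orthogonal_dense_eq_0[OF Cc_dense, of \<Phi>] \<Phi>_nonzero by auto
  then obtain f0 where f0: "Cc f0" "cinner (L2_of f0) \<Phi> \<noteq> 0" by blast
  define k where "k = cinner (L2_of f0) w / cinner (L2_of f0) \<Phi>"
  have "cinner (L2_of f) (w - cscale (cnj k) \<Phi>) = 0" if f: "Cc f" for f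
  proof -
    define c where "c = cinner (L2_of f) \<Phi> / cinner (L2_of f0) \<Phi>"
    have cc: "Cc (\<lambda>x. f x + (- c) * f0 x)" by (intro Cc_add f Cc_mult f0) simp
    have eq: "L2_of (\<lambda>x. f x + (- c) * f0 x) = L2_of f + cscale (- c) (L2_of f0)"
      using L2_of_add[OF Cc_square_integrable[OF f] square_integrable_cmult[OF Cc_square_integrable[OF f0(1)], of "- c"]]
        cscale_L2_of[OF Cc_square_integrable[OF f0(1)], of "- c"] by simp
    have "cinner (L2_of f + cscale (- c) (L2_of f0)) \<Phi> = 0"
      using f0 by (simp add: cinner_add_left cinner_cscale_left c_def)
    then have "cinner (L2_of f + cscale (- c) (L2_of f0)) w = 0" using w[OF cc] eq by simp
    then show ?thesis
      using f0 by (simp add: cinner_diff_right cinner_cscale_right cinner_add_left cinner_cscale_left c_def k_def field_simps)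
  qed
  then have "w - cscale (cnj k) \<Phi> = 0"
    by (intro orthogonal_dense_eq_0[OF Cc_dense]) auto
  then show ?thesis using that by simp
qed

text \<open>Since \<open>U = G F\<close> on \<open>H\<^sub>0\<^sub>0\<close>, the adjoint relation \<open>\<langle>F, v\<rangle> = \<langle>U, g\<rangle>\<close> reads \<open>\<langle>F, v - G g\<rangle> = 0\<close> by
  symmetry of \<open>G\<close>, and the functions \<open>F\<close> in question span a dense part of the complement of \<open>\<phi>\<close>.\<close>

theorem H_max_eq: "H_max p q \<alpha> = {(max_element g c, L2_of g) | g c. square_integrable g}"
proof
  have Hm: "H_max p q \<alpha> = adjoint_op (H00 p q \<alpha>)" unfolding H_max_def H_min_def by (rule adjoint_closure)
  show "{(max_element g c, L2_of g) | g c. square_integrable g} \<subseteq> H_max p q \<alpha>"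
  proof clarify
    fix g c assume g: "square_integrable g"
    show "(max_element g c, L2_of g) \<in> H_max p q \<alpha>"
      unfolding Hm adjoint_op_def
    proof (clarify)
      fix U F assume "(U, F) \<in> H00 p q \<alpha>"
      then obtain f where f: "square_integrable f" "F = L2_of f" "U = L2_of (green_op f)" "cinner F \<Phi> = 0" by (rule H00_elim)
      show "cinner F (max_element g c) = cinner U (L2_of g)"
        using f green_op_symmetric[OF f(1) g] by (simp add: max_element_eq[OF g] cinner_add_right cinner_cscale_right)
    qed
  qed
  show "H_max p q \<alpha> \<subseteq> {(max_element g c, L2_of g) | g c. square_integrable g}"
  proof clarify
    fix v G assume vG: "(v, G) \<in> H_max p q \<alpha>"
    obtain g where g: "square_integrable g" "L2_of g = G" by (rule L2_of_surj)
    obtain c where "v - L2_of (green_op g) = cscale c \<Phi>"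
    proof (rule orthogonal_H00_range[of "v - L2_of (green_op g)"])
      fix f assume f: "Cc f" "cinner (L2_of f) \<Phi> = 0"
      note sf = Cc_square_integrable[OF f(1)]
      have "(L2_of (green_op f), L2_of f) \<in> H00 p q \<alpha>"
        by (rule green_op_of_Cc_in_H00[OF f(1)]) (use f(2) cinner_\<Phi>[OF sf] in simp)
      then have "cinner (L2_of f) v = cinner (L2_of (green_op f)) G" using vG unfolding Hm adjoint_op_def by auto
      also have "\<dots> = cinner (L2_of f) (L2_of (green_op g))" using green_op_symmetric[OF sf g(1)] g(2) by simp
      finally show "cinner (L2_of f) (v - L2_of (green_op g)) = 0" by (simp add: cinner_diff_right)
    qed
    then have "v = max_element g c" unfolding max_element_eq[OF g(1)] by (simp add: algebra_simps)
    then show "\<exists>g' c. (v, G) = (max_element g' c, L2_of g') \<and> square_integrable g'" using g by blast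
  qed
qed

end

section \<open>Self-adjoint restrictions from boundary values\<close>

text \<open>The abstract situation: an adjoint \<open>Hmax\<close> of a densely defined operator with two boundary
  functionals that are jointly onto and turn the boundary form into an indefinite Hermitian form of
  signature \<open>(1, 1)\<close>, up to the factor \<open>\<kappa>\<close>.\<close>

locale boundary_pair =
  fixes H0 Hmax :: "(L2 \<times> L2) set" and s\<^sub>p s\<^sub>m :: "L2 \<Rightarrow> complex" and \<kappa> :: complex
  assumes Hmax: "Hmax = adjoint_op H0"
    and dense: "closure (Domain H0) = UNIV"
    and H0: "(u, f) \<in> H0 \<Longrightarrow> (u, f) \<in> Hmax \<and> s\<^sub>p u = 0 \<and> s\<^sub>m u = 0"
    and add: "\<lbrakk>(u, f) \<in> Hmax; (v, g) \<in> Hmax\<rbrakk> \<Longrightarrow> s\<^sub>p (u + v) = s\<^sub>p u + s\<^sub>p v \<and> s\<^sub>m (u + v) = s\<^sub>m u + s\<^sub>m v"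
    and scale: "(u, f) \<in> Hmax \<Longrightarrow> s\<^sub>p (cscale c u) = c * s\<^sub>p u \<and> s\<^sub>m (cscale c u) = c * s\<^sub>m u"
    and surj: "\<exists>(u, f)\<in>Hmax. s\<^sub>p u = x \<and> s\<^sub>m u = y"
    and \<kappa>: "\<kappa> \<noteq> 0"
    and green: "\<lbrakk>(u, f) \<in> Hmax; (v, g) \<in> Hmax\<rbrakk> \<Longrightarrow>
      cinner f v - cinner u g = \<kappa> * (s\<^sub>p u * cnj (s\<^sub>p v) - s\<^sub>m u * cnj (s\<^sub>m v))"
begin

definition H_bc :: "complex \<Rightarrow> (L2 \<times> L2) set" where
  "H_bc \<omega> = {(u, f) \<in> Hmax. s\<^sub>p u = \<omega> * s\<^sub>m u}"

lemma Hmax_add: "\<lbrakk>(u, f) \<in> Hmax; (v, g) \<in> Hmax\<rbrakk> \<Longrightarrow> (u + v, f + g) \<in> Hmax"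
  unfolding Hmax adjoint_op_def by (fastforce simp: cinner_add_right)

lemma Hmax_scale: "(u, f) \<in> Hmax \<Longrightarrow> (cscale c u, cscale c f) \<in> Hmax"
  unfolding Hmax adjoint_op_def by (auto simp: cinner_cscale_right)

lemma Hmax_single_valued: assumes "(u, f) \<in> Hmax" "(u, g) \<in> Hmax" shows "f = g"
proof -
  have "cinner x (f - g) = 0" if "x \<in> Domain H0" for x
    using that assms unfolding Hmax adjoint_op_def by (fastforce simp: cinner_diff_right)
  then have "f - g = 0" by (rule orthogonal_dense_eq_0[OF dense])
  then show ?thesis by simp
qed

lemma unit_mult_cnj: "cmod \<omega> = 1 \<Longrightarrow> \<omega> * cnj \<omega> = 1"
  using complex_norm_square[of \<omega>] by simp

lemma adjoint_H_bc: assumes \<omega>: "cmod \<omega> = 1" shows "adjoint_op (H_bc \<omega>) = H_bc \<omega>"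
proof
  note \<omega>1 = unit_mult_cnj[OF \<omega>]
  show "H_bc \<omega> \<subseteq> adjoint_op (H_bc \<omega>)"
  proof (clarsimp simp: adjoint_op_def)
    fix v g u f assume "(v, g) \<in> H_bc \<omega>" "(u, f) \<in> H_bc \<omega>"
    then have h: "(v, g) \<in> Hmax" "(u, f) \<in> Hmax" "s\<^sub>p v = \<omega> * s\<^sub>m v" "s\<^sub>p u = \<omega> * s\<^sub>m u" by (auto simp: H_bc_def)
    have "s\<^sub>p u * cnj (s\<^sub>p v) = (\<omega> * cnj \<omega>) * (s\<^sub>m u * cnj (s\<^sub>m v))" using h by simp
    then have "cinner f v - cinner u g = 0" using green[OF h(2,1)] \<omega>1 by simp
    then show "cinner f v = cinner u g" by simp
  qed
  \<comment> \<open>Testing against one element with boundary values \<open>(\<omega>, 1)\<close> suffices.\<close>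
  show "adjoint_op (H_bc \<omega>) \<subseteq> H_bc \<omega>"
  proof clarify
    fix v g assume vg: "(v, g) \<in> adjoint_op (H_bc \<omega>)"
    have "H0 \<subseteq> H_bc \<omega>" using H0 by (auto simp: H_bc_def)
    then have vm: "(v, g) \<in> Hmax" using vg unfolding Hmax adjoint_op_def by blast
    obtain u f where u: "(u, f) \<in> Hmax" "s\<^sub>p u = \<omega>" "s\<^sub>m u = 1" using surj[of \<omega> 1] by auto
    then have "(u, f) \<in> H_bc \<omega>" by (simp add: H_bc_def)
    then have "cinner f v - cinner u g = 0" using vg by (auto simp: adjoint_op_def)
    then have "\<omega> * cnj (s\<^sub>p v) = cnj (s\<^sub>m v)" using green[OF u(1) vm] \<kappa> u by simp
    then have "cnj (\<omega> * cnj (s\<^sub>p v)) = s\<^sub>m v" by simp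
    then have "\<omega> * s\<^sub>m v = (\<omega> * cnj \<omega>) * s\<^sub>p v" by auto
    then have "s\<^sub>p v = \<omega> * s\<^sub>m v" using \<omega>1 by simp
    then show "(v, g) \<in> H_bc \<omega>" using vm by (simp add: H_bc_def)
  qed
qed

theorem self_adjoint_H_bc: assumes \<omega>: "cmod \<omega> = 1" shows "self_adjoint_op (H_bc \<omega>)"
  unfolding self_adjoint_op_def
proof (intro conjI)
  have zero: "(0, 0) \<in> Hmax" by (simp add: Hmax adjoint_op_def)
  then have "s\<^sub>p 0 = 0 \<and> s\<^sub>m 0 = 0" using scale[of 0 0 0] by simp
  then have "(0, 0) \<in> H_bc \<omega>" using zero by (simp add: H_bc_def)
  moreover have "(u + v, f + g) \<in> H_bc \<omega>" if "(u, f) \<in> H_bc \<omega>" "(v, g) \<in> H_bc \<omega>" for u f v g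
    using that Hmax_add[of u f v g] add[of u f v g] by (simp add: H_bc_def distrib_left)
  moreover have "(cscale c u, cscale c f) \<in> H_bc \<omega>" if "(u, f) \<in> H_bc \<omega>" for c u f
    using that Hmax_scale[of u f c] scale[of u f c] by (simp add: H_bc_def mult.left_commute)
  moreover have "single_valued (H_bc \<omega>)"
    unfolding single_valued_def H_bc_def using Hmax_single_valued by blast
  ultimately show "linear_operator (H_bc \<omega>)" unfolding linear_operator_def by auto
  have "Domain H0 \<subseteq> Domain (H_bc \<omega>)" using H0 by (fastforce simp: H_bc_def)
  then show "closure (Domain (H_bc \<omega>)) = UNIV" using dense closure_mono by blast
  show "adjoint_op (H_bc \<omega>) = H_bc \<omega>" by (rule adjoint_H_bc[OF \<omega>])
qed

text \<open>On a symmetric restriction the form vanishes, so \<open>|s\<^sub>p| = |s\<^sub>m|\<close> there.  Not both functionals can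
  vanish identically on \<open>H\<close>, for otherwise \<open>Hmax\<close> would be contained in the adjoint of \<open>H\<close>, which is
  \<open>H\<close>, whereas the functionals map \<open>Hmax\<close> onto \<open>\<complex>\<^sup>2\<close>.  One element with nonzero boundary values determines \<open>\<omega>\<close> and forces all others onto the same
  line; equality follows by taking adjoints.\<close>

theorem self_adjoint_restriction_eq_H_bc:
  assumes H: "self_adjoint_op H" "H \<subseteq> Hmax"
  shows "\<exists>\<omega>. cmod \<omega> = 1 \<and> H = H_bc \<omega>"
proof -
  have adj: "adjoint_op H = H" using H by (simp add: self_adjoint_op_def)
  have iso: "s\<^sub>p u * cnj (s\<^sub>p v) = s\<^sub>m u * cnj (s\<^sub>m v)" if "(u, f) \<in> H" "(v, g) \<in> H" for u f v g
  proof -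
    have "(v, g) \<in> adjoint_op H" using that adj by simp
    then have "cinner f v - cinner u g = 0" using that by (auto simp: adjoint_op_def)
    then show ?thesis using green[of u f v g] that H(2) \<kappa> by auto
  qed
  have "\<exists>(u, f)\<in>H. s\<^sub>p u \<noteq> 0 \<or> s\<^sub>m u \<noteq> 0"
  proof (rule ccontr)
    assume "\<not> ?thesis"
    then have z: "s\<^sub>p u = 0 \<and> s\<^sub>m u = 0" if "(u, f) \<in> H" for u f using that by auto
    have "Hmax \<subseteq> adjoint_op H"
    proof (clarsimp simp: adjoint_op_def)
      fix v g u f assume h: "(v, g) \<in> Hmax" "(u, f) \<in> H"
      then have "cinner f v - cinner u g = 0" using green[of u f v g] z[OF h(2)] H(2) by auto
      then show "cinner f v = cinner u g" by simp
    qed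
    then have "Hmax \<subseteq> H" using adj by simp
    moreover obtain u f where "(u, f) \<in> Hmax" "s\<^sub>p u = 1" using surj[of 1 0] by auto
    ultimately show False using z by fastforce
  qed
  then obtain u f where u: "(u, f) \<in> H" "s\<^sub>p u \<noteq> 0 \<or> s\<^sub>m u \<noteq> 0" by auto
  have "complex_of_real ((cmod (s\<^sub>p u))\<^sup>2) = complex_of_real ((cmod (s\<^sub>m u))\<^sup>2)"
    using iso[OF u(1) u(1)] by (simp only: complex_norm_square)
  then have "(cmod (s\<^sub>p u))\<^sup>2 = (cmod (s\<^sub>m u))\<^sup>2" by (simp only: of_real_eq_iff)
  then have n: "cmod (s\<^sub>p u) = cmod (s\<^sub>m u)" by simp
  then have nz: "s\<^sub>m u \<noteq> 0" "s\<^sub>p u \<noteq> 0" using u(2) by auto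
  define \<omega> where "\<omega> = s\<^sub>p u / s\<^sub>m u"
  have \<omega>: "cmod \<omega> = 1" using n nz by (simp add: \<omega>_def norm_divide)
  have sub: "H \<subseteq> H_bc \<omega>"
  proof clarify
    fix v g assume v: "(v, g) \<in> H"
    have "s\<^sub>m v * cnj (s\<^sub>m u) = s\<^sub>p v * cnj (s\<^sub>p u)" using iso[OF v u(1)] by simp
    also have "s\<^sub>p u = \<omega> * s\<^sub>m u" using nz by (simp add: \<omega>_def)
    finally have "s\<^sub>m v = s\<^sub>p v * cnj \<omega>" using nz by simp
    then have "\<omega> * s\<^sub>m v = (\<omega> * cnj \<omega>) * s\<^sub>p v" by simp
    then show "(v, g) \<in> H_bc \<omega>" using v H(2) unit_mult_cnj[OF \<omega>] by (auto simp: H_bc_def)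
  qed
  have "H_bc \<omega> = adjoint_op (H_bc \<omega>)" by (simp add: adjoint_H_bc[OF \<omega>])
  also have "\<dots> \<subseteq> adjoint_op H" using sub unfolding adjoint_op_def by blast
  finally show ?thesis using sub \<omega> adj by blast
qed

end

section \<open>Asymptotic coefficients as boundary values\<close>

context SL_problem begin

text \<open>The phase is continuous and unbounded, so it passes through \<open>\<tau> + 2 \<pi> k\<close> for large \<open>k\<close>.\<close>

lemma phase_attains: obtains x where "x \<ge> X" "x \<ge> x0" "exp (\<i> * of_real (\<Xi> x)) = exp (\<i> * of_real \<tau>)" "exp (- \<i> * of_real (\<Xi> x)) = exp (- \<i> * of_real \<tau>)"
proof -
  define Y where "Y = max X x0"
  obtain k :: nat where k: "real k \<ge> (\<Xi> Y - \<tau>) / (2 * pi)" using real_arch_simple by blast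
  define v where "v = \<tau> + 2 * pi * real k"
  have v: "v \<ge> \<Xi> Y" using k pi_gt_zero by (simp add: v_def field_simps)
  have "\<forall>\<^sub>F z in at_top. \<Xi> z \<ge> v \<and> z \<ge> Y"
    using \<Xi>_at_top eventually_ge_at_top[of Y] by (auto simp: filterlim_at_top intro: eventually_conj)
  then obtain Z where Z: "\<Xi> Z \<ge> v" "Z \<ge> Y" unfolding eventually_at_top_linorder by auto
  have "continuous_on {Y..Z} \<Xi>" by (rule continuous_on_subset[OF \<Xi>_cont]) (auto simp: Y_def)
  then obtain x where x: "Y \<le> x" "x \<le> Z" "\<Xi> x = v" using IVT'[of \<Xi> Y v Z] v Z by auto
  have e: "exp (\<i> * of_real (2 * pi * real k)) = 1" "exp (- \<i> * of_real (2 * pi * real k)) = 1"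
    by (auto simp: exp_eq_1 exp_minus intro: exI[of _ "int k"])
  show ?thesis
  proof (rule that[of x])
    show "x \<ge> X" "x \<ge> x0" using x by (auto simp: Y_def)
    have "exp (\<i> * of_real (\<Xi> x)) = exp (\<i> * of_real \<tau>) * exp (\<i> * of_real (2 * pi * real k))"
      unfolding x(3) v_def by (simp only: of_real_add distrib_left exp_add)
    then show "exp (\<i> * of_real (\<Xi> x)) = exp (\<i> * of_real \<tau>)" unfolding e by simp
    have "exp (- \<i> * of_real (\<Xi> x)) = exp (- \<i> * of_real \<tau>) * exp (- \<i> * of_real (2 * pi * real k))"
      unfolding x(3) v_def by (simp only: of_real_add distrib_left exp_add)
    then show "exp (- \<i> * of_real (\<Xi> x)) = exp (- \<i> * of_real \<tau>)" unfolding e by simp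
  qed
qed

lemma oscillation_unique:
  assumes l: "((\<lambda>x. d * exp (\<i> * of_real (\<Xi> x)) + e * exp (- \<i> * of_real (\<Xi> x))) \<longlongrightarrow> 0) at_top"
  shows "d = 0 \<and> e = 0"
proof -
  have z: "d * exp (\<i> * of_real \<tau>) + e * exp (- \<i> * of_real \<tau>) = 0" for \<tau>
  proof (rule ccontr)
    let ?n = "cmod (d * exp (\<i> * of_real \<tau>) + e * exp (- \<i> * of_real \<tau>))"
    assume "\<not> ?thesis"
    then have n: "?n > 0" by simp
    from tendstoD[OF l n] obtain X where X: "\<And>x. x \<ge> X \<Longrightarrow> cmod (d * exp (\<i> * of_real (\<Xi> x)) + e * exp (- \<i> * of_real (\<Xi> x))) < ?n"
      unfolding eventually_at_top_linorder dist_norm by auto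
    obtain x where "x \<ge> X" "exp (\<i> * of_real (\<Xi> x)) = exp (\<i> * of_real \<tau>)" "exp (- \<i> * of_real (\<Xi> x)) = exp (- \<i> * of_real \<tau>)"
      by (rule phase_attains)
    with X[of x] show False by simp
  qed
  have "d + e = 0" using z[of 0] by simp
  moreover have "d * \<i> + e * (- \<i>) = 0"
  proof -
    have "exp (\<i> * of_real (pi / 2)) = \<i>" "exp (- \<i> * of_real (pi / 2)) = - \<i>"
      by (simp_all add: complex_eq_iff Re_exp Im_exp)
    with z[of "pi / 2"] show ?thesis by simp
  qed
  then have "\<i> * (d - e) = 0" by (simp add: algebra_simps)
  then have "d = e" by simp
  ultimately show ?thesis by simp
qed

lemma has_asymptotics_unique:
  assumes "has_asymptotics p q x0 u s m" "has_asymptotics p q x0 u s' m'"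
  shows "s' = s \<and> m' = m"
proof -
  let ?E = "\<lambda>x. exp (\<i> * of_real (\<Xi> x))" and ?F = "\<lambda>x. exp (- \<i> * of_real (\<Xi> x))"
  obtain f r where f: "square_integrable f" "L2_of f = u" "continuous_on {0<..} f" "(r \<longlongrightarrow> 0) at_top"
    "\<And>x. x \<ge> x0 \<Longrightarrow> f x = of_real (a x) * (s * ?E x + m * ?F x + r x)"
    using assms(1) unfolding has_asymptotics_def by blast
  obtain g t where g: "square_integrable g" "L2_of g = u" "continuous_on {0<..} g" "(t \<longlongrightarrow> 0) at_top"
    "\<And>x. x \<ge> x0 \<Longrightarrow> g x = of_real (a x) * (s' * ?E x + m' * ?F x + t x)"
    using assms(2) unfolding has_asymptotics_def by blast
  have "AE x in halfline. f x = g x" using L2_of_eq_iff[OF f(1) g(1)] f(2) g(2) by simp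
  then have fg: "f x = g x" if "x > 0" for x using AE_halfline_continuous_eq f(3) g(3) that by blast
  have "((\<lambda>x. r x - t x) \<longlongrightarrow> 0 - 0) at_top" by (intro tendsto_intros f g)
  moreover have "\<forall>\<^sub>F x in at_top. r x - t x = (s' - s) * ?E x + (m' - m) * ?F x"
  proof (rule eventually_mono[OF eventually_ge_at_top[of x0]])
    fix x assume x: "x \<ge> x0"
    have "of_real (a x) * (s * ?E x + m * ?F x + r x) = of_real (a x) * (s' * ?E x + m' * ?F x + t x)"
      using fg[of x] f(5)[OF x] g(5)[OF x] x x0_pos by simp
    then have "s * ?E x + m * ?F x + r x = s' * ?E x + m' * ?F x + t x" using a_pos[OF x] by simp
    then show "r x - t x = (s' - s) * ?E x + (m' - m) * ?F x" by (simp add: algebra_simps)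
  qed
  ultimately have "((\<lambda>x. (s' - s) * ?E x + (m' - m) * ?F x) \<longlongrightarrow> 0 - 0) at_top" by (rule Lim_transform_eventually)
  then show ?thesis using oscillation_unique[of "s' - s" "m' - m"] by simp
qed

lemma s_plus_minus_eq:
  assumes "has_asymptotics p q x0 u s m"
  shows "s_plus p q x0 u = s" "s_minus p q x0 u = m"
proof -
  have "(THE (s\<^sub>p, s\<^sub>m). has_asymptotics p q x0 u s\<^sub>p s\<^sub>m) = (s, m)"
  proof (rule the_equality)
    fix z assume "case z of (s\<^sub>p, s\<^sub>m) \<Rightarrow> has_asymptotics p q x0 u s\<^sub>p s\<^sub>m"
    then show "z = (s, m)" using has_asymptotics_unique[OF assms] by (cases z) simp
  qed (use assms in simp)
  then show "s_plus p q x0 u = s" "s_minus p q x0 u = m" by (simp_all add: s_plus_def s_minus_def)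
qed

end

context SL_fundamental begin

text \<open>At infinity the first integral in \<open>G g\<close> converges to \<open>\<langle>g, \<phi>\<rangle>\<close> and the second one to \<open>0\<close>, while
  \<open>\<phi> / a\<close> and \<open>\<theta> / a\<close> stay bounded.\<close>

lemma max_element_asymptotics:
  assumes g: "square_integrable g"
    and s\<phi>: "((\<lambda>x. of_real (\<phi> x / a x) - wave s\<phi> x) \<longlongrightarrow> 0) at_top"
    and s\<theta>: "((\<lambda>x. of_real (\<theta> x / a x) - wave s\<theta> x) \<longlongrightarrow> 0) at_top"
  shows "has_asymptotics p q x0 (max_element g c) (cinner (L2_of g) \<Phi> * s\<theta> + c * s\<phi>) (cinner (L2_of g) \<Phi> * cnj s\<theta> + c * cnj s\<phi>)"
proof -
  let ?A = "cinner (L2_of g) \<Phi>"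
  let ?E = "\<lambda>x. exp (\<i> * of_real (\<Xi> x))" and ?F = "\<lambda>x. exp (- \<i> * of_real (\<Xi> x))"
  define I where "I x = integral {0..x} (\<lambda>t. \<phi>c t * g t)" for x
  define J where "J x = integral\<^sup>L halfline (\<lambda>t. \<theta>c t * g t) - integral {0..x} (\<lambda>t. \<theta>c t * g t)" for x
  note int = integrable_solution_mult[OF g]
  have I: "((\<lambda>x. I x - ?A) \<longlongrightarrow> 0) at_top"
    unfolding I_def cinner_\<Phi>[OF g] by (rule LIM_zero[OF integral_Icc_tendsto[OF int(1)]])
  have "(J \<longlongrightarrow> integral\<^sup>L halfline (\<lambda>t. \<theta>c t * g t) - integral\<^sup>L halfline (\<lambda>t. \<theta>c t * g t)) at_top"
    unfolding J_def[abs_def] by (rule tendsto_diff[OF tendsto_const integral_Icc_tendsto[OF int(2)]])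
  then have J: "(J \<longlongrightarrow> 0) at_top" by simp
  have bdd: "Bfun (\<lambda>x. complex_of_real (u x / a x)) at_top" if h: "solution u w" for u w
  proof -
    obtain X K where "\<And>x. x \<ge> X \<Longrightarrow> \<bar>scaled u x\<bar> \<le> K" using scaled_bounded[OF h] by metis
    then have "norm (complex_of_real (u x / a x)) \<le> K" if "x \<ge> X" for x
      using that unfolding norm_of_real scaled_def by blast
    then show ?thesis by (intro BfunI[where K = K] eventually_mono[OF eventually_ge_at_top[of X]]) auto
  qed
  have prod0: "((\<lambda>x. b x * z x) \<longlongrightarrow> 0) at_top" if "Bfun b at_top" "(z \<longlongrightarrow> 0) at_top" for b z :: "real \<Rightarrow> complex"
    using bounded_bilinear.Bfun_prod_Zfun[OF bounded_bilinear_mult that(1)] that(2) by (simp add: tendsto_Zfun_iff)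
  define r where "r x = (green_op g x + c * \<phi>c x) / of_real (a x) - ((?A * s\<theta> + c * s\<phi>) * ?E x + (?A * cnj s\<theta> + c * cnj s\<phi>) * ?F x)" for x
  have r_eq: "r x = of_real (\<theta> x / a x) * (I x - ?A) + of_real (\<phi> x / a x) * J x
     + ?A * (of_real (\<theta> x / a x) - wave s\<theta> x) + c * (of_real (\<phi> x / a x) - wave s\<phi> x)" for x
  proof -
    have "(green_op g x + c * \<phi>c x) / of_real (a x) = of_real (\<theta> x / a x) * I x + of_real (\<phi> x / a x) * J x + c * of_real (\<phi> x / a x)"
      by (simp add: green_op_def I_def J_def \<phi>c_def \<theta>c_def add_divide_distrib)
    then show ?thesis unfolding r_def wave_def by (simp add: algebra_simps del: of_real_divide)
  qed
  have "(r \<longlongrightarrow> 0 + 0 + ?A * 0 + c * 0) at_top"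
    unfolding r_eq[abs_def] by (intro tendsto_intros prod0 bdd[OF sol_\<phi>] bdd[OF sol_\<theta>] I J s\<phi> s\<theta>)
  then have "(r \<longlongrightarrow> 0) at_top" by simp
  moreover have "green_op g x + c * \<phi>c x = of_real (a x) * ((?A * s\<theta> + c * s\<phi>) * ?E x + (?A * cnj s\<theta> + c * cnj s\<phi>) * ?F x + r x)" if "x \<ge> x0" for x
    using a_pos[OF that] by (simp add: r_def)
  moreover have "continuous_on {0<..} (\<lambda>x. green_op g x + c * \<phi>c x)"
    by (intro continuous_intros continuous_on_subset[OF green_op_cont[OF g]] continuous_on_subset[OF cont_c(1)]) auto
  ultimately show ?thesis
    unfolding has_asymptotics_def using max_element_square_integrable[OF g]
    by (intro exI[of _ "\<lambda>x. green_op g x + c * \<phi>c x"] exI[of _ r]) (simp add: max_element_def)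
qed

text \<open>All requirements reduce to linear algebra for the pair \<open>(\<langle>g, \<phi>\<rangle>, c)\<close>: the boundary form is
  \<open>A cnj d - c cnj B\<close>, and the linear map from this pair to the coefficients has determinant \<open>D\<close>, where
  \<open>D = \<i>/2\<close> comes from the Wronskian.\<close>

theorem boundary_pair_SL: "\<exists>\<kappa>. boundary_pair (H00 p q \<alpha>) (H_max p q \<alpha>) (s_plus p q x0) (s_minus p q x0) \<kappa>"
proof -
  have W': "\<phi> x * w\<theta> x - \<theta> x * w\<phi> x = -1" if "x > 0" for x using W[of x] that by simp
  obtain s\<phi> s\<theta> where s\<phi>: "((\<lambda>x. of_real (\<phi> x / a x) - wave s\<phi> x) \<longlongrightarrow> 0) at_top"
    and s\<theta>: "((\<lambda>x. of_real (\<theta> x / a x) - wave s\<theta> x) \<longlongrightarrow> 0) at_top"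
    and Im: "Im (s\<phi> * cnj s\<theta>) = (-1) / 4"
    using solution_asymptotics[OF sol_\<phi> sol_\<theta> W'] by blast
  define D where "D = s\<theta> * cnj s\<phi> - cnj s\<theta> * s\<phi>"
  have D: "D = \<i> / 2" using Im by (simp add: D_def complex_eq_iff algebra_simps)
  have sp: "s_plus p q x0 (max_element g c) = cinner (L2_of g) \<Phi> * s\<theta> + c * s\<phi>"
    and sm: "s_minus p q x0 (max_element g c) = cinner (L2_of g) \<Phi> * cnj s\<theta> + c * cnj s\<phi>" if "square_integrable g" for g c
    using s_plus_minus_eq[OF max_element_asymptotics[OF that s\<phi> s\<theta>, of c]] by auto
  have Hm: "\<exists>g c. square_integrable g \<and> u = max_element g c \<and> f = L2_of g" if "(u, f) \<in> H_max p q \<alpha>" for u f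
    using that unfolding H_max_eq by auto
  have el_add: "max_element g c + max_element h d = max_element (\<lambda>x. g x + h x) (c + d)" if "square_integrable g" "square_integrable h" for g h c d
  proof -
    have "green_op (\<lambda>x. g x + h x) x = green_op g x + green_op h x" if "x > 0" for x
      using \<open>square_integrable g\<close> \<open>square_integrable h\<close> that
      by (simp add: green_op_kernel square_integrable_add distrib_left)
    then show ?thesis unfolding max_element_def using that
      by (subst L2_of_add[OF max_element_square_integrable max_element_square_integrable])
         (auto intro!: L2_of_cong square_integrable_add square_integrable_cmult green_op_square_integrable sq_\<phi> simp: algebra_simps)
  qed
  have el_scale: "cscale k (max_element g c) = max_element (\<lambda>x. k * g x) (k * c)" if "square_integrable g" for g k c
  proof -
    have "green_op (\<lambda>x. k * g x) x = k * green_op g x" for x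
      by (simp add: green_op_def mult.left_commute[of _ k] algebra_simps)
    then show ?thesis unfolding max_element_def using that
      by (subst cscale_L2_of[OF max_element_square_integrable]) (auto simp: algebra_simps)
  qed
  have "boundary_pair (H00 p q \<alpha>) (H_max p q \<alpha>) (s_plus p q x0) (s_minus p q x0) (1 / D)"
  proof
    show "H_max p q \<alpha> = adjoint_op (H00 p q \<alpha>)" unfolding H_max_def H_min_def by (rule adjoint_closure)
    show "closure (Domain (H00 p q \<alpha>)) = UNIV" by (rule H00_domain_dense)
    show "1 / D \<noteq> 0" by (simp add: D)
    show "(u, f) \<in> H_max p q \<alpha> \<and> s_plus p q x0 u = 0 \<and> s_minus p q x0 u = 0" if h: "(u, f) \<in> H00 p q \<alpha>" for u f
    proof -
      obtain g where g: "square_integrable g" "f = L2_of g" "u = L2_of (green_op g)" "cinner f \<Phi> = 0" by (rule H00_elim[OF h])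
      have "u = max_element g 0" using g by (simp add: max_element_eq)
      then show ?thesis using g sp[OF g(1), of 0] sm[OF g(1), of 0] by (auto simp: H_max_eq)
    qed
    show "s_plus p q x0 (u + v) = s_plus p q x0 u + s_plus p q x0 v \<and> s_minus p q x0 (u + v) = s_minus p q x0 u + s_minus p q x0 v"
      if uv: "(u, f) \<in> H_max p q \<alpha>" "(v, h) \<in> H_max p q \<alpha>" for u f v h
    proof -
      obtain g c where g: "square_integrable g" "u = max_element g c" using Hm[OF uv(1)] by blast
      obtain k d where k: "square_integrable k" "v = max_element k d" using Hm[OF uv(2)] by blast
      show ?thesis unfolding g(2) k(2) el_add[OF g(1) k(1)] sp[OF square_integrable_add[OF g(1) k(1)]] sm[OF square_integrable_add[OF g(1) k(1)]]
          sp[OF g(1)] sp[OF k(1)] sm[OF g(1)] sm[OF k(1)]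
        by (simp add: L2_of_add[OF g(1) k(1), symmetric] cinner_add_left algebra_simps)
    qed
    show "s_plus p q x0 (cscale k u) = k * s_plus p q x0 u \<and> s_minus p q x0 (cscale k u) = k * s_minus p q x0 u"
      if uf: "(u, f) \<in> H_max p q \<alpha>" for u f k
    proof -
      obtain g c where g: "square_integrable g" "u = max_element g c" using Hm[OF uf] by blast
      show ?thesis unfolding g(2) el_scale[OF g(1)] sp[OF square_integrable_cmult[OF g(1)]] sm[OF square_integrable_cmult[OF g(1)]]
          sp[OF g(1)] sm[OF g(1)]
        by (simp add: cscale_L2_of[OF g(1), symmetric] cinner_cscale_left algebra_simps)
    qed
    show "\<exists>(u, f)\<in>H_max p q \<alpha>. s_plus p q x0 u = x \<and> s_minus p q x0 u = y" for x y
    proof -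
      \<comment> \<open>Cramer's rule; \<open>A\<close> is realised as \<open>\<langle>g, \<phi>\<rangle>\<close> by a multiple \<open>g\<close> of \<open>\<phi>\<close>.\<close>
      define A where "A = (x * cnj s\<phi> - y * s\<phi>) / D"
      define c where "c = (y * s\<theta> - x * cnj s\<theta>) / D"
      define k where "k = A / cinner \<Phi> \<Phi>"
      have "cinner \<Phi> \<Phi> \<noteq> 0" using \<Phi>_nonzero cinner_self_eq_0[of \<Phi>] by auto
      have sq: "square_integrable (\<lambda>x. k * \<phi>c x)" by (intro square_integrable_cmult sq_\<phi>)
      have A: "cinner (L2_of (\<lambda>x. k * \<phi>c x)) \<Phi> = A"
        unfolding cscale_L2_of[OF sq_\<phi>, symmetric] \<Phi>_def[symmetric] cinner_cscale_left
        using \<open>cinner \<Phi> \<Phi> \<noteq> 0\<close> by (simp add: k_def)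
      have Dnz: "D \<noteq> 0" by (simp add: D)
      have 1: "A * s\<theta> + c * s\<phi> = x"
      proof -
        have "D * (A * s\<theta> + c * s\<phi>) = (x * cnj s\<phi> - y * s\<phi>) * s\<theta> + (y * s\<theta> - x * cnj s\<theta>) * s\<phi>"
          using Dnz by (simp add: A_def c_def distrib_left)
        also have "\<dots> = D * x" by (simp add: D_def algebra_simps)
        finally show ?thesis using Dnz by simp
      qed
      have 2: "A * cnj s\<theta> + c * cnj s\<phi> = y"
      proof -
        have "D * (A * cnj s\<theta> + c * cnj s\<phi>) = (x * cnj s\<phi> - y * s\<phi>) * cnj s\<theta> + (y * s\<theta> - x * cnj s\<theta>) * cnj s\<phi>"
          using Dnz by (simp add: A_def c_def distrib_left)
        also have "\<dots> = D * y" by (simp add: D_def algebra_simps)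
        finally show ?thesis using Dnz by simp
      qed
      have "(max_element (\<lambda>x. k * \<phi>c x) c, L2_of (\<lambda>x. k * \<phi>c x)) \<in> H_max p q \<alpha>" using sq by (auto simp: H_max_eq)
      moreover have "s_plus p q x0 (max_element (\<lambda>x. k * \<phi>c x) c) = x" "s_minus p q x0 (max_element (\<lambda>x. k * \<phi>c x) c) = y"
        unfolding sp[OF sq] sm[OF sq] A by (rule 1 2)+
      ultimately show ?thesis by blast
    qed
    show "cinner f v - cinner u h = 1 / D * (s_plus p q x0 u * cnj (s_plus p q x0 v) - s_minus p q x0 u * cnj (s_minus p q x0 v))"
      if uv: "(u, f) \<in> H_max p q \<alpha>" "(v, h) \<in> H_max p q \<alpha>" for u f v h
    proof -
      obtain g c where g: "square_integrable g" "u = max_element g c" "f = L2_of g" using Hm[OF uv(1)] by blast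
      obtain k d where k: "square_integrable k" "v = max_element k d" "h = L2_of k" using Hm[OF uv(2)] by blast
      define A B where "A = cinner f \<Phi>" and "B = cinner h \<Phi>"
      have "cinner \<Phi> h = cnj B" unfolding B_def by (rule cinner_commute)
      then have "cinner f v - cinner u h = A * cnj d - c * cnj B"
        using green_op_symmetric[OF g(1) k(1)]
        by (simp add: g(2,3) k(2,3) max_element_eq g(1) k(1) cinner_add_right cinner_add_left cinner_cscale_right cinner_cscale_left A_def B_def)
      moreover have "s_plus p q x0 u * cnj (s_plus p q x0 v) - s_minus p q x0 u * cnj (s_minus p q x0 v) = D * (A * cnj d - c * cnj B)"
        unfolding g(2) k(2) sp[OF g(1)] sp[OF k(1)] sm[OF g(1)] sm[OF k(1)]
        unfolding g(3)[symmetric] k(3)[symmetric] A_def[symmetric] B_def[symmetric] D_def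
        by (simp add: algebra_simps)
      moreover have "D \<noteq> 0" by (simp add: D)
      ultimately show ?thesis by simp
    qed
  qed
  then show ?thesis ..
qed

end

theorem (in SL_problem) H_omega_classification:
  "(\<forall>\<omega>. cmod \<omega> = 1 \<longrightarrow> self_adjoint_op (H_omega p q \<alpha> x0 \<omega>)) \<and>
    (\<forall>H. self_adjoint_op H \<and> H \<subseteq> H_max p q \<alpha> \<longrightarrow> (\<exists>\<omega>. cmod \<omega> = 1 \<and> H = H_omega p q \<alpha> x0 \<omega>))"
proof -
  obtain \<phi> w\<phi> where \<phi>: "solution \<phi> w\<phi>" "continuous_on {0..} \<phi>" "continuous_on {0..} w\<phi>"
    "\<phi> 0 = (case \<alpha> of None \<Rightarrow> 0 | Some r \<Rightarrow> 1)" "w\<phi> 0 = (case \<alpha> of None \<Rightarrow> 1 | Some r \<Rightarrow> p0 * r)"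
    by (rule solution_exists)
  \<comment> \<open>The initial values of \<open>\<theta>\<close> make the Wronskian at \<open>0\<close> equal to \<open>-1\<close> in both cases.\<close>
  obtain \<theta> w\<theta> where \<theta>: "solution \<theta> w\<theta>" "continuous_on {0..} \<theta>" "continuous_on {0..} w\<theta>"
    "\<theta> 0 = (case \<alpha> of None \<Rightarrow> 1 | Some r \<Rightarrow> 0)" "w\<theta> 0 = (case \<alpha> of None \<Rightarrow> 0 | Some r \<Rightarrow> -1)"
    by (rule solution_exists)
  interpret SL_fundamental p q a' pa'' p0 q0 x0 \<alpha> \<phi> w\<phi> \<theta> w\<theta>
    by unfold_locales (use \<phi> \<theta> in \<open>auto split: option.splits\<close>)
  obtain \<kappa> where "boundary_pair (H00 p q \<alpha>) (H_max p q \<alpha>) (s_plus p q x0) (s_minus p q x0) \<kappa>"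
    using boundary_pair_SL by blast
  then interpret B: boundary_pair "H00 p q \<alpha>" "H_max p q \<alpha>" "s_plus p q x0" "s_minus p q x0" \<kappa> .
  have "H_omega p q \<alpha> x0 \<omega> = B.H_bc \<omega>" for \<omega> by (simp add: H_omega_def B.H_bc_def)
  then show ?thesis using B.self_adjoint_H_bc B.self_adjoint_restriction_eq_H_bc by simp
qed

theorem theorem4p4:
  fixes p q a' pa'' :: "real \<Rightarrow> real" and p0 q0 x0 :: real and \<alpha> :: "real option"
  assumes p_C1: "p C1_differentiable_on {0<..}"
    and q_cont: "continuous_on {0<..} q"
    and p_lim: "(p \<longlongrightarrow> p0) (at_right 0)"
    and q_lim: "(q \<longlongrightarrow> q0) (at_right 0)"
    and p_pos: "p0 > 0" "\<And>x. x > 0 \<Longrightarrow> p x > 0"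
    and x0_pos: "x0 > 0"
    and q_pos: "\<And>x. x \<ge> x0 \<Longrightarrow> q x > 0"
    \<comment> \<open>\<open>a'\<close> is the derivative of \<open>a = amp p q\<close> on \<open>[x0,\<infinity>)\<close>, one-sided at \<open>x0\<close>\<close>
    and a_deriv: "\<And>x. x \<ge> x0 \<Longrightarrow> (amp p q has_real_derivative a' x) (at x within {x0..})"
    and a_C1: "continuous_on {x0..} a'"
    and a'_ac: "locally_abs_continuous_on {x0..} a'"
    \<comment> \<open>\<open>pa''\<close> is \<open>(pa')'\<close>, which exists almost everywhere since \<open>pa'\<close> is locally
        absolutely continuous\<close>
    and pa'_deriv: "AE x in lebesgue_on {x0<..}. ((\<lambda>y. p y * a' y) has_real_derivative pa'' x) (at x)"
    and a_L2: "integrable (lebesgue_on {x0<..}) (\<lambda>x. (amp p q x)\<^sup>2)"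
    and apa''_L1: "integrable (lebesgue_on {x0<..}) (\<lambda>x. amp p q x * pa'' x)"
    and paa'_lim: "((\<lambda>x. p x * a' x * amp p q x) \<longlongrightarrow> 0) at_top"
  shows "(\<forall>\<omega>. cmod \<omega> = 1 \<longrightarrow> self_adjoint_op (H_omega p q \<alpha> x0 \<omega>)) \<and>
    (\<forall>H. H_min p q \<alpha> \<subseteq> H \<and> self_adjoint_op H \<and> H \<subseteq> H_max p q \<alpha>
       \<longrightarrow> (\<exists>\<omega>. cmod \<omega> = 1 \<and> H = H_omega p q \<alpha> x0 \<omega>))"
proof -
  interpret SL_problem p q a' pa'' p0 q0 x0
    by unfold_locales (fact assms)+
  show ?thesis using H_omega_classification[of \<alpha>] by blast
qed

end
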